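(* Let $v_0,v_1$ be real-valued functions in $L_1(\mathbb{R})$ such that for every $\varkappa>0$, $v_j(x)=O(e^{-\varkappa|x|})$ as $|x|\to\infty$, $j=0,1$. Suppose $\lambda=k^4$, $k>0$, is not an eigenvalue of $H$. Then the asymptotic coefficients $s_{jl}(\lambda)$ and $b_{jl}(\lambda)$ of the wave functions $\psi_1,\psi_2$ satisfy $$\begin{pmatrix}s_{11}&s_{12}\\ s_{21}&s_{22}\end{pmatrix}\begin{pmatrix}\overline{b_{11}}&\overline{b_{21}}\\ \overline{b_{12}}&\overline{b_{22}}\end{pmatrix}=\begin{pmatrix}b_{12}&b_{22}\\ b_{11}&b_{21}\end{pmatrix}.$$
   Context: $D=-i\,d/dx$; $H$ is the self-adjoint operator in $L_2(\mathbb{R})$ associated with $h[u,u]=\int(|u''|^2+v_1|u'|^2+v_0|u|^2)dx$ on $\mathsf{H}^2(\mathbb{R})$, $R(z)=(H-z)^{-1}$, $V=Dv_1D+v_0$. With $\varphi_1(x)=e^{ikx}$, $\varphi_2(x)=e^{-ikx}$, the wave functions are $\psi_j=\varphi_j-R(\lambda+i0)V\varphi_j$ ($R(\lambda+i0)V\varphi_j=\lim_{\varepsilon\downarrow0}R(\lambda+i\varepsilon)V\varphi_j$), and $s_{jl}(\lambda)=\delta_{jl}-\frac{i}{4k^3}\int(v_1\psi_l'\overline{\varphi_j'}+v_0\psi_l\overline{\varphi_j})dx$ are the entries of the scattering matrix of the pair $D^4,H$. Under the stated hypotheses there are unique complex numbers $b_{jl}(\lambda)$ such that, for every $\varkappa>0$: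 $\psi_1=s_{11}e^{ikx}+b_{11}e^{-kx}+O(e^{-\varkappa x})$ as $x\to\infty$; $\psi_1=e^{ikx}+s_{21}e^{-ikx}+b_{21}e^{kx}+O(e^{\varkappa x})$ as $x\to-\infty$; $\psi_2=e^{-ikx}+s_{12}e^{ikx}+b_{12}e^{-kx}+O(e^{-\varkappa x})$ as $x\to\infty$; $\psi_2=s_{22}e^{-ikx}+b_{22}e^{kx}+O(e^{\varkappa x})$ as $x\to-\infty$. *)

theory Defs
  imports "HOL-Analysis.Analysis" "HOL-Library.Landau_Symbols"
begin

text \<open>Sobolev space H^2(R): u is C^1 with derivative u1, u1 is absolutely continuous
  with (a.e.) derivative u2 (locally integrable), and u, u1, u2 are in L2(R).\<close>
definition H2 :: "(real \<Rightarrow> complex) \<Rightarrow> (real \<Rightarrow> complex) \<Rightarrow> (real \<Rightarrow> complex) \<Rightarrow> bool" where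
  "H2 u u1 u2 \<longleftrightarrow>
     (\<forall>x. (u has_vector_derivative u1 x) (at x)) \<and>
     (\<forall>a b. a \<le> b \<longrightarrow> set_integrable lborel {a..b} u2 \<and>
                         u1 b - u1 a = (LINT t:{a..b}|lborel. u2 t)) \<and>
     u \<in> borel_measurable lborel \<and> u1 \<in> borel_measurable lborel \<and> u2 \<in> borel_measurable lborel \<and>
     integrable lborel (\<lambda>x. (cmod (u x))\<^sup>2) \<and>
     integrable lborel (\<lambda>x. (cmod (u1 x))\<^sup>2) \<and>
     integrable lborel (\<lambda>x. (cmod (u2 x))\<^sup>2)"

definition l2_inner :: "(real \<Rightarrow> complex) \<Rightarrow> (real \<Rightarrow> complex) \<Rightarrow> complex" where
  "l2_inner u w = (LINT x|lborel. u x * cnj (w x))"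

definition hform :: "(real \<Rightarrow> real) \<Rightarrow> (real \<Rightarrow> real) \<Rightarrow>
    (real \<Rightarrow> complex) \<Rightarrow> (real \<Rightarrow> complex) \<Rightarrow> (real \<Rightarrow> complex) \<Rightarrow>
    (real \<Rightarrow> complex) \<Rightarrow> (real \<Rightarrow> complex) \<Rightarrow> (real \<Rightarrow> complex) \<Rightarrow> complex" where
  "hform v0 v1 u u1 u2 w w1 w2 =
     (LINT x|lborel. u2 x * cnj (w2 x) + complex_of_real (v1 x) * u1 x * cnj (w1 x)
                     + complex_of_real (v0 x) * u x * cnj (w x))"

text \<open>lam is an eigenvalue of the operator H associated with the form h on H^2:
  there is a nonzero u in dom H with H u = lam u.\<close>
definition is_eigenvalue_H :: "(real \<Rightarrow> real) \<Rightarrow> (real \<Rightarrow> real) \<Rightarrow> real \<Rightarrow> bool" where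
  "is_eigenvalue_H v0 v1 lam \<longleftrightarrow>
     (\<exists>u u1 u2. H2 u u1 u2 \<and> (\<exists>x. u x \<noteq> 0) \<and>
        (\<forall>w w1 w2. H2 w w1 w2 \<longrightarrow>
            hform v0 v1 u u1 u2 w w1 w2 = complex_of_real lam * l2_inner u w))"

text \<open>u = R(z) V phi, where V = D v1 D + v0 and phi has derivative dphi:
  u in H^2 and h[u,w] - z<u,w> = <V phi, w> = int (v1 phi' conj w' + v0 phi conj w)
  for all w in H^2.\<close>
definition resolvent_V_sol :: "(real \<Rightarrow> real) \<Rightarrow> (real \<Rightarrow> real) \<Rightarrow> complex \<Rightarrow>
    (real \<Rightarrow> complex) \<Rightarrow> (real \<Rightarrow> complex) \<Rightarrow> (real \<Rightarrow> complex) \<Rightarrow> bool" where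
  "resolvent_V_sol v0 v1 z phi dphi u \<longleftrightarrow>
     (\<exists>u1 u2. H2 u u1 u2 \<and>
        (\<forall>w w1 w2. H2 w w1 w2 \<longrightarrow>
           hform v0 v1 u u1 u2 w w1 w2 - z * l2_inner u w =
           (LINT x|lborel. complex_of_real (v1 x) * dphi x * cnj (w1 x)
                           + complex_of_real (v0 x) * phi x * cnj (w x))))"

definition RV :: "(real \<Rightarrow> real) \<Rightarrow> (real \<Rightarrow> real) \<Rightarrow> complex \<Rightarrow>
    (real \<Rightarrow> complex) \<Rightarrow> (real \<Rightarrow> complex) \<Rightarrow> (real \<Rightarrow> complex)" where
  "RV v0 v1 z phi dphi = (THE u. resolvent_V_sol v0 v1 z phi dphi u)"

definition is_wave_function :: "(real \<Rightarrow> real) \<Rightarrow> (real \<Rightarrow> real) \<Rightarrow> real \<Rightarrow>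
    (real \<Rightarrow> complex) \<Rightarrow> (real \<Rightarrow> complex) \<Rightarrow> (real \<Rightarrow> complex) \<Rightarrow> bool" where
  "is_wave_function v0 v1 lam phi dphi psi \<longleftrightarrow>
     (\<forall>x. ((\<lambda>\<epsilon>. RV v0 v1 (complex_of_real lam + \<i> * complex_of_real \<epsilon>) phi dphi x)
             \<longlongrightarrow> phi x - psi x) (at_right 0))"

text \<open>Entry s_{jl} of the scattering matrix:
  delta_{jl} - i/(4k^3) int (v1 psi_l' conj phi_j' + v0 psi_l conj phi_j).\<close>
definition smat_entry :: "(real \<Rightarrow> real) \<Rightarrow> (real \<Rightarrow> real) \<Rightarrow> real \<Rightarrow> bool \<Rightarrow>
    (real \<Rightarrow> complex) \<Rightarrow> (real \<Rightarrow> complex) \<Rightarrow> (real \<Rightarrow> complex) \<Rightarrow> complex" where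
  "smat_entry v0 v1 k same phi dphi psi =
     (if same then 1 else 0) - \<i> / (4 * complex_of_real k ^ 3) *
       (LINT x|lborel. complex_of_real (v1 x) * vector_derivative psi (at x) * cnj (dphi x)
                       + complex_of_real (v0 x) * psi x * cnj (phi x))"

end

theory Submission
  imports Defs
begin

text \<open>Two obstacles shape the proof. The potentials are only integrable, so \<open>v1\<close>
  cannot be differentiated and \<open>u'''\<close> need not be continuous. Hence the calculus is
  that of Lebesgue primitives, with a product rule from Fubini, and \<open>v1 u'\<close> is absorbed
  into the third quasi-derivative. The second obstacle is the passage to real spectral parameters.
  There the determinant of the 2 by 2 system might degenerate, so the amplitudes at -infinity of the
  resolvent solutions might diverge. No estimate of the resolvent excludes this. Instead, the
  convergence contained in \<open>is_wave_function\<close> is exploited: two independent solutions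
  are separated by their values at two points, and the convergence of the resolvent at these points
  forces the amplitudes to converge. In the limit the roots \<open>\<i> \<kappa>\<close> and
  \<open>- \<i> \<kappa>\<close> become imaginary. The decay conditions, which name components and
  not growth rates, survive as radiation conditions. That \<open>\<lambda>\<close> is not an
  eigenvalue enters at the very end, where a solution without oscillating part at both ends has to
  vanish.\<close>

text \<open>Write a solution of \<open>u'''' - (v1 u')' + v0 u = \<kappa>^4 u\<close> and its quasi-derivatives as
  \<open>u^[m](x) = (\<Sum>j. \<mu>_j^m exp (\<mu>_j x) C_j x)\<close>, where \<open>\<mu>_j\<close> are the four roots of \<open>\<mu>^4 = \<kappa>^4\<close>.
  Because the potentials decay superexponentially, the amplitudes \<open>C\<close> solve a linear system whose
  coefficients are integrable over the whole line, so they have limits at both ends, depend continuously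
  on \<open>\<kappa>\<close>, and approach their limits superexponentially fast. For non-real \<open>\<kappa>^4\<close> the resolvent is
  obtained by choosing the incoming amplitudes so that the outgoing solution decays (a 2 by 2 system), and
  letting \<open>\<kappa>^4\<close> tend to \<open>\<lambda>\<close> shows that \<open>\<psi>\<^sub>1\<close> and \<open>\<psi>\<^sub>2\<close> are solutions with end amplitudes
  \<open>(1, s21, b21, 0)\<close>, \<open>(s11, 0, 0, b11)\<close> and \<open>(0, s22, b22, 0)\<close>, \<open>(s12, 1, 0, b12)\<close>.
  The bilinear Wronskian takes equal values at both ends, which gives \<open>s11 = s22\<close> and the unitarity of
  the scattering matrix. Hence \<open>s11 cnj \<psi>\<^sub>1 + s12 cnj \<psi>\<^sub>2 - \<psi>\<^sub>2\<close> and
  \<open>s21 cnj \<psi>\<^sub>1 + s22 cnj \<psi>\<^sub>2 - \<psi>\<^sub>1\<close> decay exponentially; as \<open>\<lambda>\<close> is not an eigenvalue, they vanish,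
  and the amplitudes of \<open>exp (\<mp>k x)\<close> are the claimed identities.\<close>

section \<open>Indefinite integrals\<close>

text \<open>Says that \<open>f\<close> is locally absolutely continuous with derivative \<open>g\<close> almost everywhere.\<close>
definition primitive :: "(real \<Rightarrow> 'a::euclidean_space) \<Rightarrow> (real \<Rightarrow> 'a) \<Rightarrow> bool" where
  "primitive f g \<longleftrightarrow>
     (\<forall>a b. a \<le> b \<longrightarrow> set_integrable lborel {a..b} g \<and> f b - f a = (LINT t:{a..b}|lborel. g t))"

lemma primitive_integrable: "primitive f g \<Longrightarrow> set_integrable lborel {a..b} g"
  by (cases "a \<le> b") (auto simp: primitive_def set_integrable_def)

lemma primitive_diff_eq: "primitive f g \<Longrightarrow> a \<le> b \<Longrightarrow> f b - f a = (LINT t:{a..b}|lborel. g t)"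
  by (auto simp: primitive_def)

lemma primitive_integral: "primitive f g \<Longrightarrow> a \<le> b \<Longrightarrow> f b = f a + integral {a..b} g"
  using set_borel_integral_eq_integral(2)[of "{a..b}" g] by (auto simp: primitive_def algebra_simps)

lemma primitive_continuous:
  assumes "primitive f g"
  shows "continuous_on UNIV f"
proof -
  have "isCont f x" for x
  proof -
    have "continuous_on {x-1..x+1} (\<lambda>y. f (x-1) + integral {x-1..y} g)"
      using set_borel_integral_eq_integral(1)[OF primitive_integrable[OF assms]]
      by (intro continuous_intros indefinite_integral_continuous_1)
    then have "continuous_on {x-1..x+1} f"
      by (rule continuous_on_eq) (use primitive_integral[OF assms] in auto)
    then show ?thesis
      by (rule continuous_on_interior) (auto simp: interior_cbox[of "x-1" "x+1", simplified])
  qed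
  then show ?thesis by (simp add: continuous_on_eq_continuous_within continuous_at_imp_continuous_at_within)
qed

lemma primitive_deriv:
  assumes "primitive f g" and g: "continuous_on UNIV g"
  shows "(f has_vector_derivative g x) (at x)"
proof -
  have "((\<lambda>y. f (x-1) + integral {x-1..y} g) has_vector_derivative g x) (at x within {x-1..x+1})"
    using has_vector_derivative_add[OF has_vector_derivative_const
        integral_has_vector_derivative[OF continuous_on_subset[OF g subset_UNIV], of x "x-1" "x+1"]] by simp
  then have "(f has_vector_derivative g x) (at x within {x-1..x+1})"
    by (rule has_vector_derivative_transform[rotated 2]) (use primitive_integral[OF assms(1)] in auto)
  then show ?thesis
    by (subst (asm) at_within_interior) (auto simp: interior_cbox[of "x-1" "x+1", simplified])
qed

lemma deriv_primitive:
  assumes "\<And>x. (f has_vector_derivative g x) (at x)" and g: "continuous_on UNIV g"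
  shows "primitive f g"
  unfolding primitive_def
proof (intro allI impI conjI)
  fix a b :: real assume "a \<le> b"
  show si: "set_integrable lborel {a..b} g"
    by (rule borel_integrable_atLeastAtMost') (rule continuous_on_subset[OF g], simp)
  have "(g has_integral (f b - f a)) {a..b}"
    using \<open>a \<le> b\<close> assms(1) by (intro fundamental_theorem_of_calculus) (auto intro: has_vector_derivative_at_within)
  then show "f b - f a = (LINT t:{a..b}|lborel. g t)"
    using set_borel_integral_eq_integral(2)[OF si] by (simp add: integral_unique)
qed

lemma primitive_add:
  assumes "primitive f f'" "primitive g g'"
  shows "primitive (\<lambda>x. f x + g x) (\<lambda>x. f' x + g' x)"
  using assms unfolding primitive_def by (auto simp: set_integral_add algebra_simps)

lemma primitive_zero: "primitive (\<lambda>x. 0) (\<lambda>x. 0)"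
  by (simp add: primitive_def set_integrable_def set_lebesgue_integral_def)

lemma primitive_sum:
  "finite I \<Longrightarrow> (\<And>i. i \<in> I \<Longrightarrow> primitive (f i) (f' i)) \<Longrightarrow>
    primitive (\<lambda>x. \<Sum>i\<in>I. f i x) (\<lambda>x. \<Sum>i\<in>I. f' i x)"
  by (induction I rule: finite_induct) (auto intro: primitive_add primitive_zero)

lemma primitive_linear:
  assumes "primitive f f'" "bounded_linear L"
  shows "primitive (\<lambda>x. L (f x)) (\<lambda>x. L (f' x))"
proof -
  interpret bounded_linear L by fact
  show ?thesis unfolding primitive_def
  proof (intro allI impI conjI)
    fix a b :: real assume "a \<le> b"
    have i: "set_integrable lborel {a..b} f'" using assms primitive_integrable by blast
    have e: "(\<lambda>x. indicator {a..b} x *\<^sub>R L (f' x)) = (\<lambda>x. L (indicator {a..b} x *\<^sub>R f' x))"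
      by (simp add: scaleR)
    show "set_integrable lborel {a..b} (\<lambda>x. L (f' x))"
      using i unfolding set_integrable_def e by (rule integrable_bounded_linear[OF assms(2)])
    have "L (f b) - L (f a) = L (LINT t:{a..b}|lborel. f' t)"
      using primitive_diff_eq[OF assms(1) \<open>a \<le> b\<close>] diff by metis
    also have "\<dots> = (LINT t:{a..b}|lborel. L (f' t))"
      using i unfolding set_lebesgue_integral_def set_integrable_def e
      by (simp add: integral_bounded_linear[OF assms(2)])
    finally show "L (f b) - L (f a) = (LINT t:{a..b}|lborel. L (f' t))" .
  qed
qed

lemma primitive_cong:
  "primitive f f' \<Longrightarrow> (\<And>x. f x = g x) \<Longrightarrow> (\<And>x. f' x = g' x) \<Longrightarrow> primitive g g'"
  by (simp add: primitive_def set_lebesgue_integral_def set_integrable_def)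

text \<open>Cutting the integrable product \<open>P s * Q t\<close> down to a triangle keeps it
  integrable, so Fubini applies to factors with no continuity at all. This is why the product rule
  holds for merely integrable derivatives.\<close>

lemma fubini_triangle:
  fixes P Q :: "real \<Rightarrow> 'a::{real_normed_field, euclidean_space}"
  shows "integrable lborel P \<Longrightarrow> integrable lborel Q \<Longrightarrow>
     (LINT t|lborel. (LINT s|lborel. (if s \<le> t then P s * Q t else 0)))
   = (LINT s|lborel. (LINT t|lborel. (if s \<le> t then P s * Q t else 0)))"
proof -
  assume P: "integrable lborel P" and Q: "integrable lborel Q"
  have [measurable]: "P \<in> borel_measurable borel" "Q \<in> borel_measurable borel"
    using P Q by (simp_all add: borel_measurable_integrable[of lborel, simplified])
  let ?f = "\<lambda>s t. if s \<le> t then P s * Q t else 0"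
  interpret lborel_pair: pair_sigma_finite lborel "lborel :: real measure" ..
  have "integrable (lborel \<Otimes>\<^sub>M lborel) (\<lambda>(s,t). P s * Q t)"
  proof (rule lborel_pair.Fubini_integrable)
    show "integrable lborel (\<lambda>x. LINT y|lborel. norm (case (x, y) of (s, t) \<Rightarrow> P s * Q t))"
      using P by (simp add: norm_mult)
    show "AE x in lborel. integrable lborel (\<lambda>y. case (x, y) of (s, t) \<Rightarrow> P s * Q t)"
      using Q by simp
  qed simp
  then have "integrable (lborel \<Otimes>\<^sub>M lborel) (case_prod ?f)"
    by (rule Bochner_Integration.integrable_bound) (auto simp: split_beta')
  from lborel_pair.Fubini_integral[OF this] show ?thesis .
qed

text \<open>Both products are expanded by Fubini over the triangle \<open>s \<le> t\<close>.\<close>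
lemma primitive_mult:
  fixes f g :: "real \<Rightarrow> 'a::{real_normed_field, euclidean_space}"
  assumes f: "primitive f f'" and g: "primitive g g'"
  shows "primitive (\<lambda>x. f x * g x) (\<lambda>x. f' x * g x + f x * g' x)"
  unfolding primitive_def
proof (intro allI impI)
  fix a b :: real assume ab: "a \<le> b"
  define P where "P = (\<lambda>s. indicator {a..b} s *\<^sub>R f' s)"
  define Q where "Q = (\<lambda>s. indicator {a..b} s *\<^sub>R g' s)"
  have P: "integrable lborel P" and Q: "integrable lborel Q"
    using f g primitive_integrable unfolding P_def Q_def set_integrable_def by blast+
  have cf: "continuous_on UNIV f" and cg: "continuous_on UNIV g"
    using f g primitive_continuous by auto
  \<comment> \<open>\<open>f\<close> is expanded from the left end and \<open>g\<close> from the
    right end, so that both remainders are integrals over the same triangle and cancel by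
    Fubini.\<close>
  have 1: "f t = f a + (LINT s|lborel. (if s \<le> t then P s else 0))" if "t \<in> {a..b}" for t
  proof -
    have "f t - f a = (LINT s:{a..t}|lborel. f' s)" using primitive_diff_eq[OF f, of a t] that by auto
    also have "\<dots> = (LINT s|lborel. (if s \<le> t then P s else 0))"
      unfolding set_lebesgue_integral_def P_def using that
      by (intro Bochner_Integration.integral_cong) (auto simp: indicator_def)
    finally show ?thesis by (simp add: algebra_simps)
  qed
  have 2: "g s = g b - (LINT t|lborel. (if s \<le> t then Q t else 0))" if "s \<in> {a..b}" for s
  proof -
    have "g b - g s = (LINT t:{s..b}|lborel. g' t)" using primitive_diff_eq[OF g, of s b] that by auto
    also have "\<dots> = (LINT t|lborel. (if s \<le> t then Q t else 0))"
      unfolding set_lebesgue_integral_def Q_def using that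
      by (intro Bochner_Integration.integral_cong) (auto simp: indicator_def)
    finally show ?thesis by (simp add: algebra_simps)
  qed
  have [measurable]: "P \<in> borel_measurable borel" "Q \<in> borel_measurable borel"
    using P Q by (simp_all add: borel_measurable_integrable[of lborel, simplified])
  have [measurable]: "f \<in> borel_measurable borel" "g \<in> borel_measurable borel"
    using cf cg by (auto intro: borel_measurable_continuous_onI)
  obtain Mf where Mf: "\<And>x. x \<in> {a..b} \<Longrightarrow> norm (f x) \<le> Mf"
    using compact_imp_bounded[OF compact_continuous_image[OF continuous_on_subset[OF cf] compact_Icc]]
    unfolding bounded_iff by (metis imageI subset_UNIV)
  obtain Mg where Mg: "\<And>x. x \<in> {a..b} \<Longrightarrow> norm (g x) \<le> Mg"
    using compact_imp_bounded[OF compact_continuous_image[OF continuous_on_subset[OF cg] compact_Icc]]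
    unfolding bounded_iff by (metis imageI subset_UNIV)
  have I1: "integrable lborel (\<lambda>s. P s * g s)"
  proof (rule Bochner_Integration.integrable_bound)
    show "integrable lborel (\<lambda>s. Mg *\<^sub>R P s)" using P by simp
    show "AE x in lborel. norm (P x * g x) \<le> norm (Mg *\<^sub>R P x)"
    proof (intro AE_I2)
      fix x show "norm (P x * g x) \<le> norm (Mg *\<^sub>R P x)"
      proof (cases "x \<in> {a..b}")
        case True
        then have "norm (P x) * norm (g x) \<le> norm (P x) * \<bar>Mg\<bar>" using Mg[of x] by (intro mult_left_mono) auto
        then show ?thesis by (simp add: norm_mult mult.commute)
      qed (simp add: P_def)
    qed
  qed simp
  have I2: "integrable lborel (\<lambda>s. f s * Q s)"
  proof (rule Bochner_Integration.integrable_bound)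
    show "integrable lborel (\<lambda>s. Mf *\<^sub>R Q s)" using Q by simp
    show "AE x in lborel. norm (f x * Q x) \<le> norm (Mf *\<^sub>R Q x)"
    proof (intro AE_I2)
      fix x show "norm (f x * Q x) \<le> norm (Mf *\<^sub>R Q x)"
      proof (cases "x \<in> {a..b}")
        case True
        then have "norm (f x) * norm (Q x) \<le> \<bar>Mf\<bar> * norm (Q x)" using Mf[of x] by (intro mult_right_mono) auto
        then show ?thesis by (simp add: norm_mult)
      qed (simp add: Q_def)
    qed
  qed simp
  have e: "(\<lambda>x. indicator {a..b} x *\<^sub>R (f' x * g x + f x * g' x)) = (\<lambda>x. P x * g x + f x * Q x)"
    by (auto simp: P_def Q_def fun_eq_iff indicator_def)
  have s1: "set_integrable lborel {a..b} (\<lambda>x. f' x * g x + f x * g' x)"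
    unfolding set_integrable_def e using I1 I2 by simp
  have iP: "(LINT s|lborel. P s) = f b - f a" and iQ: "(LINT s|lborel. Q s) = g b - g a"
    using primitive_diff_eq[OF f ab] primitive_diff_eq[OF g ab]
    by (simp_all add: P_def Q_def set_lebesgue_integral_def)
  let ?T = "LINT s|lborel. (LINT t|lborel. (if s \<le> t then P s * Q t else 0))"
  have "P s * g s = P s * g b - (LINT t|lborel. (if s \<le> t then P s * Q t else 0))" for s
  proof (cases "s \<in> {a..b}")
    case True
    have "(LINT t|lborel. (if s \<le> t then P s * Q t else 0)) = (LINT t|lborel. P s * (if s \<le> t then Q t else 0))"
      by (intro Bochner_Integration.integral_cong) auto
    then have "(LINT t|lborel. (if s \<le> t then P s * Q t else 0)) = P s * (g b - g s)"
      using 2[OF True] by simp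
    then show ?thesis by (simp add: algebra_simps)
  next
    case False
    then have "P s = 0" by (simp add: P_def)
    then show ?thesis by (simp cong: if_cong)
  qed
  then have e1: "(\<lambda>s. LINT t|lborel. (if s \<le> t then P s * Q t else 0)) = (\<lambda>s. P s * g b - P s * g s)"
    by (simp add: fun_eq_iff algebra_simps)
  have "f t * Q t = f a * Q t + (LINT s|lborel. (if s \<le> t then P s * Q t else 0))" for t
  proof (cases "t \<in> {a..b}")
    case True
    have "(LINT s|lborel. (if s \<le> t then P s * Q t else 0)) = (LINT s|lborel. (if s \<le> t then P s else 0) * Q t)"
      by (intro Bochner_Integration.integral_cong) auto
    then have "(LINT s|lborel. (if s \<le> t then P s * Q t else 0)) = (f t - f a) * Q t"
      using 1[OF True] by simp
    then show ?thesis by (simp add: algebra_simps)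
  next
    case False
    then have "Q t = 0" by (simp add: Q_def)
    then show ?thesis by (simp cong: if_cong)
  qed
  then have e2: "(\<lambda>t. LINT s|lborel. (if s \<le> t then P s * Q t else 0)) = (\<lambda>t. f t * Q t - f a * Q t)"
    by (simp add: fun_eq_iff algebra_simps)
  have "(LINT t|lborel. f t * Q t - f a * Q t) = (LINT s|lborel. P s * g b - P s * g s)"
    using fubini_triangle[OF P Q] unfolding e1 e2 .
  then have "(LINT t|lborel. f t * Q t) - f a * (g b - g a) = (f b - f a) * g b - (LINT s|lborel. P s * g s)"
    using I1 I2 P Q by (simp add: iP iQ)
  moreover have "(LINT t:{a..b}|lborel. f' t * g t + f t * g' t) = (LINT s|lborel. P s * g s) + (LINT t|lborel. f t * Q t)"
    unfolding set_lebesgue_integral_def e using I1 I2 by simp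
  ultimately show "set_integrable lborel {a..b} (\<lambda>x. f' x * g x + f x * g' x) \<and>
      f b * g b - f a * g a = (LINT t:{a..b}|lborel. f' t * g t + f t * g' t)"
    using s1 by (simp add: algebra_simps)
qed

text \<open>The product rule on \<open>[-n, n]\<close> leaves boundary terms that tend to 0, and the
  integrable sum of the two products dominates its own truncations.\<close>

lemma integration_by_parts_real_line:
  fixes f g :: "real \<Rightarrow> 'a::{real_normed_field, euclidean_space}"
  assumes f: "primitive f f'" and g: "primitive g g'"
    and i1: "integrable lborel (\<lambda>x. f' x * g x)" and i2: "integrable lborel (\<lambda>x. f x * g' x)"
    and top: "((\<lambda>x. f x * g x) \<longlongrightarrow> 0) at_top" and bot: "((\<lambda>x. f x * g x) \<longlongrightarrow> 0) at_bot"
  shows "(LINT x|lborel. f' x * g x) = - (LINT x|lborel. f x * g' x)"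
proof -
  let ?h = "\<lambda>x. f' x * g x + f x * g' x"
  have ih: "integrable lborel ?h" using i1 i2 by simp
  have lim: "(\<lambda>n. LINT x|lborel. indicator {- real n..real n} x *\<^sub>R ?h x) \<longlonglongrightarrow> (LINT x|lborel. ?h x)"
  proof (rule integral_dominated_convergence[where w = "\<lambda>x. norm (?h x)"])
    show "AE x in lborel. (\<lambda>n. indicator {- real n..real n} x *\<^sub>R ?h x) \<longlonglongrightarrow> ?h x"
    proof (intro AE_I2 tendsto_eventually)
      fix x :: real
      show "\<forall>\<^sub>F n in sequentially. indicator {- real n..real n} x *\<^sub>R ?h x = ?h x"
        using eventually_ge_at_top[of "nat \<lceil>\<bar>x\<bar>\<rceil>"]
      proof eventually_elim
        case (elim n)
        then have "\<bar>x\<bar> \<le> real n" by linarith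
        then have "x \<in> {-real n..real n}" by auto
        then show ?case by simp
      qed
    qed
  qed (use ih in \<open>auto simp: indicator_def borel_measurable_integrable\<close>)
  have e: "(LINT x|lborel. indicator {- real n..real n} x *\<^sub>R ?h x) = f (real n) * g (real n) - f (- real n) * g (- real n)" for n
    using primitive_diff_eq[OF primitive_mult[OF f g], of "- real n" "real n"]
    by (simp add: set_lebesgue_integral_def)
  have "(\<lambda>n. f (real n) * g (real n) - f (- real n) * g (- real n)) \<longlonglongrightarrow> 0 - 0"
    by (intro tendsto_diff filterlim_compose[OF top] filterlim_compose[OF bot] filterlim_real_sequentially
        filterlim_compose[OF filterlim_uminus_at_bot_at_top])
  then have "(LINT x|lborel. ?h x) = 0"
    using LIMSEQ_unique lim unfolding e by fastforce
  then show ?thesis using i1 i2 by (simp add: eq_neg_iff_add_eq_0)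
qed

section \<open>Linear systems with integrable coefficients\<close>

lemma integrable_imp_set_integrable:
  fixes g :: "real \<Rightarrow> 'a::euclidean_space"
  shows "integrable lborel g \<Longrightarrow> A \<in> sets borel \<Longrightarrow> set_integrable lborel A g"
  unfolding set_integrable_def by (rule integrable_mult_indicator) auto

lemma primitive_Iic:
  fixes g :: "real \<Rightarrow> 'a::euclidean_space"
  assumes g: "integrable lborel g"
  shows "primitive (\<lambda>x. c + (LINT t:{..x}|lborel. g t)) g"
  unfolding primitive_def
proof (intro allI impI conjI)
  fix a b :: real assume ab: "a \<le> b"
  have si: "set_integrable lborel A g" if "A \<in> sets lborel" for A
    using g that by (simp add: set_integrable_def integrable_mult_indicator)
  show "set_integrable lborel {a..b} g" by (rule si) simp
  have "(LINT t:{..a} \<union> {a<..b}|lborel. g t) = (LINT t:{..a}|lborel. g t) + (LINT t:{a<..b}|lborel. g t)"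
    by (intro set_integral_Un si) auto
  moreover have "{..a} \<union> {a<..b} = {..b}" using ab by auto
  moreover have "(LINT t:{a<..b}|lborel. g t) = (LINT t:{a..b}|lborel. g t)"
    unfolding set_lebesgue_integral_def
  proof (rule integral_cong_AE)
    show "AE x in lborel. indicator {a<..b} x *\<^sub>R g x = indicator {a..b} x *\<^sub>R g x"
      using AE_lborel_singleton[of a] by eventually_elim (auto simp: indicator_def)
  qed (use g in \<open>auto simp: borel_measurable_integrable\<close>)
  ultimately show "c + (LINT t:{..b}|lborel. g t) - (c + (LINT t:{..a}|lborel. g t)) = (LINT t:{a..b}|lborel. g t)"
    by simp
qed

lemma norm_set_integral_le:
  fixes g :: "real \<Rightarrow> 'a::euclidean_space"
  assumes g: "integrable lborel g" and A: "A \<in> sets borel"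
  shows "norm (LINT t:A|lborel. g t) \<le> (LINT t|lborel. norm (g t))"
  unfolding set_lebesgue_integral_def using assms
  by (intro Bochner_Integration.integral_norm_bound_integral integrable_mult_indicator integrable_norm)
     (auto simp: indicator_def)

lemma tendsto_Iic_at_bot:
  fixes g :: "real \<Rightarrow> 'a::euclidean_space"
  assumes g: "integrable lborel g"
  shows "((\<lambda>a. LINT t:{a..x}|lborel. g t) \<longlongrightarrow> (LINT t:{..x}|lborel. g t)) at_bot"
  by (rule tendsto_set_lebesgue_integral_at_bot)
     (use g in \<open>auto simp: set_integrable_def integrable_mult_indicator\<close>)

text \<open>A truncated exponential \<open>(\<Sum>i\<le>N. (2 B)^i / fact i)\<close> of \<open>B x = \<integral>\<^bsub>-\<infinity>\<^esub>\<^bsup>x\<^esup> b\<close> replaces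
  \<open>exp (2 B)\<close>, so that the product rule suffices to integrate it.\<close>
lemma contracting_weight:
  fixes b :: "real \<Rightarrow> real"
  assumes b: "integrable lborel b" and b0: "\<And>t. 0 \<le> b t"
  obtains W M where "continuous_on UNIV W" "\<And>x. 1 \<le> W x" "\<And>x. W x \<le> M"
    "integrable lborel (\<lambda>t. b t * W t)" "\<And>x. (LINT t:{..x}|lborel. b t * W t) \<le> W x / (2::real)"
proof -
  define B where "B x = (LINT t:{..x}|lborel. b t)" for x
  define S where "S = (LINT t|lborel. b t)"
  have pB: "primitive B b" using primitive_Iic[OF b, of 0] by (simp add: B_def[abs_def])
  have B0: "0 \<le> B x" for x unfolding B_def set_lebesgue_integral_def
    by (intro Bochner_Integration.integral_nonneg) (simp add: b0 indicator_def)
  have BS: "B x \<le> S" for x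
    using norm_set_integral_le[OF b, of "{..x}"] by (simp add: B_def S_def b0)
  have S0: "0 \<le> S" using B0 BS order_trans by blast
  have pP: "primitive (\<lambda>x. (2 * B x) ^ Suc n / fact (Suc n)) (\<lambda>x. 2 * b x * ((2 * B x) ^ n / fact n))" for n
  proof (induction n)
    case 0
    show ?case using primitive_linear[OF pB, of "\<lambda>x. 2 * x"] by (simp add: bounded_linear_mult_right)
  next
    case (Suc n)
    have "primitive (\<lambda>x. (2 * B x) * ((2 * B x) ^ Suc n / fact (Suc n)))
        (\<lambda>x. (2 * b x) * ((2 * B x) ^ Suc n / fact (Suc n)) + (2 * B x) * (2 * b x * ((2 * B x) ^ n / fact n)))"
      by (rule primitive_mult[OF _ Suc.IH]) (rule primitive_linear[OF pB bounded_linear_mult_right])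
    then have "primitive (\<lambda>x. (2 * B x) * ((2 * B x) ^ Suc n / fact (Suc n)) / (real n + 2))
        (\<lambda>x. ((2 * b x) * ((2 * B x) ^ Suc n / fact (Suc n)) + (2 * B x) * (2 * b x * ((2 * B x) ^ n / fact n))) / (real n + 2))"
      by (rule primitive_linear) (rule bounded_linear_divide)
    then show ?case
    proof (rule primitive_cong)
      fix x :: real
      have "(p * (q * y / ((real n + 1) * f)) + q * (p * (y / f))) / (real n + 2) = p * (q * y / ((real n + 1) * f))"
        if "f \<noteq> 0" for p q y f :: real
        using that by (simp add: divide_simps) (simp add: algebra_simps)
      from this[of "fact n" "2 * b x" "2 * B x" "(2 * B x) ^ n"]
      show "((2 * b x) * ((2 * B x) ^ Suc n / fact (Suc n)) + (2 * B x) * (2 * b x * ((2 * B x) ^ n / fact n))) / (real n + 2)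
          = 2 * b x * ((2 * B x) ^ Suc n / fact (Suc n))"
        by (simp add: algebra_simps)
    qed (simp add: field_simps)
  qed
  have "(\<lambda>n. inverse (fact n) * (2 * S) ^ n) \<longlonglongrightarrow> 0"
    using summable_LIMSEQ_zero[OF summable_exp[of "2 * S"]] .
  then have "(\<lambda>n. S * (inverse (fact n) * (2 * S) ^ n)) \<longlonglongrightarrow> S * 0" by (rule tendsto_mult_left)
  then have "\<forall>\<^sub>F n in sequentially. S * (inverse (fact n) * (2 * S) ^ n) < 1 / 2"
    by (rule order_tendstoD) simp
  \<comment> \<open>Truncating the exponential series costs its top term. \<open>N\<close> is so
    large that this error, integrated against \<open>b\<close>, stays below 1/2, which the lower
    bound \<open>1 \<le> W a\<close> will absorb.\<close>
  then obtain N where N: "S * (inverse (fact N) * (2 * S) ^ N) < 1 / 2"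
    by (auto simp: eventually_sequentially)
  define W where "W x = 1 + (\<Sum>i<N. (2 * B x) ^ Suc i / fact (Suc i))" for x
  define W' where "W' x = (\<Sum>i<N. 2 * b x * ((2 * B x) ^ i / fact i))" for x
  have pW: "primitive W W'"
    using primitive_add[OF deriv_primitive[of "\<lambda>_. 1" "\<lambda>_. 0"] primitive_sum[of "{..<N}", OF _ pP]]
    by (simp add: W_def[abs_def] W'_def[abs_def])
  have cW: "continuous_on UNIV W" by (rule primitive_continuous[OF pW])
  have cB: "continuous_on UNIV B" by (rule primitive_continuous[OF pB])
  have W1: "1 \<le> W x" for x using B0[of x] by (simp add: W_def sum_nonneg)
  define M where "M = 1 + (\<Sum>i<N. (2 * S) ^ Suc i / fact (Suc i))"
  have WM: "W x \<le> M" for x unfolding W_def M_def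
    by (intro add_left_mono sum_mono divide_right_mono power_mono) (use B0[of x] BS[of x] in auto)
  have [measurable]: "b \<in> borel_measurable borel" "W \<in> borel_measurable borel" "B \<in> borel_measurable borel"
    using b cW cB by (auto intro: borel_measurable_continuous_onI borel_measurable_integrable[of lborel, simplified])
  have ibW: "integrable lborel (\<lambda>t. b t * W t)"
  proof (rule Bochner_Integration.integrable_bound)
    show "integrable lborel (\<lambda>t. b t * M)" using b by simp
    show "AE x in lborel. norm (b x * W x) \<le> norm (b x * M)"
    proof (intro AE_I2)
      fix x
      have "\<bar>W x\<bar> \<le> \<bar>M\<bar>" using W1[of x] WM[of x] by simp
      then show "norm (b x * W x) \<le> norm (b x * M)" by (simp add: abs_mult mult_left_mono)
    qed
  qed simp
  \<comment> \<open>\<open>R\<close> is the top term of the truncated series, the exact amount by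
    which \<open>W\<close> misses the equation \<open>W' = 2 * b * W\<close>.\<close>
  define R where "R x = (2 * B x) ^ N / fact N" for x
  have telescope: "(\<Sum>i<N. (2 * B x) ^ i / fact i) + R x = W x" for x
    using sum.lessThan_Suc_shift[of "\<lambda>i. (2 * B x) ^ i / fact i" N]
    by (simp add: W_def R_def)
  have W'_eq: "W' x = 2 * (b x * W x) - 2 * (b x * R x)" for x
  proof -
    have "W' x = 2 * b x * (\<Sum>i<N. (2 * B x) ^ i / fact i)" unfolding W'_def sum_distrib_left ..
    also have "(\<Sum>i<N. (2 * B x) ^ i / fact i) = W x - R x" using telescope[of x] by linarith
    finally show ?thesis by (simp add: algebra_simps)
  qed
  have bR: "b x * R x \<le> b x * (inverse (fact N) * (2 * S) ^ N)" for x
    using B0[of x] BS[of x] power_mono[of "2 * B x" "2 * S" N]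
    by (intro mult_left_mono b0) (simp add: R_def divide_inverse_commute mult_left_mono)
  have R0: "0 \<le> R x" for x using B0[of x] by (simp add: R_def)
  have ibR: "integrable lborel (\<lambda>t. b t * R t)"
  proof (rule Bochner_Integration.integrable_bound)
    show "integrable lborel (\<lambda>x. b x * (inverse (fact N) * (2 * S) ^ N))" using b by simp
    show "AE x in lborel. norm (b x * R x) \<le> norm (b x * (inverse (fact N) * (2 * S) ^ N))"
      using bR R0 b0 S0 by (intro AE_I2) (simp add: abs_mult)
  qed (simp add: R_def[abs_def])
  have intR: "(LINT t:{a..x}|lborel. b t * R t) \<le> 1 / 2" for a x
  proof -
    have "(LINT t:{a..x}|lborel. b t * R t) \<le> (LINT t|lborel. norm (b t * R t))"
      using norm_set_integral_le[OF ibR, of "{a..x}"] by simp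
    also have "\<dots> \<le> (LINT x|lborel. b x * (inverse (fact N) * (2 * S) ^ N))"
      using ibR b bR R0 b0 by (intro integral_mono) (auto simp: abs_mult)
    also have "\<dots> = S * (inverse (fact N) * (2 * S) ^ N)" by (simp add: S_def)
    finally show ?thesis using N by simp
  qed
  have main: "(LINT t:{a..x}|lborel. b t * W t) \<le> W x / 2" if "a \<le> x" for a x
  proof -
    have s: "set_integrable lborel {a..x} (\<lambda>t. b t * W t)" "set_integrable lborel {a..x} (\<lambda>t. b t * R t)"
      by (auto intro: integrable_imp_set_integrable ibW ibR)
    have "W x - W a = (LINT t:{a..x}|lborel. 2 * (b t * W t) - 2 * (b t * R t))"
      using primitive_diff_eq[OF pW that] by (simp add: W'_eq)
    also have "\<dots> = 2 * (LINT t:{a..x}|lborel. b t * W t) - 2 * (LINT t:{a..x}|lborel. b t * R t)"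
      using s by (subst set_integral_diff) (auto simp: set_integrable_mult_right)
    finally show ?thesis using intR[of a x] W1[of a] by simp
  qed
  have "(LINT t:{..x}|lborel. b t * W t) \<le> W x / 2" for x
    by (rule tendsto_upperbound[OF tendsto_Iic_at_bot[OF ibW]])
       (rule eventually_mono[OF eventually_le_at_bot[of x] main], simp_all)
  then show ?thesis using that cW W1 WM ibW by blast
qed

text \<open>A Volterra equation started at -infinity, so that \<open>c\<close> is the limit of
  \<open>C\<close> there and plays the role of the initial value. Integrability is demanded
  explicitly because the integral of a non-integrable function is 0 by convention, which would make
  the equation meaningless.\<close>

definition global_solution ::
  "(real \<Rightarrow> 'a::euclidean_space \<Rightarrow> 'a) \<Rightarrow> 'a \<Rightarrow> (real \<Rightarrow> 'a) \<Rightarrow> bool" where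
  "global_solution \<Phi> c C \<longleftrightarrow> continuous_on UNIV C \<and> bounded (range C) \<and>
     integrable lborel (\<lambda>t. \<Phi> t (C t)) \<and> (\<forall>x. C x = c + (LINT t:{..x}|lborel. \<Phi> t (C t)))"

lemma global_solutionD:
  assumes "global_solution \<Phi> c C"
  shows "continuous_on UNIV C" "bounded (range C)" "integrable lborel (\<lambda>t. \<Phi> t (C t))"
    "C x = c + (LINT t:{..x}|lborel. \<Phi> t (C t))"
  using assms unfolding global_solution_def by blast+

lemma global_solution_bounded:
  assumes "global_solution \<Phi> c C"
  obtains K where "0 \<le> K" "\<And>x. norm (C x) \<le> K"
  using global_solutionD(2)[OF assms] unfolding bounded_iff by (metis norm_ge_zero order_trans rangeI)

text \<open>Picard iteration on the whole line at once. In the sup norm weighted by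
  \<open>1 / W\<close> the Volterra operator halves distances, however large the integral of
  \<open>b\<close> is. Since \<open>1 \<le> W \<le> M\<close>, the weighted norm is equivalent to
  the plain one.\<close>

theorem global_solution_exists:
  fixes \<Phi> :: "real \<Rightarrow> 'a::euclidean_space \<Rightarrow> 'a"
  assumes b: "integrable lborel b" and b0: "\<And>t. 0 \<le> b t"
    and lip: "\<And>t v w. norm (\<Phi> t v - \<Phi> t w) \<le> b t * norm (v - w)"
    and \<Phi>0: "integrable lborel (\<lambda>t. \<Phi> t 0)"
    and meas: "\<And>C. continuous_on UNIV C \<Longrightarrow> (\<lambda>t. \<Phi> t (C t)) \<in> borel_measurable lborel"
  shows "\<exists>C. global_solution \<Phi> c C"
proof -
  obtain W M where cW: "continuous_on UNIV W" and W1: "\<And>x. 1 \<le> W x" and WM: "\<And>x. W x \<le> M"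
    and ibW: "integrable lborel (\<lambda>t. b t * W t)"
    and bW: "\<And>x. (LINT t:{..x}|lborel. b t * W t) \<le> W x / (2::real)"
    using contracting_weight[OF b b0] by blast
  have W0: "0 < W x" for x using W1[of x] by simp
  have int: "integrable lborel (\<lambda>t. \<Phi> t (C t))" if C: "continuous_on UNIV C" "\<And>x. norm (C x) \<le> K" for C K
  proof (rule Bochner_Integration.integrable_bound)
    show "integrable lborel (\<lambda>t. norm (\<Phi> t 0) + b t * K)" using \<Phi>0 b by simp
    show "AE t in lborel. norm (\<Phi> t (C t)) \<le> norm (norm (\<Phi> t 0) + b t * K)"
    proof (intro AE_I2)
      fix t
      have "norm (\<Phi> t (C t)) \<le> norm (\<Phi> t 0) + norm (\<Phi> t (C t) - \<Phi> t 0)"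
        by (metis add.commute diff_add_cancel norm_triangle_ineq)
      also have "\<dots> \<le> norm (\<Phi> t 0) + b t * K"
        using lip[of t "C t" 0] mult_left_mono[OF C(2)[of t] b0[of t]] by simp
      finally show "norm (\<Phi> t (C t)) \<le> norm (norm (\<Phi> t 0) + b t * K)" by simp
    qed
  qed (use meas C in auto)
  \<comment> \<open>The iteration runs on \<open>F = C / W\<close>, which turns the weighted norm
    into the complete sup norm of bounded continuous functions.\<close>
  define T where "T F = (\<lambda>x. (1 / W x) *\<^sub>R (c + (LINT t:{..x}|lborel. \<Phi> t (W t *\<^sub>R apply_bcontfun F t))))" for F
  have cF: "continuous_on UNIV (\<lambda>t. W t *\<^sub>R apply_bcontfun F t)" for F :: "real \<Rightarrow>\<^sub>C 'a"
    by (intro continuous_intros cW) simp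
  have bF: "norm (W x *\<^sub>R apply_bcontfun F x) \<le> M * norm F" for F :: "real \<Rightarrow>\<^sub>C 'a" and x
    using mult_mono[OF WM[of x] norm_bounded[of F x]] W0[of x] WM[of x] by simp
  note iF = int[OF cF bF]
  have T: "T F \<in> bcontfun" for F
  proof (rule bcontfun_normI)
    show "continuous_on UNIV (T F)" unfolding T_def
      using W0 by (intro continuous_intros cW primitive_continuous[OF primitive_Iic[OF iF]]) (metis less_irrefl)
    fix x
    have "norm (T F x) \<le> norm (c + (LINT t:{..x}|lborel. \<Phi> t (W t *\<^sub>R apply_bcontfun F t)))"
      unfolding T_def using W1[of x] by (simp add: divide_le_eq mult_le_cancel_left1)
    also have "\<dots> \<le> norm c + (LINT t|lborel. norm (\<Phi> t (W t *\<^sub>R apply_bcontfun F t)))"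
      by (rule order_trans[OF norm_triangle_ineq]) (simp add: norm_set_integral_le[OF iF])
    finally show "norm (T F x) \<le> norm c + (LINT t|lborel. norm (\<Phi> t (W t *\<^sub>R apply_bcontfun F t)))" .
  qed
  have app: "apply_bcontfun (Bcontfun (T F)) = T F" for F by (rule Bcontfun_inverse[OF T])
  have "dist (Bcontfun (T F)) (Bcontfun (T G)) \<le> (1 / 2) * dist F G" for F G
  proof (rule dist_bound)
    fix x
    have i: "set_integrable lborel {..x} (\<lambda>t. \<Phi> t (W t *\<^sub>R apply_bcontfun F t))" for F
      using iF[of F] by (simp add: set_integrable_def integrable_mult_indicator)
    have "norm (T F x - T G x) = (1 / W x) * norm (LINT t:{..x}|lborel. \<Phi> t (W t *\<^sub>R F t) - \<Phi> t (W t *\<^sub>R G t))"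
      unfolding T_def scaleR_diff_right[symmetric] using W0[of x] i[of F] i[of G] by (simp add: set_integral_diff)
    also have "norm (LINT t:{..x}|lborel. \<Phi> t (W t *\<^sub>R F t) - \<Phi> t (W t *\<^sub>R G t))
        \<le> (LINT t:{..x}|lborel. dist F G * (b t * W t))"
      unfolding set_lebesgue_integral_def
    proof (intro Bochner_Integration.integral_norm_bound_integral)
      fix t
      have "norm (\<Phi> t (W t *\<^sub>R F t) - \<Phi> t (W t *\<^sub>R G t)) \<le> b t * (W t * dist (F t) (G t))"
        using lip[of t "W t *\<^sub>R F t" "W t *\<^sub>R G t"] W0[of t]
        by (simp add: scaleR_diff_right[symmetric] dist_norm)
      also have "\<dots> \<le> b t * (W t * dist F G)"
        by (intro mult_left_mono b0 dist_bounded) (use W0[of t] in simp)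
      finally show "norm (indicator {..x} t *\<^sub>R (\<Phi> t (W t *\<^sub>R F t) - \<Phi> t (W t *\<^sub>R G t)))
          \<le> indicator {..x} t *\<^sub>R (dist F G * (b t * W t))"
        by (auto simp: indicator_def algebra_simps)
    next
      show "integrable lborel (\<lambda>t. indicator {..x} t *\<^sub>R (\<Phi> t (W t *\<^sub>R F t) - \<Phi> t (W t *\<^sub>R G t)))"
        using iF[of F] iF[of G] by (intro integrable_mult_indicator) auto
      show "integrable lborel (\<lambda>t. indicator {..x} t *\<^sub>R (dist F G * (b t * W t)))"
        using ibW by (intro integrable_mult_indicator) auto
    qed
    also have "\<dots> = dist F G * (LINT t:{..x}|lborel. b t * W t)" by simp
    also have "\<dots> \<le> dist F G * (W x / 2)" by (intro mult_left_mono bW) simp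
    finally show "dist (apply_bcontfun (Bcontfun (T F)) x) (apply_bcontfun (Bcontfun (T G)) x) \<le> (1 / 2) * dist F G"
      using W0[of x] by (simp add: app dist_norm field_simps)
  qed
  then obtain F where F: "Bcontfun (T F) = F"
    using banach_fix_type[of "1/2" "\<lambda>F. Bcontfun (T F)"] by auto
  define C where "C t = W t *\<^sub>R apply_bcontfun F t" for t
  have "C x = c + (LINT t:{..x}|lborel. \<Phi> t (C t))" for x
  proof -
    have "T F = apply_bcontfun F" using app[of F] F by simp
    then have "C x = W x *\<^sub>R T F x" by (simp add: C_def)
    then show ?thesis using W0[of x] by (simp add: T_def C_def)
  qed
  then show ?thesis
    using cF[of F] bF[of _ F] iF[of F] unfolding global_solution_def C_def[symmetric] bounded_iff by blast
qed

text \<open>A Gronwall estimate. The two systems are compared only along the second solution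
  \<open>E\<close>, so \<open>\<Psi>\<close> needs no Lipschitz bound. The constant is chosen before
  the systems and depends on \<open>b\<close> alone, which makes it uniform along a sequence of
  spectral parameters.\<close>

theorem global_solution_stable:
  fixes b :: "real \<Rightarrow> real"
  assumes b: "integrable lborel b" and b0: "\<And>t. 0 \<le> b t"
  shows "\<exists>M. \<forall>(\<Phi> :: real \<Rightarrow> 'a::euclidean_space \<Rightarrow> 'a) \<Psi> c e C E x.
    (\<forall>t v w. norm (\<Phi> t v - \<Phi> t w) \<le> b t * norm (v - w)) \<longrightarrow>
    global_solution \<Phi> c C \<longrightarrow> global_solution \<Psi> e E \<longrightarrow> integrable lborel (\<lambda>t. \<Phi> t (E t)) \<longrightarrow>
    norm (C x - E x) \<le> M * (norm (c - e) + (LINT t|lborel. norm (\<Phi> t (E t) - \<Psi> t (E t))))"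
proof -
  obtain W M where cW: "continuous_on UNIV W" and W1: "\<And>x. 1 \<le> W x" and WM: "\<And>x. W x \<le> M"
    and ibW: "integrable lborel (\<lambda>t. b t * W t)"
    and bW: "\<And>x. (LINT t:{..x}|lborel. b t * W t) \<le> W x / (2::real)"
    using contracting_weight[OF b b0] by blast
  have W0: "0 < W x" for x using W1[of x] by simp
  have "norm (C x - E x) \<le> 2 * M * (norm (c - e) + (LINT t|lborel. norm (\<Phi> t (E t) - \<Psi> t (E t))))"
    if lip: "\<And>t v w. norm (\<Phi> t v - \<Phi> t w) \<le> b t * norm (v - w)"
      and C: "global_solution \<Phi> c C" and E: "global_solution \<Psi> e E" and iE: "integrable lborel (\<lambda>t. \<Phi> t (E t))"
    for \<Phi> \<Psi> :: "real \<Rightarrow> 'a \<Rightarrow> 'a" and c e C E x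
  proof -
    define h where "h = norm (c - e) + (LINT t|lborel. norm (\<Phi> t (E t) - \<Psi> t (E t)))"
    have h0: "0 \<le> h" by (simp add: h_def)
    have iC: "integrable lborel (\<lambda>t. \<Phi> t (C t))" and iE': "integrable lborel (\<lambda>t. \<Psi> t (E t))"
      and cC: "continuous_on UNIV C" and cE: "continuous_on UNIV E"
      using global_solutionD[OF C] global_solutionD[OF E] by blast+
    obtain KC where KC: "\<And>x. norm (C x) \<le> KC" using global_solution_bounded[OF C] by metis
    obtain KE where KE: "\<And>x. norm (E x) \<le> KE" using global_solution_bounded[OF E] by metis
    define f where "f x = (1 / W x) *\<^sub>R (C x - E x)" for x
    have f: "f \<in> bcontfun"
    proof (rule bcontfun_normI)
      show "continuous_on UNIV f" unfolding f_def
        using W0 by (intro continuous_intros cW cC cE) (metis less_irrefl)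
      fix x
      have "norm (f x) \<le> norm (C x - E x)" using W1[of x] by (simp add: f_def divide_le_eq mult_le_cancel_left1)
      also have "\<dots> \<le> KC + KE" using norm_triangle_ineq4[of "C x" "E x"] KC[of x] KE[of x] by simp
      finally show "norm (f x) \<le> KC + KE" .
    qed
    define F where "F = Bcontfun f"
    have F: "apply_bcontfun F = f" unfolding F_def by (rule Bcontfun_inverse[OF f])
    have CE: "norm (C t - E t) \<le> W t * norm F" for t
    proof -
      have "norm (f t) = norm (C t - E t) / W t" using W0[of t] by (simp add: f_def)
      then show ?thesis using mult_left_mono[OF norm_bounded[of F t], of "W t"] W0[of t]
        by (simp add: F field_simps)
    qed
    have step: "norm (C x - E x) \<le> h + norm F * (W x / 2)" for x
    proof -
      have i: "set_integrable lborel {..x} g" if "integrable lborel g" for g :: "real \<Rightarrow> 'a"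
        using that by (simp add: set_integrable_def integrable_mult_indicator)
      have "C x - E x = (c - e) + (LINT t:{..x}|lborel. \<Phi> t (E t) - \<Psi> t (E t))
                        + (LINT t:{..x}|lborel. \<Phi> t (C t) - \<Phi> t (E t))"
      proof -
        have "C x = c + (LINT t:{..x}|lborel. \<Phi> t (C t))" "E x = e + (LINT t:{..x}|lborel. \<Psi> t (E t))"
          by (rule global_solutionD[OF C] global_solutionD[OF E])+
        then have "C x - E x = (c - e) + ((LINT t:{..x}|lborel. \<Phi> t (C t)) - (LINT t:{..x}|lborel. \<Psi> t (E t)))"
          by (metis add_diff_add)
        also have "\<dots> = (c - e) + ((LINT t:{..x}|lborel. \<Phi> t (E t)) - (LINT t:{..x}|lborel. \<Psi> t (E t)))
              + ((LINT t:{..x}|lborel. \<Phi> t (C t)) - (LINT t:{..x}|lborel. \<Phi> t (E t)))"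
          by simp
        finally show ?thesis
          by (simp only: set_integral_diff(2)[OF i[OF iC] i[OF iE]] set_integral_diff(2)[OF i[OF iE] i[OF iE']])
      qed
      also have "norm \<dots> \<le> norm (c - e) + norm (LINT t:{..x}|lborel. \<Phi> t (E t) - \<Psi> t (E t))
                        + norm (LINT t:{..x}|lborel. \<Phi> t (C t) - \<Phi> t (E t))"
        by (meson add_right_mono norm_triangle_ineq order_trans)
      also have "norm (LINT t:{..x}|lborel. \<Phi> t (E t) - \<Psi> t (E t)) \<le> (LINT t|lborel. norm (\<Phi> t (E t) - \<Psi> t (E t)))"
        using iE iE' by (intro norm_set_integral_le) auto
      also have "norm (LINT t:{..x}|lborel. \<Phi> t (C t) - \<Phi> t (E t)) \<le> (LINT t:{..x}|lborel. norm F * (b t * W t))"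
        unfolding set_lebesgue_integral_def
      proof (intro Bochner_Integration.integral_norm_bound_integral)
        fix t
        have "norm (\<Phi> t (C t) - \<Phi> t (E t)) \<le> b t * norm (C t - E t)" by (rule lip)
        also have "\<dots> \<le> b t * (W t * norm F)" by (intro mult_left_mono b0 CE)
        finally show "norm (indicator {..x} t *\<^sub>R (\<Phi> t (C t) - \<Phi> t (E t)))
            \<le> indicator {..x} t *\<^sub>R (norm F * (b t * W t))"
          by (auto simp: indicator_def algebra_simps)
      next
        show "integrable lborel (\<lambda>t. indicator {..x} t *\<^sub>R (\<Phi> t (C t) - \<Phi> t (E t)))"
          using iC iE by (intro integrable_mult_indicator) auto
        show "integrable lborel (\<lambda>t. indicator {..x} t *\<^sub>R (norm F * (b t * W t)))"
          using ibW by (intro integrable_mult_indicator) auto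
      qed
      also have "\<dots> = norm F * (LINT t:{..x}|lborel. b t * W t)" by simp
      also have "\<dots> \<le> norm F * (W x / 2)" by (intro mult_left_mono bW) simp
      finally show ?thesis by (simp add: h_def)
    qed
    \<comment> \<open>The weighted distance reappears on the right with the contraction factor 1/2
      and is absorbed into the left side.\<close>
    have "norm F \<le> h + norm F / 2"
    proof (rule norm_bound)
      fix x
      have "norm (apply_bcontfun F x) = norm (C x - E x) / W x" using W0[of x] by (simp add: F f_def)
      also have "\<dots> \<le> (h + norm F * (W x / 2)) / W x" by (intro divide_right_mono step) (use W0[of x] in simp)
      also have "\<dots> = h / W x + norm F / 2" using W0[of x] by (simp add: field_simps)
      also have "\<dots> \<le> h + norm F / 2" using W1[of x] h0 by (simp add: divide_le_eq mult_le_cancel_left1)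
      finally show "norm (apply_bcontfun F x) \<le> h + norm F / 2" .
    qed
    then have "norm F \<le> 2 * h" by simp
    then have "W x * norm F \<le> M * (2 * h)" using WM[of x] W0[of x] by (intro mult_mono) auto
    then show ?thesis using CE[of x] by (simp add: h_def algebra_simps)
  qed
  then show ?thesis by blast
qed

section \<open>Amplitudes of the four exponentials\<close>

text \<open>Real linearity of \<open>L\<close> suffices, so this covers multiplication by complex
  scalars, negation and the antilinear map \<open>conj4\<close>.\<close>

lemma global_solution_linear:
  fixes L :: "'a::euclidean_space \<Rightarrow> 'b::euclidean_space"
  assumes C: "global_solution \<Phi> c C" and L: "bounded_linear L"
    and eq: "\<And>t v. \<Psi> t (L v) = L (\<Phi> t v)"
  shows "global_solution \<Psi> (L c) (\<lambda>x. L (C x))"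
proof -
  interpret bounded_linear L by fact
  note C' = global_solutionD[OF C]
  have i: "integrable lborel (\<lambda>t. L (\<Phi> t (C t)))"
    by (rule integrable_bounded_linear[OF L C'(3)])
  have "L (C x) = L c + (LINT t:{..x}|lborel. L (\<Phi> t (C t)))" for x
  proof -
    have "L (C x) = L c + L (LINT t:{..x}|lborel. \<Phi> t (C t))"
      by (subst C'(4)) (rule add)
    also have "L (LINT t:{..x}|lborel. \<Phi> t (C t)) = (LINT t:{..x}|lborel. L (\<Phi> t (C t)))"
      using integral_bounded_linear[OF L integrable_imp_set_integrable[OF C'(3), of "{..x}", unfolded set_integrable_def]]
      by (simp add: set_lebesgue_integral_def scaleR)
    finally show ?thesis .
  qed
  moreover have "continuous_on UNIV (\<lambda>x. L (C x))"
    by (rule continuous_on[OF C'(1)])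
  moreover have "bounded (range (\<lambda>x. L (C x)))"
    using bounded_linear_image[OF C'(2) L] by (simp add: image_image)
  ultimately show ?thesis using i unfolding global_solution_def eq by blast
qed

text \<open>Allowing three different right-hand sides lets sources add: homogeneous and
  inhomogeneous solutions can be superposed, and a source can be cancelled.\<close>

lemma global_solution_add:
  assumes C: "global_solution \<Phi> c C" and E: "global_solution \<Psi> e E"
    and eq: "\<And>t v w. \<Theta> t (v + w) = \<Phi> t v + \<Psi> t w"
  shows "global_solution \<Theta> (c + e) (\<lambda>x. C x + E x)"
proof -
  note C' = global_solutionD[OF C] and E' = global_solutionD[OF E]
  have "C x + E x = c + e + (LINT t:{..x}|lborel. \<Phi> t (C t) + \<Psi> t (E t))" for x
  proof -
    have "C x + E x = (c + (LINT t:{..x}|lborel. \<Phi> t (C t))) + (e + (LINT t:{..x}|lborel. \<Psi> t (E t)))"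
      using C'(4)[of x] E'(4)[of x] by argo
    then show ?thesis
      by (subst set_integral_add(2)[OF integrable_imp_set_integrable[OF C'(3)] integrable_imp_set_integrable[OF E'(3)]])
         (auto simp only: add_ac atMost_borel)
  qed
  moreover have "bounded (range (\<lambda>x. C x + E x))"
    using bounded_plus_comp[OF C'(2)  E'(2)] .
  moreover have "continuous_on UNIV (\<lambda>x. C x + E x)"
    by (rule continuous_on_add[OF C'(1) E'(1)])
  moreover have "integrable lborel (\<lambda>t. \<Phi> t (C t) + \<Psi> t (E t))"
    by (rule Bochner_Integration.integrable_add[OF C'(3) E'(3)])
  ultimately show ?thesis unfolding global_solution_def eq by blast
qed

lemma global_solution_primitive:
  assumes "global_solution \<Phi> c C"
  shows "primitive C (\<lambda>t. \<Phi> t (C t))"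
proof -
  note C' = global_solutionD[OF assms]
  have "(\<lambda>x. c + (LINT t:{..x}|lborel. \<Phi> t (C t))) = C" by (rule ext) (rule C'(4)[symmetric])
  with primitive_Iic[OF C'(3), of c] show ?thesis by simp
qed

text \<open>The value of the solution at +infinity, by \<open>end_value_tendsto\<close>. Written as
  an integral it is linear in the solution without any limit argument.\<close>

definition end_value :: "(real \<Rightarrow> 'a::euclidean_space \<Rightarrow> 'a) \<Rightarrow> 'a \<Rightarrow> (real \<Rightarrow> 'a) \<Rightarrow> 'a" where
  "end_value \<Phi> c C = c + (LINT t|lborel. \<Phi> t (C t))"

lemma end_value_diff:
  assumes "global_solution \<Phi> c C"
  shows "end_value \<Phi> c C - C x = (LINT t:{x<..}|lborel. \<Phi> t (C t))"
proof -
  note C' = global_solutionD[OF assms]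
  have "(LINT t:{..x} \<union> {x<..}|lborel. \<Phi> t (C t)) = (LINT t:{..x}|lborel. \<Phi> t (C t)) + (LINT t:{x<..}|lborel. \<Phi> t (C t))"
    by (intro set_integral_Un integrable_imp_set_integrable C') auto
  moreover have "{..x} \<union> {x<..} = UNIV" by auto
  moreover have "(LINT t:UNIV|lborel. \<Phi> t (C t)) = (LINT t|lborel. \<Phi> t (C t))"
    by (simp add: set_lebesgue_integral_def)
  moreover have "c + (P + Q) - (c + P) = Q" for P Q by simp
  ultimately show ?thesis using C'(4)[of x] unfolding end_value_def by metis
qed

lemma end_value_tendsto:
  assumes "global_solution \<Phi> c C"
  shows "(C \<longlongrightarrow> end_value \<Phi> c C) at_top"
proof -
  have "((\<lambda>x. c + (LINT t:{..x}|lborel. \<Phi> t (C t))) \<longlongrightarrow> c + (LINT t|lborel. \<Phi> t (C t))) at_top"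
    unfolding set_lebesgue_integral_def
    by (intro tendsto_intros tendsto_integral_at_top global_solutionD[OF assms]) simp
  moreover have "(\<lambda>x. c + (LINT t:{..x}|lborel. \<Phi> t (C t))) = C"
    by (rule ext) (rule global_solutionD(4)[OF assms, symmetric])
  ultimately show ?thesis by (simp add: end_value_def)
qed

text \<open>The rates come from \<open>exp (a * \<bar>t\<bar>) \<ge> exp (- a * x)\<close> for \<open>t \<le> x\<close> and
  \<open>exp (a * \<bar>t\<bar>) \<ge> exp (a * x)\<close> for \<open>x \<le> t\<close>.\<close>
lemma global_solution_limit_rate:
  assumes C: "global_solution \<Phi> c C" and a: "0 \<le> a"
    and i: "integrable lborel (\<lambda>t. norm (\<Phi> t (C t)) * exp (a * \<bar>t\<bar>))"
  obtains K where "0 \<le> K" "\<And>x. norm (C x - c) \<le> K * exp (a * x)"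
    "\<And>x. norm (C x - end_value \<Phi> c C) \<le> K * exp (- a * x)"
proof -
  note C' = global_solutionD[OF C]
  define K where "K = (LINT t|lborel. norm (\<Phi> t (C t)) * exp (a * \<bar>t\<bar>))"
  have *: "norm (LINT t:A|lborel. \<Phi> t (C t)) \<le> K * exp y"
    if "A \<in> sets borel" "\<And>t. t \<in> A \<Longrightarrow> 0 \<le> a * \<bar>t\<bar> + y" for A y
  proof -
    have "norm (LINT t:A|lborel. \<Phi> t (C t)) \<le> (LINT t|lborel. norm (\<Phi> t (C t)) * exp (a * \<bar>t\<bar>) * exp y)"
      unfolding set_lebesgue_integral_def
    proof (intro Bochner_Integration.integral_norm_bound_integral)
      fix t
      show "norm (indicator A t *\<^sub>R \<Phi> t (C t)) \<le> norm (\<Phi> t (C t)) * exp (a * \<bar>t\<bar>) * exp y"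
      proof (cases "t \<in> A")
        case True
        then have "1 \<le> exp (a * \<bar>t\<bar> + y)" using that(2) by simp
        from mult_left_mono[OF this, of "norm (\<Phi> t (C t))"] True show ?thesis
          by (simp add: exp_add mult.assoc)
      qed simp
    qed (use i that C'(3) in \<open>auto intro!: integrable_mult_indicator\<close>)
    then show ?thesis by (simp add: K_def)
  qed
  have "C x - c = (LINT t:{..x}|lborel. \<Phi> t (C t))" for x using C'(4)[of x] by (simp add: algebra_simps)
  moreover have "norm (LINT t:{..x}|lborel. \<Phi> t (C t)) \<le> K * exp (a * x)" for x
  proof (rule *)
    fix t assume "t \<in> {..x}"
    then have "0 \<le> a * (\<bar>t\<bar> + x)" by (intro mult_nonneg_nonneg a) auto
    then show "0 \<le> a * \<bar>t\<bar> + a * x" by (simp add: algebra_simps)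
  qed simp
  moreover have "norm (LINT t:{x<..}|lborel. \<Phi> t (C t)) \<le> K * exp (- a * x)" for x
  proof (rule *)
    fix t assume "t \<in> {x<..}"
    then have "0 \<le> a * (\<bar>t\<bar> - x)" by (intro mult_nonneg_nonneg a) auto
    then show "0 \<le> a * \<bar>t\<bar> + - a * x" by (simp add: algebra_simps)
  qed simp
  moreover have "0 \<le> K" unfolding K_def by (intro Bochner_Integration.integral_nonneg) simp
  ultimately show ?thesis using that end_value_diff[OF C] by (metis norm_minus_commute)
qed

lemma norm_complex4_le: "norm (v :: complex^4) \<le> norm (v $ 1) + norm (v $ 2) + norm (v $ 3) + norm (v $ 4)"
  unfolding norm_vec_def by (rule order_trans[OF L2_set_le_sum]) (auto simp: sum_4)

lemma norm_complex4_bound: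
  assumes "\<And>j. norm ((v :: complex^4) $ j) \<le> K"
  shows "norm v \<le> 4 * K"
  using norm_complex4_le[of v] assms[of 1] assms[of 2] assms[of 3] assms[of 4] by simp

lemma borel_measurable_complex4:
  assumes "\<And>j. (\<lambda>x. f x $ j) \<in> borel_measurable M"
  shows "(f :: 'a \<Rightarrow> complex^4) \<in> borel_measurable M"
proof (rule borel_measurable_euclidean_space[THEN iffD2], intro ballI)
  fix i :: "complex^4" assume "i \<in> Basis"
  then obtain j b where i: "i = axis j b" by (auto simp: Basis_vec_def)
  have "(\<lambda>x. f x $ j \<bullet> b) \<in> borel_measurable M" using assms by simp
  then show "(\<lambda>x. f x \<bullet> i) \<in> borel_measurable M" by (simp add: i inner_axis)
qed

section \<open>The four roots and the quasi-derivatives\<close>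

definition rt :: "complex \<Rightarrow> 4 \<Rightarrow> complex" where
  "rt \<kappa> j = (if j = 1 then \<i> * \<kappa> else if j = 2 then - \<i> * \<kappa> else if j = 3 then \<kappa> else - \<kappa>)"

lemma rt_simps [simp]:
  "rt \<kappa> 1 = \<i> * \<kappa>" "rt \<kappa> 2 = - \<i> * \<kappa>" "rt \<kappa> 3 = \<kappa>" "rt \<kappa> 4 = - \<kappa>"
  by (simp_all add: rt_def)

lemma norm_rt [simp]: "norm (rt \<kappa> j) = norm \<kappa>"
  by (simp add: rt_def norm_mult)

lemma rt_pow4: "rt \<kappa> j ^ 4 = \<kappa> ^ 4"
  by (simp add: rt_def power_mult_distrib)

lemma rt_eq_0_iff [simp]: "rt \<kappa> j = 0 \<longleftrightarrow> \<kappa> = 0"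
  by (simp add: rt_def)

lemma tendsto_rt [tendsto_intros]: "(f \<longlongrightarrow> \<kappa>) F \<Longrightarrow> ((\<lambda>n. rt (f n) j) \<longlongrightarrow> rt \<kappa> j) F"
  unfolding rt_def by (auto intro!: tendsto_eq_intros)

text \<open>The roots are ordered \<open>\<i> \<kappa>, - \<i> \<kappa>, \<kappa>, - \<kappa>\<close>; along a solution the third quasi-derivative is
  \<open>u''' - v1 (u' - q)\<close>, the lower ones are ordinary derivatives.\<close>
definition qderiv :: "complex \<Rightarrow> nat \<Rightarrow> real \<Rightarrow> complex^4 \<Rightarrow> complex" where
  "qderiv \<kappa> m t c = (\<Sum>j\<in>UNIV. rt \<kappa> j ^ m * exp (rt \<kappa> j * of_real t) * c $ j)"

lemma qderiv_add: "qderiv \<kappa> m t (c + d) = qderiv \<kappa> m t c + qderiv \<kappa> m t d"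
  by (simp add: qderiv_def sum.distrib algebra_simps)

lemma qderiv_diff: "qderiv \<kappa> m t (c - d) = qderiv \<kappa> m t c - qderiv \<kappa> m t d"
  by (simp add: qderiv_def sum_subtractf algebra_simps)

lemma qderiv_zero [simp]: "qderiv \<kappa> m t 0 = 0"
  by (simp add: qderiv_def)

lemma qderiv_scale: "qderiv \<kappa> m t (a *s c) = a * qderiv \<kappa> m t c"
  by (simp add: qderiv_def sum_distrib_left algebra_simps)

lemma norm_exp_rt_le:
  assumes "norm \<kappa> \<le> R"
  shows "norm (exp (rt \<kappa> j * of_real t)) \<le> exp (R * \<bar>t\<bar>)" "norm (exp (- rt \<kappa> j * of_real t)) \<le> exp (R * \<bar>t\<bar>)"
proof -
  have "norm (exp z) \<le> exp (R * \<bar>t\<bar>)" if "norm z \<le> R * \<bar>t\<bar>" for z :: complex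
    using order_trans[OF complex_Re_le_cmod that] by (simp add: norm_exp_eq_Re)
  moreover have "norm (rt \<kappa> j * of_real t) \<le> R * \<bar>t\<bar>" "norm (- rt \<kappa> j * of_real t) \<le> R * \<bar>t\<bar>"
    using assms by (simp_all add: norm_mult mult_right_mono)
  ultimately show "norm (exp (rt \<kappa> j * of_real t)) \<le> exp (R * \<bar>t\<bar>)" "norm (exp (- rt \<kappa> j * of_real t)) \<le> exp (R * \<bar>t\<bar>)"
    by blast+
qed

lemma norm_qderiv_le:
  assumes "norm \<kappa> \<le> R"
  shows "norm (qderiv \<kappa> m t c) \<le> 4 * R ^ m * exp (R * \<bar>t\<bar>) * norm c"
proof -
  have "norm (qderiv \<kappa> m t c) \<le> (\<Sum>j\<in>(UNIV :: 4 set). R ^ m * exp (R * \<bar>t\<bar>) * norm c)"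
    unfolding qderiv_def
  proof (rule sum_norm_le)
    fix j :: 4
    have R: "0 \<le> R" using assms norm_ge_zero order_trans by blast
    show "norm (rt \<kappa> j ^ m * exp (rt \<kappa> j * of_real t) * c $ j) \<le> R ^ m * exp (R * \<bar>t\<bar>) * norm c"
      unfolding norm_mult norm_power norm_rt
      using assms R by (intro mult_mono norm_exp_rt_le power_mono Finite_Cartesian_Product.norm_nth_le) auto
  qed
  then show ?thesis by simp
qed

lemma continuous_on_qderiv [continuous_intros]:
  assumes "continuous_on S C"
  shows "continuous_on S (\<lambda>t. qderiv \<kappa> m t (C t))"
  unfolding qderiv_def by (intro continuous_intros assms)

text \<open>Decay is recorded as integrability against every exponential, the form in which the
  amplitude system consumes it: its coefficients contain products of a potential with growing
  exponentials.\<close>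

locale potentials =
  fixes v0 v1 :: "real \<Rightarrow> real"
  assumes v0_exp: "\<And>a. integrable lborel (\<lambda>t. v0 t * exp (a * \<bar>t\<bar>))"
    and v1_exp: "\<And>a. integrable lborel (\<lambda>t. v1 t * exp (a * \<bar>t\<bar>))"
begin

lemma v_int: "integrable lborel v0" "integrable lborel v1"
  using v0_exp[of 0] v1_exp[of 0] by simp_all

lemma v_meas [measurable]: "v0 \<in> borel_measurable borel" "v1 \<in> borel_measurable borel"
  using v_int[THEN borel_measurable_integrable] by simp_all

text \<open>Variation of constants for \<open>u'''' - (v1 u')' + v0 u = \<kappa>^4 u - (v1 p')' + v0 p\<close>, where \<open>q = p'\<close>.\<close>
definition ampl_ode :: "complex \<Rightarrow> (real \<Rightarrow> complex) \<Rightarrow> (real \<Rightarrow> complex) \<Rightarrow> real \<Rightarrow> complex^4 \<Rightarrow> complex^4" where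
  "ampl_ode \<kappa> p q t c = (\<chi> j. exp (- rt \<kappa> j * of_real t) / (4 * rt \<kappa> j ^ 3) *
     (- of_real (v0 t) * (qderiv \<kappa> 0 t c - p t) + rt \<kappa> j * of_real (v1 t) * (qderiv \<kappa> 1 t c - q t)))"

abbreviation ampl_ode0 :: "complex \<Rightarrow> real \<Rightarrow> complex^4 \<Rightarrow> complex^4" where
  "ampl_ode0 \<kappa> \<equiv> ampl_ode \<kappa> (\<lambda>_. 0) (\<lambda>_. 0)"

lemma ampl_ode_add: "ampl_ode \<kappa> (\<lambda>x. p x + p' x) (\<lambda>x. q x + q' x) t (v + w) = ampl_ode \<kappa> p q t v + ampl_ode \<kappa> p' q' t w"
  by (simp add: ampl_ode_def vec_eq_iff qderiv_add algebra_simps add_divide_distrib diff_divide_distrib)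

lemma ampl_ode_scale: "ampl_ode \<kappa> (\<lambda>x. a * p x) (\<lambda>x. a * q x) t (a *s v) = a *s ampl_ode \<kappa> p q t v"
  by (simp add: ampl_ode_def vec_eq_iff qderiv_scale algebra_simps add_divide_distrib diff_divide_distrib)

text \<open>The bounds \<open>r\<close> and \<open>R\<close> enclose \<open>norm \<kappa>\<close>,
  so one majorant serves a whole annulus of parameters. The exponential combines the factor in front
  of the right-hand side with the one inside \<open>qderiv\<close>, and the leading 4 counts the
  components, the four roots having cancelled the 4 in the denominator of
  \<open>ampl_ode\<close>.\<close>

definition lip_bound :: "real \<Rightarrow> real \<Rightarrow> real \<Rightarrow> real" where
  "lip_bound r R t = 4 / r ^ 3 * exp (2 * R * \<bar>t\<bar>) * (\<bar>v0 t\<bar> + R\<^sup>2 * \<bar>v1 t\<bar>)"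

definition inhom_bound :: "real \<Rightarrow> real \<Rightarrow> real \<Rightarrow> real \<Rightarrow> real" where
  "inhom_bound r R K t = K / r ^ 3 * exp (R * \<bar>t\<bar>) * (\<bar>v0 t\<bar> + R * \<bar>v1 t\<bar>)"

lemma lip_bound_nonneg: "0 < r \<Longrightarrow> 0 \<le> lip_bound r R t"
  by (simp add: lip_bound_def)

lemma lip_bound_exp_integrable: "integrable lborel (\<lambda>t. lip_bound r R t * exp (a * \<bar>t\<bar>))"
proof -
  have eq: "(\<lambda>t. lip_bound r R t * exp (a * \<bar>t\<bar>)) =
     (\<lambda>t. 4 / r ^ 3 * (\<bar>v0 t * exp ((2 * R + a) * \<bar>t\<bar>)\<bar> + R\<^sup>2 * \<bar>v1 t * exp ((2 * R + a) * \<bar>t\<bar>)\<bar>))"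
    by (simp add: lip_bound_def fun_eq_iff abs_mult exp_add distrib_right) (simp add: algebra_simps)
  show ?thesis unfolding eq
    by (intro integrable_mult_right Bochner_Integration.integrable_add integrable_abs v0_exp v1_exp)
qed

lemma inhom_bound_exp_integrable: "integrable lborel (\<lambda>t. inhom_bound r R K t * exp (a * \<bar>t\<bar>))"
proof -
  have eq: "(\<lambda>t. inhom_bound r R K t * exp (a * \<bar>t\<bar>)) =
     (\<lambda>t. K / r ^ 3 * (\<bar>v0 t * exp ((R + a) * \<bar>t\<bar>)\<bar> + R * \<bar>v1 t * exp ((R + a) * \<bar>t\<bar>)\<bar>))"
    by (simp add: inhom_bound_def fun_eq_iff abs_mult exp_add distrib_right) (simp add: algebra_simps)
  show ?thesis unfolding eq
    by (intro integrable_mult_right Bochner_Integration.integrable_add integrable_abs v0_exp v1_exp)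
qed

lemma ampl_ode_component_bound:
  assumes r: "0 < r" "r \<le> norm \<kappa>" and R: "norm \<kappa> \<le> R"
  shows "norm (exp (- rt \<kappa> j * of_real t) / (4 * rt \<kappa> j ^ 3) * (- of_real (v0 t) * A + rt \<kappa> j * of_real (v1 t) * B))
    \<le> exp (R * \<bar>t\<bar>) / (4 * r ^ 3) * (\<bar>v0 t\<bar> * norm A + R * \<bar>v1 t\<bar> * norm B)"
proof -
  have "norm (- of_real (v0 t) * A + rt \<kappa> j * of_real (v1 t) * B) \<le> \<bar>v0 t\<bar> * norm A + norm \<kappa> * \<bar>v1 t\<bar> * norm B"
    by (rule order_trans[OF norm_triangle_ineq]) (simp add: norm_mult)
  also have "\<dots> \<le> \<bar>v0 t\<bar> * norm A + R * \<bar>v1 t\<bar> * norm B"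
    using R by (intro add_left_mono mult_right_mono) auto
  finally have 1: "norm (- of_real (v0 t) * A + rt \<kappa> j * of_real (v1 t) * B) \<le> \<bar>v0 t\<bar> * norm A + R * \<bar>v1 t\<bar> * norm B" .
  have 2: "norm (exp (- rt \<kappa> j * of_real t) / (4 * rt \<kappa> j ^ 3)) \<le> exp (R * \<bar>t\<bar>) / (4 * r ^ 3)"
    unfolding norm_divide norm_mult norm_power norm_rt using r
    by (intro frac_le norm_exp_rt_le[OF R] mult_left_mono power_mono) auto
  show ?thesis unfolding norm_mult[of "_ / _"]
    using r by (intro mult_mono 1 2) auto
qed

lemma ampl_ode_lipschitz:
  assumes r: "0 < r" "r \<le> norm \<kappa>" and R: "norm \<kappa> \<le> R"
  shows "norm (ampl_ode \<kappa> p q t v - ampl_ode \<kappa> p q t w) \<le> lip_bound r R t * norm (v - w)"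
proof -
  have R0: "0 \<le> R" using r R by linarith
  have "norm ((ampl_ode \<kappa> p q t v - ampl_ode \<kappa> p q t w) $ j) \<le> lip_bound r R t * norm (v - w) / 4" for j
  proof -
    let ?d = "v - w"
    have "(ampl_ode \<kappa> p q t v - ampl_ode \<kappa> p q t w) $ j = exp (- rt \<kappa> j * of_real t) / (4 * rt \<kappa> j ^ 3) *
       (- of_real (v0 t) * qderiv \<kappa> 0 t ?d + rt \<kappa> j * of_real (v1 t) * qderiv \<kappa> 1 t ?d)"
      by (simp add: ampl_ode_def qderiv_diff algebra_simps add_divide_distrib diff_divide_distrib)
    also have "norm \<dots> \<le> exp (R * \<bar>t\<bar>) / (4 * r ^ 3) * (\<bar>v0 t\<bar> * norm (qderiv \<kappa> 0 t ?d) + R * \<bar>v1 t\<bar> * norm (qderiv \<kappa> 1 t ?d))"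
      by (rule ampl_ode_component_bound[OF assms])
    also have "\<dots> \<le> exp (R * \<bar>t\<bar>) / (4 * r ^ 3) * (\<bar>v0 t\<bar> * (4 * R ^ 0 * exp (R * \<bar>t\<bar>) * norm ?d) + R * \<bar>v1 t\<bar> * (4 * R ^ 1 * exp (R * \<bar>t\<bar>) * norm ?d))"
      using r R0 by (intro mult_left_mono add_mono norm_qderiv_le[OF R]) auto
    also have "\<dots> = lip_bound r R t * norm ?d / 4"
    proof -
      have "exp (2 * R * \<bar>t\<bar>) = exp (R * \<bar>t\<bar>) * exp (R * \<bar>t\<bar>)" by (simp add: exp_add[symmetric])
      then show ?thesis using r by (simp add: lip_bound_def field_simps power2_eq_square)
    qed
    finally show ?thesis .
  qed
  from norm_complex4_bound[OF this] show ?thesis by simp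
qed

lemma ampl_ode_zero_bound:
  assumes r: "0 < r" "r \<le> norm \<kappa>" and R: "norm \<kappa> \<le> R"
    and p: "norm (p t) \<le> K" and q: "norm (q t) \<le> K"
  shows "norm (ampl_ode \<kappa> p q t 0) \<le> inhom_bound r R K t"
proof -
  have R0: "0 \<le> R" using r R by linarith
  have "norm (ampl_ode \<kappa> p q t 0 $ j) \<le> inhom_bound r R K t / 4" for j
  proof -
    have "norm (ampl_ode \<kappa> p q t 0 $ j) \<le> exp (R * \<bar>t\<bar>) / (4 * r ^ 3) * (\<bar>v0 t\<bar> * norm (- p t) + R * \<bar>v1 t\<bar> * norm (- q t))"
      using ampl_ode_component_bound[OF assms(1-3), of j t "- p t" "- q t"] by (simp add: ampl_ode_def)
    also have "\<dots> \<le> exp (R * \<bar>t\<bar>) / (4 * r ^ 3) * (\<bar>v0 t\<bar> * K + R * \<bar>v1 t\<bar> * K)"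
      using p q r R0 by (intro mult_left_mono add_mono) auto
    also have "\<dots> = inhom_bound r R K t / 4" using r by (simp add: inhom_bound_def field_simps)
    finally show ?thesis .
  qed
  from norm_complex4_bound[OF this] show ?thesis by simp
qed

lemma ampl_ode_bound:
  assumes r: "0 < r" "r \<le> norm \<kappa>" and R: "norm \<kappa> \<le> R"
    and p: "norm (p t) \<le> K" and q: "norm (q t) \<le> K" and v: "norm v \<le> L"
  shows "norm (ampl_ode \<kappa> p q t v) \<le> inhom_bound r R K t + lip_bound r R t * L"
proof -
  have "norm (ampl_ode \<kappa> p q t v) \<le> norm (ampl_ode \<kappa> p q t 0) + norm (ampl_ode \<kappa> p q t v - ampl_ode \<kappa> p q t 0)"
    by (metis add.commute diff_add_cancel norm_triangle_ineq)
  also have "norm (ampl_ode \<kappa> p q t v - ampl_ode \<kappa> p q t 0) \<le> lip_bound r R t * L"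
    using ampl_ode_lipschitz[OF assms(1-3), of p q t v 0] mult_left_mono[OF v lip_bound_nonneg[OF r(1)], of R t] by simp
  finally show ?thesis using ampl_ode_zero_bound[of r \<kappa> R p t K q, OF assms(1-5)] by simp
qed

lemma ampl_ode_measurable:
  assumes "continuous_on UNIV p" "continuous_on UNIV q" "continuous_on UNIV C"
  shows "(\<lambda>t. ampl_ode \<kappa> p q t (C t)) \<in> borel_measurable borel"
proof (rule borel_measurable_complex4)
  fix j
  have [measurable]: "(\<lambda>t. exp (- rt \<kappa> j * of_real t)) \<in> borel_measurable borel"
    "(\<lambda>t. qderiv \<kappa> 0 t (C t)) \<in> borel_measurable borel" "(\<lambda>t. qderiv \<kappa> 1 t (C t)) \<in> borel_measurable borel"
    "p \<in> borel_measurable borel" "q \<in> borel_measurable borel"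
    using assms by (auto intro!: borel_measurable_continuous_onI continuous_intros)
  show "(\<lambda>t. ampl_ode \<kappa> p q t (C t) $ j) \<in> borel_measurable borel"
    unfolding ampl_ode_def vec_lambda_beta
    by (intro borel_measurable_times borel_measurable_add borel_measurable_diff borel_measurable_uminus) measurable
qed

definition admissible :: "(real \<Rightarrow> complex) \<Rightarrow> (real \<Rightarrow> complex) \<Rightarrow> bool" where
  "admissible p q \<longleftrightarrow> continuous_on UNIV p \<and> continuous_on UNIV q \<and> (\<exists>K. \<forall>t. norm (p t) \<le> K \<and> norm (q t) \<le> K)"

lemma admissible_zero [simp]: "admissible (\<lambda>_. 0) (\<lambda>_. 0)"
  by (auto simp: admissible_def)

lemma ampl_ode_exp_integrable:
  assumes \<kappa>: "\<kappa> \<noteq> 0" and pq: "admissible p q" and C: "continuous_on UNIV C" "\<And>x. norm (C x) \<le> L"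
  shows "integrable lborel (\<lambda>t. norm (ampl_ode \<kappa> p q t (C t)) * exp (a * \<bar>t\<bar>))"
proof -
  obtain K where K: "\<And>t. norm (p t) \<le> K" "\<And>t. norm (q t) \<le> K"
    and c: "continuous_on UNIV p" "continuous_on UNIV q" using pq by (auto simp: admissible_def)
  let ?k = "norm \<kappa>"
  show ?thesis
  proof (rule Bochner_Integration.integrable_bound)
    show "integrable lborel (\<lambda>t. inhom_bound ?k ?k K t * exp (a * \<bar>t\<bar>) + L * (lip_bound ?k ?k t * exp (a * \<bar>t\<bar>)))"
      by (intro Bochner_Integration.integrable_add inhom_bound_exp_integrable integrable_mult_right lip_bound_exp_integrable)
    show "AE t in lborel. norm (norm (ampl_ode \<kappa> p q t (C t)) * exp (a * \<bar>t\<bar>))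
        \<le> norm (inhom_bound ?k ?k K t * exp (a * \<bar>t\<bar>) + L * (lip_bound ?k ?k t * exp (a * \<bar>t\<bar>)))"
    proof (intro AE_I2)
      fix t
      have "norm (ampl_ode \<kappa> p q t (C t)) \<le> inhom_bound ?k ?k K t + lip_bound ?k ?k t * L"
        using \<kappa> by (intro ampl_ode_bound K C) auto
      from mult_right_mono[OF this, of "exp (a * \<bar>t\<bar>)"]
      show "norm (norm (ampl_ode \<kappa> p q t (C t)) * exp (a * \<bar>t\<bar>))
        \<le> norm (inhom_bound ?k ?k K t * exp (a * \<bar>t\<bar>) + L * (lip_bound ?k ?k t * exp (a * \<bar>t\<bar>)))"
        by (simp add: algebra_simps)
    qed
    show "(\<lambda>t. norm (ampl_ode \<kappa> p q t (C t)) * exp (a * \<bar>t\<bar>)) \<in> borel_measurable lborel"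
      using ampl_ode_measurable[OF c C(1), of \<kappa>] by measurable
  qed
qed

lemma ampl_ode_integrable:
  assumes \<kappa>: "\<kappa> \<noteq> 0" and pq: "admissible p q" and C: "continuous_on UNIV C" "\<And>x. norm (C x) \<le> L"
  shows "integrable lborel (\<lambda>t. ampl_ode \<kappa> p q t (C t))"
proof -
  have "(\<lambda>t. ampl_ode \<kappa> p q t (C t)) \<in> borel_measurable borel"
    using pq C by (intro ampl_ode_measurable) (auto simp: admissible_def)
  with ampl_ode_exp_integrable[OF assms, of 0] show ?thesis by (simp add: integrable_norm_iff)
qed

lemma solution_exists:
  assumes \<kappa>: "\<kappa> \<noteq> 0" and pq: "admissible p q"
  shows "\<exists>C. global_solution (ampl_ode \<kappa> p q) c C"
proof (rule global_solution_exists)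
  show "integrable lborel (lip_bound (norm \<kappa>) (norm \<kappa>))" using lip_bound_exp_integrable[of _ _ 0] by simp
  show "0 \<le> lip_bound (norm \<kappa>) (norm \<kappa>) t" for t using \<kappa> by (simp add: lip_bound_nonneg)
  show "norm (ampl_ode \<kappa> p q t v - ampl_ode \<kappa> p q t w) \<le> lip_bound (norm \<kappa>) (norm \<kappa>) t * norm (v - w)" for t v w
    using \<kappa> by (intro ampl_ode_lipschitz) auto
  show "integrable lborel (\<lambda>t. ampl_ode \<kappa> p q t 0)" using ampl_ode_integrable[OF assms, of "\<lambda>_. 0" 0] by simp
  show "(\<lambda>t. ampl_ode \<kappa> p q t (C t)) \<in> borel_measurable lborel" if "continuous_on UNIV C" for C
    using pq that ampl_ode_measurable by (simp add: admissible_def)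
qed

text \<open>Every rate \<open>a\<close> is reached, since the potentials stay integrable after
  multiplication by any exponential. Applications choose \<open>a\<close> large enough to beat the
  growth of the exponentials multiplying the amplitudes.\<close>

lemma solution_rate:
  assumes \<kappa>: "\<kappa> \<noteq> 0" and pq: "admissible p q" and C: "global_solution (ampl_ode \<kappa> p q) c C" and a: "0 \<le> a"
  obtains K where "0 \<le> K" "\<And>x. norm (C x - c) \<le> K * exp (a * x)"
    "\<And>x. norm (C x - end_value (ampl_ode \<kappa> p q) c C) \<le> K * exp (- a * x)"
proof -
  obtain L where L: "\<And>x. norm (C x) \<le> L" using global_solution_bounded[OF C] by metis
  show ?thesis
    using global_solution_limit_rate[OF C a ampl_ode_exp_integrable[OF \<kappa> pq global_solutionD(1)[OF C] L]] that by metis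
qed

lemma qderiv_tendsto:
  assumes "\<kappa>n \<longlonglongrightarrow> \<kappa>" "cn \<longlonglongrightarrow> c"
  shows "(\<lambda>n. qderiv (\<kappa>n n) m t (cn n)) \<longlonglongrightarrow> qderiv \<kappa> m t c"
  unfolding qderiv_def by (intro tendsto_intros assms)

lemma ampl_ode_tendsto:
  assumes "\<kappa>n \<longlonglongrightarrow> \<kappa>" "\<kappa> \<noteq> 0"
  shows "(\<lambda>n. ampl_ode (\<kappa>n n) p q t v) \<longlonglongrightarrow> ampl_ode \<kappa> p q t v"
  unfolding ampl_ode_def
  by (intro vec_tendstoI, simp only: vec_lambda_beta)
     (intro tendsto_intros qderiv_tendsto assms, use assms in simp)

text \<open>The systems for \<open>\<kappa>n n\<close> and \<open>\<kappa>\<close> are compared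
  along the fixed solution \<open>C\<close>, where their difference tends to 0 by dominated
  convergence. The resulting bound is uniform in \<open>x\<close>, hence it passes to +infinity and
  controls the end values too.\<close>

lemma solution_continuous_dependence:
  assumes \<kappa>n: "\<kappa>n \<longlonglongrightarrow> \<kappa>" and \<kappa>: "\<kappa> \<noteq> 0" and pq: "admissible p q"
    and cn: "cn \<longlonglongrightarrow> c" and Cn: "\<And>n. global_solution (ampl_ode (\<kappa>n n) p q) (cn n) (Cn n)"
    and C: "global_solution (ampl_ode \<kappa> p q) c C"
  shows "(\<lambda>n. Cn n x) \<longlonglongrightarrow> C x"
    and "(\<lambda>n. end_value (ampl_ode (\<kappa>n n) p q) (cn n) (Cn n)) \<longlonglongrightarrow> end_value (ampl_ode \<kappa> p q) c C"
proof -
  define r R where "r = norm \<kappa> / 2" and "R = 2 * norm \<kappa>"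
  have r: "0 < r" "r < norm \<kappa>" "norm \<kappa> < R" using \<kappa> by (auto simp: r_def R_def)
  have ev: "\<forall>\<^sub>F n in sequentially. r \<le> norm (\<kappa>n n) \<and> norm (\<kappa>n n) \<le> R"
    using eventually_conj[OF order_tendstoD(1)[OF tendsto_norm[OF \<kappa>n] r(2)] order_tendstoD(2)[OF tendsto_norm[OF \<kappa>n] r(3)]]
    by (rule eventually_mono) auto
  obtain K where K: "\<And>t. norm (p t) \<le> K" "\<And>t. norm (q t) \<le> K"
    and pqc: "continuous_on UNIV p" "continuous_on UNIV q" using pq by (auto simp: admissible_def)
  obtain L where L: "0 \<le> L" "\<And>x. norm (C x) \<le> L" using global_solution_bounded[OF C] by metis
  note cC = global_solutionD(1)[OF C]
  have "integrable lborel (lip_bound r R)" using lip_bound_exp_integrable[of r R 0] by simp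
  from global_solution_stable[OF this lip_bound_nonneg[OF r(1)]]
  obtain M where M: "\<forall>\<Phi> \<Psi> c e (C :: real \<Rightarrow> complex^4) E x.
    (\<forall>t v w. norm (\<Phi> t v - \<Phi> t w) \<le> lip_bound r R t * norm (v - w)) \<longrightarrow>
    global_solution \<Phi> c C \<longrightarrow> global_solution \<Psi> e E \<longrightarrow> integrable lborel (\<lambda>t. \<Phi> t (E t)) \<longrightarrow>
    norm (C x - E x) \<le> M * (norm (c - e) + (LINT t|lborel. norm (\<Phi> t (E t) - \<Psi> t (E t))))"
    by (rule exE)
  let ?\<delta> = "\<lambda>n. norm (cn n - c) + (LINT t|lborel. norm (ampl_ode (\<kappa>n n) p q t (C t) - ampl_ode \<kappa> p q t (C t)))"
  have "(\<lambda>n. LINT t|lborel. norm (ampl_ode (\<kappa>n n) p q t (C t) - ampl_ode \<kappa> p q t (C t))) \<longlonglongrightarrow> (LINT t|(lborel :: real measure). (0::real))"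
  proof -
    \<comment> \<open>Dropping finitely many terms puts all remaining parameters into the annulus,
      so that one dominating function works for every index.\<close>
    obtain N where N: "\<And>n. n \<ge> N \<Longrightarrow> r \<le> norm (\<kappa>n n) \<and> norm (\<kappa>n n) \<le> R"
      using ev by (auto simp: eventually_sequentially)
    have "(\<lambda>n. LINT t|lborel. norm (ampl_ode (\<kappa>n (n + N)) p q t (C t) - ampl_ode \<kappa> p q t (C t))) \<longlonglongrightarrow> (LINT t|(lborel :: real measure). (0::real))"
    proof (rule integral_dominated_convergence[where w = "\<lambda>t. 2 * (inhom_bound r R K t + L * lip_bound r R t)"])
      show "integrable lborel (\<lambda>t. 2 * (inhom_bound r R K t + L * lip_bound r R t))"
        using inhom_bound_exp_integrable[of r R K 0] lip_bound_exp_integrable[of r R 0] by simp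
      have m: "(\<lambda>t. ampl_ode \<kappa>' p q t (C t)) \<in> borel_measurable lborel" for \<kappa>'
        using ampl_ode_measurable[OF pqc cC] by simp
      show "(\<lambda>t. norm (ampl_ode (\<kappa>n (n + N)) p q t (C t) - ampl_ode \<kappa> p q t (C t))) \<in> borel_measurable lborel" for n
        by (rule measurable_compose[OF borel_measurable_diff[OF m m] borel_measurable_norm])
      show "AE t in lborel. (\<lambda>n. norm (ampl_ode (\<kappa>n (n + N)) p q t (C t) - ampl_ode \<kappa> p q t (C t))) \<longlonglongrightarrow> 0"
      proof (intro AE_I2)
        fix t
        have "(\<lambda>n. ampl_ode (\<kappa>n (n + N)) p q t (C t)) \<longlonglongrightarrow> ampl_ode \<kappa> p q t (C t)"
          by (rule ampl_ode_tendsto[OF LIMSEQ_ignore_initial_segment[OF \<kappa>n] \<kappa>])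
        then show "(\<lambda>n. norm (ampl_ode (\<kappa>n (n + N)) p q t (C t) - ampl_ode \<kappa> p q t (C t))) \<longlonglongrightarrow> 0"
          using LIM_zero tendsto_norm_zero by blast
      qed
      fix n
      show "AE t in lborel. norm (norm (ampl_ode (\<kappa>n (n + N)) p q t (C t) - ampl_ode \<kappa> p q t (C t))) \<le> 2 * (inhom_bound r R K t + L * lip_bound r R t)"
      proof (intro AE_I2)
        fix t
        have "norm (ampl_ode (\<kappa>n (n + N)) p q t (C t)) \<le> inhom_bound r R K t + lip_bound r R t * L"
          using N[of "n + N"] r K L by (intro ampl_ode_bound) auto
        moreover have "norm (ampl_ode \<kappa> p q t (C t)) \<le> inhom_bound r R K t + lip_bound r R t * L"
          using r K L by (intro ampl_ode_bound) auto
        ultimately show "norm (norm (ampl_ode (\<kappa>n (n + N)) p q t (C t) - ampl_ode \<kappa> p q t (C t))) \<le> 2 * (inhom_bound r R K t + L * lip_bound r R t)"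
          using norm_triangle_ineq4[of "ampl_ode (\<kappa>n (n + N)) p q t (C t)" "ampl_ode \<kappa> p q t (C t)"] by (simp add: algebra_simps)
      qed
    qed simp
    then show ?thesis by (rule LIMSEQ_offset)
  qed
  then have "(\<lambda>n. M * ?\<delta> n) \<longlonglongrightarrow> M * (0 + 0)"
    by (intro tendsto_intros tendsto_norm_zero) (use cn LIM_zero in \<open>auto\<close>)
  then have \<delta>0: "(\<lambda>n. M * ?\<delta> n) \<longlonglongrightarrow> 0" by simp
  have bound: "\<forall>\<^sub>F n in sequentially. \<forall>x. norm (Cn n x - C x) \<le> M * ?\<delta> n"
    using ev
  proof eventually_elim
    case (elim n)
    have "\<kappa>n n \<noteq> 0" using elim r by auto
    then show ?case
      using elim r by (intro allI M[rule_format] ampl_ode_lipschitz Cn C ampl_ode_integrable[OF _ pq cC L(2)]) auto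
  qed
  show "(\<lambda>n. Cn n x) \<longlonglongrightarrow> C x"
    by (rule LIM_zero_cancel, rule Lim_null_comparison[OF _ \<delta>0]) (use bound in \<open>auto elim: eventually_mono\<close>)
  have "\<forall>\<^sub>F n in sequentially. norm (end_value (ampl_ode (\<kappa>n n) p q) (cn n) (Cn n) - end_value (ampl_ode \<kappa> p q) c C) \<le> M * ?\<delta> n"
    using bound
  proof eventually_elim
    case (elim n)
    \<comment> \<open>The uniform bound survives the limit of \<open>x\<close> to +infinity for
      fixed \<open>n\<close>.\<close>
    have "((\<lambda>x. norm (Cn n x - C x)) \<longlongrightarrow> norm (end_value (ampl_ode (\<kappa>n n) p q) (cn n) (Cn n) - end_value (ampl_ode \<kappa> p q) c C)) at_top"
      by (intro tendsto_intros end_value_tendsto Cn C)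
    then show ?case by (rule tendsto_upperbound) (use elim in auto)
  qed
  then show "(\<lambda>n. end_value (ampl_ode (\<kappa>n n) p q) (cn n) (Cn n)) \<longlonglongrightarrow> end_value (ampl_ode \<kappa> p q) c C"
    by (intro LIM_zero_cancel[OF Lim_null_comparison[OF _ \<delta>0]])
qed

text \<open>Continuous dependence for constant sequences: a constant sequence that converges to
  \<open>E x\<close> equals it.\<close>

lemma solution_unique:
  assumes \<kappa>: "\<kappa> \<noteq> 0" and pq: "admissible p q"
    and "global_solution (ampl_ode \<kappa> p q) c C" "global_solution (ampl_ode \<kappa> p q) c E"
  shows "C = E"
proof
  fix x
  show "C x = E x"
    using solution_continuous_dependence(1)[of "\<lambda>_. \<kappa>" \<kappa> p q "\<lambda>_. c" c "\<lambda>_. C" E x] assms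
    by (auto dest: LIMSEQ_unique[OF tendsto_const])
qed

end

section \<open>The form domain\<close>

lemma integrable_exp_minus_abs:
  assumes "0 < (\<delta>::real)"
  shows "integrable lborel (\<lambda>x. exp (- \<delta> * \<bar>x\<bar>))"
proof -
  let ?g = "\<lambda>x::real. exp (- \<delta> * x) * indicator {0..} x"
  have lim: "((\<lambda>x. - exp (- \<delta> * x) / \<delta>) \<longlongrightarrow> - 0 / \<delta>) at_top"
    by (intro tendsto_intros filterlim_compose[OF exp_at_bot] filterlim_tendsto_neg_mult_at_bot[where c = "- \<delta>"] filterlim_ident)
       (use assms in auto)
  have "(\<integral>\<^sup>+ x. ennreal (exp (- \<delta> * x)) * indicator {0..} x \<partial>lborel) = (- 0 / \<delta>) - (- exp (- \<delta> * 0) / \<delta>)"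
    by (rule nn_integral_FTC_atLeast[OF _ _ _ lim]) (use assms in \<open>auto intro!: derivative_eq_intros\<close>)
  then have g: "integrable lborel ?g"
    by (intro integrableI_nonneg) (auto simp: ennreal_mult' ennreal_indicator less_top[symmetric])
  then have g': "integrable lborel (\<lambda>x. ?g (0 + (- 1) * x))"
    by (rule lborel_integrable_real_affine) simp
  show ?thesis
    by (rule Bochner_Integration.integrable_bound[OF Bochner_Integration.integrable_add[OF g g']]) (auto simp: indicator_def)
qed

lemma exp_decay_tendsto:
  fixes f :: "real \<Rightarrow> complex"
  assumes "0 < \<delta>" and f: "\<And>x. norm (f x) \<le> K * exp (- \<delta> * \<bar>x\<bar>)"
  shows "(f \<longlongrightarrow> 0) at_top" "(f \<longlongrightarrow> 0) at_bot"
proof -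
  have 0: "((\<lambda>x. K * exp (- \<delta> * \<bar>x\<bar>)) \<longlongrightarrow> K * 0) at_top"
    by (intro tendsto_intros filterlim_compose[OF exp_at_bot] filterlim_tendsto_neg_mult_at_bot[where c = "- \<delta>"] filterlim_abs_real)
       (use assms in auto)
  then have 0: "((\<lambda>x. K * exp (- \<delta> * \<bar>x\<bar>)) \<longlongrightarrow> 0) at_top" by simp
  show "(f \<longlongrightarrow> 0) at_top"
    by (rule Lim_null_comparison[OF always_eventually 0]) (intro allI f)
  have "((\<lambda>x. K * exp (- \<delta> * \<bar>- x\<bar>)) \<longlongrightarrow> 0) at_bot"
    by (rule filterlim_compose[OF 0 filterlim_uminus_at_top_at_bot])
  then have 1: "((\<lambda>x. K * exp (- \<delta> * \<bar>x\<bar>)) \<longlongrightarrow> 0) at_bot" by simp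
  show "(f \<longlongrightarrow> 0) at_bot"
    by (rule Lim_null_comparison[OF always_eventually 1]) (intro allI f)
qed

lemma exp_decay_integrable:
  fixes f :: "real \<Rightarrow> complex"
  assumes "0 < \<delta>" and f: "\<And>x. norm (f x) \<le> K * exp (- \<delta> * \<bar>x\<bar>)" and c: "continuous_on UNIV f"
  shows "integrable lborel f" "integrable lborel (\<lambda>x. (norm (f x))\<^sup>2)"
proof -
  have [measurable]: "f \<in> borel_measurable borel" by (rule borel_measurable_continuous_onI[OF c])
  have K0: "0 \<le> K" using order_trans[OF norm_ge_zero f[of 0]] by simp
  have i: "integrable lborel (\<lambda>x. K * exp (- \<delta> * \<bar>x\<bar>))"
    by (intro integrable_mult_right integrable_exp_minus_abs assms)
  show *: "integrable lborel f"
    by (rule Bochner_Integration.integrable_bound[OF i]) (use f K0 in auto)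
  show "integrable lborel (\<lambda>x. (norm (f x))\<^sup>2)"
  proof (rule Bochner_Integration.integrable_bound[OF integrable_mult_right[OF integrable_norm[OF *], of K]])
    show "AE x in lborel. norm ((norm (f x))\<^sup>2) \<le> norm (K * norm (f x))"
    proof (intro AE_I2)
      fix x
      have "norm (f x) \<le> K"
      proof (rule order_trans[OF f])
        have "exp (- \<delta> * \<bar>x\<bar>) \<le> 1" using assms(1) by simp
        from mult_left_mono[OF this K0] show "K * exp (- \<delta> * \<bar>x\<bar>) \<le> K" by simp
      qed
      from mult_right_mono[OF this norm_ge_zero[of "f x"]] K0
      show "norm ((norm (f x))\<^sup>2) \<le> norm (K * norm (f x))" by (simp add: power2_eq_square)
    qed
  qed measurable
qed

lemma borel_measurable_cnj [measurable]: "cnj \<in> borel_measurable borel"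
  by (intro borel_measurable_continuous_onI continuous_intros)

lemma integrable_mult_bounded:
  fixes g f :: "real \<Rightarrow> complex"
  assumes g: "integrable lborel g" and f: "f \<in> borel_measurable borel" "\<And>x. norm (f x) \<le> K"
  shows "integrable lborel (\<lambda>x. g x * f x)"
proof (rule Bochner_Integration.integrable_bound)
  show "integrable lborel (\<lambda>x. K * norm (g x))" using g by simp
  show "AE x in lborel. norm (g x * f x) \<le> norm (K * norm (g x))"
  proof (intro AE_I2)
    fix x
    have "norm (g x) * norm (f x) \<le> norm (g x) * \<bar>K\<bar>"
      using f(2)[of x] by (intro mult_left_mono) auto
    then show "norm (g x * f x) \<le> norm (K * norm (g x))" by (simp add: norm_mult abs_mult mult.commute)
  qed
  show "(\<lambda>x. g x * f x) \<in> borel_measurable lborel"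
    using borel_measurable_integrable[OF g] f by simp
qed

lemma integrable_square_mult:
  fixes g f :: "real \<Rightarrow> complex"
  assumes g: "integrable lborel (\<lambda>x. (norm (g x))\<^sup>2)" and f: "integrable lborel (\<lambda>x. (norm (f x))\<^sup>2)"
    and m: "g \<in> borel_measurable borel" "f \<in> borel_measurable borel"
  shows "integrable lborel (\<lambda>x. g x * cnj (f x))"
proof (rule Bochner_Integration.integrable_bound)
  show "integrable lborel (\<lambda>x. (norm (g x))\<^sup>2 + (norm (f x))\<^sup>2)" using g f by simp
  show "AE x in lborel. norm (g x * cnj (f x)) \<le> norm ((norm (g x))\<^sup>2 + (norm (f x))\<^sup>2)"
  proof (intro AE_I2)
    fix x
    have "2 * norm (g x) * norm (f x) \<le> (norm (g x))\<^sup>2 + (norm (f x))\<^sup>2" by (rule sum_squares_bound)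
    moreover have "0 \<le> norm (g x) * norm (f x)" by simp
    ultimately have "norm (g x) * norm (f x) \<le> (norm (g x))\<^sup>2 + (norm (f x))\<^sup>2" by linarith
    then show "norm (g x * cnj (f x)) \<le> norm ((norm (g x))\<^sup>2 + (norm (f x))\<^sup>2)"
      by (simp add: norm_mult)
  qed
  show "(\<lambda>x. g x * cnj (f x)) \<in> borel_measurable lborel"
    using m by measurable
qed

text \<open>A one-dimensional Sobolev embedding. Every unit interval contains a point where the
  square of \<open>f\<close> is at most \<open>F + 1\<close>, since otherwise its integral would
  exceed \<open>F\<close>. From there \<open>f\<close> moves by at most the integral of
  \<open>norm g\<close> over the interval, for which \<open>y \<le> 1 + y\<^sup>2\<close> replaces
  the Cauchy-Schwarz inequality.\<close>

lemma primitive_bounded: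
  fixes f g :: "real \<Rightarrow> complex"
  assumes p: "primitive f g" and f: "integrable lborel (\<lambda>x. (norm (f x))\<^sup>2)" and g: "integrable lborel (\<lambda>x. (norm (g x))\<^sup>2)"
  obtains K where "\<And>x. norm (f x) \<le> K"
proof -
  define F where "F = (LINT x|lborel. (norm (f x))\<^sup>2)"
  define G where "G = (LINT x|lborel. (norm (g x))\<^sup>2)"
  have sq: "y \<le> 1 + y\<^sup>2" for y :: real
    using sum_squares_bound[of y 1] zero_le_power2[of y] by (cases "y \<ge> 0") (simp, linarith)
  have const: "(LINT t:{x..x+1}|lborel. a) = a" for x a :: real
    by (simp add: set_lebesgue_integral_def)
  have si: "set_integrable lborel {x..x+1} (\<lambda>_. a)" for x a :: real
    by (simp add: set_integrable_def)
  have le: "(LINT t:{x..x+1}|lborel. (norm (h t))\<^sup>2) \<le> (LINT t|lborel. (norm (h t))\<^sup>2)"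
    if "integrable lborel (\<lambda>x. (norm (h x))\<^sup>2)" for h :: "real \<Rightarrow> complex" and x
    unfolding set_lebesgue_integral_def
    using that by (intro integral_mono integrable_mult_indicator) (auto simp: indicator_def)
  have "norm (f x) \<le> (1 + (F + 1)) + (1 + G)" for x
  proof -
    have "\<exists>y\<in>{x..x+1}. (norm (f y))\<^sup>2 \<le> F + 1"
    proof (rule ccontr)
      assume "\<not> ?thesis"
      then have "(LINT t:{x..x+1}|lborel. F + 1) \<le> (LINT t:{x..x+1}|lborel. (norm (f t))\<^sup>2)"
        by (intro set_integral_mono si integrable_imp_set_integrable f) (auto simp: not_le intro: less_imp_le)
      with le[OF f, of x] show False unfolding const by (simp add: F_def)
    qed
    then obtain y where y: "x \<le> y" "y \<le> x + 1" "(norm (f y))\<^sup>2 \<le> F + 1" by auto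
    have sg: "set_integrable lborel A (\<lambda>t. norm (g t))" if "A = {a..b}" for A a b
      using set_integrable_norm[OF primitive_integrable[OF p]] that by simp
    have "norm (f y - f x) \<le> (LINT t:{x..y}|lborel. norm (g t))"
      using set_integral_norm_bound[OF primitive_integrable[OF p]] primitive_diff_eq[OF p y(1)] by simp
    also have "\<dots> \<le> (LINT t:{x..x+1}|lborel. norm (g t))"
      using y(2) sg[of "{x..y}" x y] sg[of "{x..x+1}" x "x+1"] unfolding set_lebesgue_integral_def set_integrable_def
      by (intro integral_mono) (auto simp: indicator_def)
    also have "\<dots> \<le> (LINT t:{x..x+1}|lborel. 1 + (norm (g t))\<^sup>2)"
      by (intro set_integral_mono sg[OF refl] set_integral_add si integrable_imp_set_integrable g sq) simp
    also have "\<dots> = 1 + (LINT t:{x..x+1}|lborel. (norm (g t))\<^sup>2)"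
      by (subst set_integral_add) (auto intro!: si integrable_imp_set_integrable g simp: const)
    also have "\<dots> \<le> 1 + G" using le[OF g, of x] by (simp add: G_def)
    finally have "norm (f y - f x) \<le> 1 + G" .
    moreover have "norm (f x) \<le> norm (f y) + norm (f y - f x)"
      by (metis add.commute diff_add_cancel norm_minus_commute norm_triangle_ineq)
    moreover have "norm (f y) \<le> 1 + (F + 1)" using sq[of "norm (f y)"] y(3) by simp
    ultimately show ?thesis by linarith
  qed
  then show ?thesis using that by blast
qed

lemma H2D:
  assumes "H2 u u1 u2"
  shows "primitive u u1" "primitive u1 u2" "continuous_on UNIV u" "continuous_on UNIV u1"
    "u \<in> borel_measurable borel" "u1 \<in> borel_measurable borel" "u2 \<in> borel_measurable borel"
    "integrable lborel (\<lambda>x. (norm (u x))\<^sup>2)" "integrable lborel (\<lambda>x. (norm (u1 x))\<^sup>2)"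
    "integrable lborel (\<lambda>x. (norm (u2 x))\<^sup>2)"
proof -
  show p1: "primitive u1 u2" using assms by (simp add: H2_def primitive_def)
  show c1: "continuous_on UNIV u1" by (rule primitive_continuous[OF p1])
  show p: "primitive u u1" by (rule deriv_primitive[OF _ c1]) (use assms in \<open>simp add: H2_def\<close>)
  show c: "continuous_on UNIV u" by (rule primitive_continuous[OF p])
qed (use assms in \<open>simp_all add: H2_def\<close>)

lemma H2_bounded:
  assumes "H2 u u1 u2"
  obtains K where "\<And>x. norm (u x) \<le> K" "\<And>x. norm (u1 x) \<le> K"
proof -
  note H = H2D[OF assms]
  obtain K where "\<And>x. norm (u x) \<le> K" using primitive_bounded[OF H(1) H(8,9)] by blast
  moreover obtain L where "\<And>x. norm (u1 x) \<le> L" using primitive_bounded[OF H(2) H(9,10)] by blast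
  ultimately show ?thesis using that[of "max K L"] by (meson max.coboundedI1 max.coboundedI2)
qed

lemma square_integrable_diff:
  fixes f g :: "real \<Rightarrow> complex"
  assumes f: "integrable lborel (\<lambda>x. (norm (f x))\<^sup>2)" and g: "integrable lborel (\<lambda>x. (norm (g x))\<^sup>2)"
    and m: "f \<in> borel_measurable borel" "g \<in> borel_measurable borel"
  shows "integrable lborel (\<lambda>x. (norm (f x - g x))\<^sup>2)"
proof (rule Bochner_Integration.integrable_bound)
  show "integrable lborel (\<lambda>x. 2 * (norm (f x))\<^sup>2 + 2 * (norm (g x))\<^sup>2)" using f g by simp
  show "AE x in lborel. norm ((norm (f x - g x))\<^sup>2) \<le> norm (2 * (norm (f x))\<^sup>2 + 2 * (norm (g x))\<^sup>2)"
  proof (intro AE_I2)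
    fix x
    have "(norm (f x - g x))\<^sup>2 \<le> (norm (f x) + norm (g x))\<^sup>2"
      by (intro power_mono norm_triangle_ineq4) simp
    also have "\<dots> \<le> 2 * (norm (f x))\<^sup>2 + 2 * (norm (g x))\<^sup>2"
      using sum_squares_bound[of "norm (f x)" "norm (g x)"] by (simp add: power2_sum)
    finally show "norm ((norm (f x - g x))\<^sup>2) \<le> norm (2 * (norm (f x))\<^sup>2 + 2 * (norm (g x))\<^sup>2)" by simp
  qed
qed (use m in measurable)

lemma H2_diff:
  assumes u: "H2 u u1 u2" and w: "H2 w w1 w2"
  shows "H2 (\<lambda>x. u x - w x) (\<lambda>x. u1 x - w1 x) (\<lambda>x. u2 x - w2 x)"
proof -
  note U = H2D[OF u] and W = H2D[OF w]
  have "primitive (\<lambda>x. u1 x - w1 x) (\<lambda>x. u2 x - w2 x)"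
    using primitive_add[OF U(2) primitive_linear[OF W(2), of uminus]] bounded_linear_minus[OF bounded_linear_ident] by simp
  moreover have "((\<lambda>x. u x - w x) has_vector_derivative u1 x - w1 x) (at x)" for x
    using u w by (auto simp: H2_def intro!: derivative_intros)
  ultimately show ?thesis
    using square_integrable_diff[OF U(8) W(8) U(5) W(5)] square_integrable_diff[OF U(9) W(9) U(6) W(6)]
      square_integrable_diff[OF U(10) W(10) U(7) W(7)] U W
    unfolding H2_def primitive_def by (auto intro: borel_measurable_diff)
qed

text \<open>The set where a continuous function is nonzero is open, and a nonempty open set is not a
  null set. This turns vanishing in L2 into vanishing at every point, as the pointwise definition of
  wave functions requires.\<close>

lemma continuous_zero_of_integral:
  fixes f :: "real \<Rightarrow> complex"
  assumes c: "continuous_on UNIV f" and i: "integrable lborel (\<lambda>x. (norm (f x))\<^sup>2)"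
    and z: "(LINT x|lborel. (norm (f x))\<^sup>2) = 0"
  shows "f x = 0"
proof (rule ccontr)
  assume "f x \<noteq> 0"
  have "AE x in lborel. (norm (f x))\<^sup>2 = 0"
    using integral_nonneg_eq_0_iff_AE[OF i] z by simp
  then have ae: "AE x in lborel. x \<notin> {x. f x \<noteq> 0}" by eventually_elim simp
  have o: "open {x. f x \<noteq> 0}"
    by (rule open_Collect_neq[OF c continuous_on_const])
  then have "{x. f x \<noteq> 0} \<in> null_sets lborel"
    using ae by (subst AE_iff_null_sets) auto
  moreover have "{x. f x \<noteq> 0} \<notin> null_sets lborel"
    using o \<open>f x \<noteq> 0\<close> open_not_negligible[of "{x. f x \<noteq> 0}"] null_sets_completionI negligible_iff_null_sets by blast
  ultimately show False by simp
qed

section \<open>Integrability of the form and uniqueness for the weak resolvent equation\<close>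

context potentials
begin

lemma v_mult_integrable:
  assumes "v = v0 \<or> v = v1"
    and f: "f \<in> borel_measurable borel" "\<And>x. norm (f x) \<le> K" and g: "g \<in> borel_measurable borel" "\<And>x. norm (g x) \<le> L"
  shows "integrable lborel (\<lambda>x. complex_of_real (v x) * f x * cnj (g x))"
proof -
  have "integrable lborel (\<lambda>x. complex_of_real (v x))" using assms(1) v_int by auto
  then have "integrable lborel (\<lambda>x. complex_of_real (v x) * f x)" by (rule integrable_mult_bounded[OF _ f])
  then show ?thesis
    by (rule integrable_mult_bounded) (use g in simp_all)
qed

lemma hform_integrable:
  assumes u: "H2 u u1 u2" and w: "H2 w w1 w2"
  shows "integrable lborel (\<lambda>x. u2 x * cnj (w2 x))"
    "integrable lborel (\<lambda>x. complex_of_real (v1 x) * u1 x * cnj (w1 x))"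
    "integrable lborel (\<lambda>x. complex_of_real (v0 x) * u x * cnj (w x))"
    "integrable lborel (\<lambda>x. u x * cnj (w x))"
proof -
  note U = H2D[OF u] and W = H2D[OF w]
  obtain K where K: "\<And>x. norm (u x) \<le> K" "\<And>x. norm (u1 x) \<le> K" using H2_bounded[OF u] by blast
  obtain L where L: "\<And>x. norm (w x) \<le> L" "\<And>x. norm (w1 x) \<le> L" using H2_bounded[OF w] by blast
  show "integrable lborel (\<lambda>x. u2 x * cnj (w2 x))" by (rule integrable_square_mult[OF U(10) W(10) U(7) W(7)])
  show "integrable lborel (\<lambda>x. u x * cnj (w x))" by (rule integrable_square_mult[OF U(8) W(8) U(5) W(5)])
  show "integrable lborel (\<lambda>x. complex_of_real (v1 x) * u1 x * cnj (w1 x))"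
    by (rule v_mult_integrable[OF _ U(6) K(2) W(6) L(2)]) simp
  show "integrable lborel (\<lambda>x. complex_of_real (v0 x) * u x * cnj (w x))"
    by (rule v_mult_integrable[OF _ U(5) K(1) W(5) L(1)]) simp
qed

text \<open>The difference \<open>d\<close> of two solutions is tested against itself. Real
  potentials make the form real on the diagonal, so the imaginary part leaves \<open>Im z\<close>
  times the square norm of \<open>d\<close>. This also makes the description operator in
  \<open>RV\<close> meaningful as soon as one solution is exhibited.\<close>

lemma resolvent_V_sol_unique:
  assumes z: "Im z \<noteq> 0" and u: "resolvent_V_sol v0 v1 z p q u" and w: "resolvent_V_sol v0 v1 z p q w"
  shows "u = w"
proof
  fix x
  obtain u1 u2 where U: "H2 u u1 u2" and hu: "\<And>g g1 g2. H2 g g1 g2 \<Longrightarrow>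
      hform v0 v1 u u1 u2 g g1 g2 - z * l2_inner u g =
           (LINT x|lborel. complex_of_real (v1 x) * q x * cnj (g1 x) + complex_of_real (v0 x) * p x * cnj (g x))"
    using u unfolding resolvent_V_sol_def by blast
  obtain w1 w2 where W: "H2 w w1 w2" and hw: "\<And>g g1 g2. H2 g g1 g2 \<Longrightarrow>
      hform v0 v1 w w1 w2 g g1 g2 - z * l2_inner w g =
           (LINT x|lborel. complex_of_real (v1 x) * q x * cnj (g1 x) + complex_of_real (v0 x) * p x * cnj (g x))"
    using w unfolding resolvent_V_sol_def by blast
  define d d1 d2 where "d = (\<lambda>x. u x - w x)" and "d1 = (\<lambda>x. u1 x - w1 x)" and "d2 = (\<lambda>x. u2 x - w2 x)"
  have D: "H2 d d1 d2" unfolding d_def d1_def d2_def by (rule H2_diff[OF U W])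
  note iu = hform_integrable[OF U D] and iw = hform_integrable[OF W D] and id = hform_integrable[OF D D]
  have "hform v0 v1 u u1 u2 d d1 d2 - hform v0 v1 w w1 w2 d d1 d2 = (LINT x|lborel.
      (u2 x * cnj (d2 x) + complex_of_real (v1 x) * u1 x * cnj (d1 x) + complex_of_real (v0 x) * u x * cnj (d x))
    - (w2 x * cnj (d2 x) + complex_of_real (v1 x) * w1 x * cnj (d1 x) + complex_of_real (v0 x) * w x * cnj (d x)))"
    unfolding hform_def
    by (intro Bochner_Integration.integral_diff[symmetric] Bochner_Integration.integrable_add iu iw)
  also have "\<dots> = hform v0 v1 d d1 d2 d d1 d2"
    unfolding hform_def by (intro Bochner_Integration.integral_cong refl) (simp add: d_def d1_def d2_def algebra_simps)
  finally have "hform v0 v1 d d1 d2 d d1 d2 = hform v0 v1 u u1 u2 d d1 d2 - hform v0 v1 w w1 w2 d d1 d2" ..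
  moreover have "l2_inner d d = l2_inner u d - l2_inner w d"
  proof -
    have "l2_inner u d - l2_inner w d = (LINT x|lborel. u x * cnj (d x) - w x * cnj (d x))"
      unfolding l2_inner_def by (intro Bochner_Integration.integral_diff[symmetric] iu iw)
    also have "\<dots> = l2_inner d d"
      unfolding l2_inner_def by (intro Bochner_Integration.integral_cong refl) (simp add: d_def algebra_simps)
    finally show ?thesis ..
  qed
  ultimately have eq: "hform v0 v1 d d1 d2 d d1 d2 = z * l2_inner d d"
  proof -
    have *: "h = z * l" if "h = a - b" "l = l' - l''" "a - z * l' = I" "b - z * l'' = I"
      for h a b l l' l'' I :: complex
      using that by algebra
    show ?thesis if "hform v0 v1 d d1 d2 d d1 d2 = hform v0 v1 u u1 u2 d d1 d2 - hform v0 v1 w w1 w2 d d1 d2"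
      "l2_inner d d = l2_inner u d - l2_inner w d"
      by (rule *[OF that hu[OF D] hw[OF D]])
  qed
  have "hform v0 v1 d d1 d2 d d1 d2 = (LINT x|lborel. complex_of_real ((norm (d2 x))\<^sup>2 + v1 x * (norm (d1 x))\<^sup>2 + v0 x * (norm (d x))\<^sup>2))"
    unfolding hform_def by (intro Bochner_Integration.integral_cong refl) (simp add: complex_norm_square[symmetric] mult.assoc del: of_real_power)
  then have "Im (hform v0 v1 d d1 d2 d d1 d2) = 0"
    by (simp only: integral_complex_of_real complex.sel Im_complex_of_real)
  moreover have l: "l2_inner d d = complex_of_real (LINT x|lborel. (norm (d x))\<^sup>2)"
    unfolding l2_inner_def integral_complex_of_real[symmetric]
    by (intro Bochner_Integration.integral_cong refl) (simp add: complex_norm_square[symmetric] del: of_real_power)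
  ultimately have "(LINT x|lborel. (norm (d x))\<^sup>2) = 0" using z unfolding eq by simp
  then have "d x = 0" by (rule continuous_zero_of_integral[OF H2D(3,8)[OF D]])
  then show "u x = w x" by (simp add: d_def)
qed

end

section \<open>Decaying solutions\<close>

lemma qderiv_4: "qderiv \<kappa> 4 t c = \<kappa> ^ 4 * qderiv \<kappa> 0 t c"
  unfolding qderiv_def rt_pow4 by (simp add: sum_distrib_left mult.assoc)

lemma component_primitive:
  assumes "global_solution \<Phi> c (C :: real \<Rightarrow> complex^4)"
  shows "primitive (\<lambda>x. C x $ j) (\<lambda>t. \<Phi> t (C t) $ j)"
  by (rule primitive_linear[OF global_solution_primitive[OF assms]]) (rule bounded_linear_vec_nth)

lemma primitive_zero_imp:
  assumes p: "primitive (\<lambda>x. 0) (g :: real \<Rightarrow> complex)" and c: "continuous_on UNIV g"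
  shows "g x = 0"
  using primitive_deriv[OF p c, of x] vector_derivative_unique_at has_vector_derivative_const by metis

lemma end_value_linear:
  fixes L :: "'a::euclidean_space \<Rightarrow> 'b::euclidean_space"
  assumes C: "global_solution \<Phi> c C" and L: "bounded_linear L"
    and eq: "\<And>t v. \<Psi> t (L v) = L (\<Phi> t v)"
  shows "end_value \<Psi> (L c) (\<lambda>x. L (C x)) = L (end_value \<Phi> c C)"
  unfolding end_value_def eq integral_bounded_linear[OF L global_solutionD(3)[OF C]]
  by (simp add: bounded_linear.linear[OF L] linear_add)

lemma end_value_add:
  assumes C: "global_solution \<Phi> c C" and E: "global_solution \<Psi> e E"
    and eq: "\<And>t v w. \<Theta> t (v + w) = \<Phi> t v + \<Psi> t w"
  shows "end_value \<Theta> (c + e) (\<lambda>x. C x + E x) = end_value \<Phi> c C + end_value \<Psi> e E"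
  unfolding end_value_def eq
    Bochner_Integration.integral_add[OF global_solutionD(3)[OF C] global_solutionD(3)[OF E]]
  by (simp add: add_ac)

lemma bounded_linear_scale: "bounded_linear (\<lambda>v :: complex^'n. a *s v)"
  by (rule linear_conv_bounded_linear[THEN iffD1])
     (auto intro!: linearI simp: vec_eq_iff algebra_simps scaleR_conv_of_real)

context potentials
begin

text \<open>The weights \<open>1 / (4 * rt \<kappa> j ^ 3)\<close> are the reciprocals of the
  derivative of the characteristic polynomial at its roots. Hence the sums of
  \<open>rt \<kappa> j ^ m / (4 * rt \<kappa> j ^ 3)\<close> are 0 for m = 0, 1, 2, 4 and 1 for m =
  3. The \<open>v0\<close> term therefore shows up at level 3, and the \<open>v1\<close> term, which
  carries one more power of the root, at level 2.\<close>

lemma qderiv_ampl_ode: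
  assumes "\<kappa> \<noteq> 0"
  shows "qderiv \<kappa> 0 t (ampl_ode \<kappa> p q t c) = 0" "qderiv \<kappa> 1 t (ampl_ode \<kappa> p q t c) = 0"
    "qderiv \<kappa> 2 t (ampl_ode \<kappa> p q t c) = of_real (v1 t) * (qderiv \<kappa> 1 t c - q t)"
    "qderiv \<kappa> 3 t (ampl_ode \<kappa> p q t c) = - of_real (v0 t) * (qderiv \<kappa> 0 t c - p t)"
proof -
  define A B where "A = - of_real (v0 t) * (qderiv \<kappa> 0 t c - p t)" and "B = of_real (v1 t) * (qderiv \<kappa> 1 t c - q t)"
  have *: "qderiv \<kappa> m t (ampl_ode \<kappa> p q t c) = (\<Sum>j\<in>UNIV. rt \<kappa> j ^ m / (4 * rt \<kappa> j ^ 3) * (A + rt \<kappa> j * B))" for m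
    unfolding qderiv_def[of \<kappa> m t "ampl_ode \<kappa> p q t c"] unfolding ampl_ode_def
  proof (intro sum.cong refl)
    fix j :: 4
    have "exp (rt \<kappa> j * of_real t) * exp (- rt \<kappa> j * of_real t) = 1"
      by (simp add: exp_add[symmetric])
    then show "rt \<kappa> j ^ m * exp (rt \<kappa> j * of_real t) * (\<chi> j. exp (- rt \<kappa> j * of_real t) / (4 * rt \<kappa> j ^ 3) *
       (- of_real (v0 t) * (qderiv \<kappa> 0 t c - p t) + rt \<kappa> j * of_real (v1 t) * (qderiv \<kappa> 1 t c - q t))) $ j
       = rt \<kappa> j ^ m / (4 * rt \<kappa> j ^ 3) * (A + rt \<kappa> j * B)"
      unfolding vec_lambda_beta A_def B_def by (simp add: mult.assoc)
  qed
  have "qderiv \<kappa> 0 t (ampl_ode \<kappa> p q t c) = 0" "qderiv \<kappa> 1 t (ampl_ode \<kappa> p q t c) = 0"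
    "qderiv \<kappa> 2 t (ampl_ode \<kappa> p q t c) = B" "qderiv \<kappa> 3 t (ampl_ode \<kappa> p q t c) = A"
    using assms unfolding * sum_4 rt_simps power_mult_distrib power_minus_odd[of 3, simplified]
    by (simp_all add: field_simps power2_eq_square power3_eq_cube)
  then show "qderiv \<kappa> 0 t (ampl_ode \<kappa> p q t c) = 0" "qderiv \<kappa> 1 t (ampl_ode \<kappa> p q t c) = 0"
    "qderiv \<kappa> 2 t (ampl_ode \<kappa> p q t c) = of_real (v1 t) * (qderiv \<kappa> 1 t c - q t)"
    "qderiv \<kappa> 3 t (ampl_ode \<kappa> p q t c) = - of_real (v0 t) * (qderiv \<kappa> 0 t c - p t)"
    by (simp_all add: A_def B_def)
qed

lemma qderiv_primitive:
  assumes C: "global_solution (ampl_ode \<kappa> p q) c C"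
  shows "primitive (\<lambda>x. qderiv \<kappa> m x (C x)) (\<lambda>x. qderiv \<kappa> (Suc m) x (C x) + qderiv \<kappa> m x (ampl_ode \<kappa> p q x (C x)))"
proof -
  have e: "primitive (\<lambda>x. rt \<kappa> j ^ m * exp (rt \<kappa> j * of_real x)) (\<lambda>x. rt \<kappa> j ^ Suc m * exp (rt \<kappa> j * of_real x))" for j
  proof (rule deriv_primitive)
    fix x
    have "((\<lambda>z. rt \<kappa> j ^ m * exp (rt \<kappa> j * z)) has_field_derivative rt \<kappa> j ^ Suc m * exp (rt \<kappa> j * of_real x)) (at (of_real x))"
      by (auto intro!: derivative_eq_intros)
    from has_vector_derivative_real_field[OF this]
    show "((\<lambda>x. rt \<kappa> j ^ m * exp (rt \<kappa> j * of_real x)) has_vector_derivative rt \<kappa> j ^ Suc m * exp (rt \<kappa> j * of_real x)) (at x)" .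
  qed (intro continuous_intros)
  have "primitive (\<lambda>x. \<Sum>j\<in>UNIV. rt \<kappa> j ^ m * exp (rt \<kappa> j * of_real x) * C x $ j)
    (\<lambda>x. \<Sum>j\<in>UNIV. rt \<kappa> j ^ Suc m * exp (rt \<kappa> j * of_real x) * C x $ j
        + rt \<kappa> j ^ m * exp (rt \<kappa> j * of_real x) * ampl_ode \<kappa> p q x (C x) $ j)"
    by (intro primitive_sum primitive_mult e component_primitive[OF C]) simp
  then show ?thesis unfolding qderiv_def sum.distrib .
qed

text \<open>The fourth order equation as a chain of first order ones. The term with
  \<open>v1\<close> enters undifferentiated between levels 2 and 3, and the chain closes because all
  roots have the same fourth power.\<close>

lemma qderiv_primitives:
  assumes C: "global_solution (ampl_ode \<kappa> p q) c C" and \<kappa>: "\<kappa> \<noteq> 0"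
  shows "primitive (\<lambda>x. qderiv \<kappa> 0 x (C x)) (\<lambda>x. qderiv \<kappa> 1 x (C x))"
    "primitive (\<lambda>x. qderiv \<kappa> 1 x (C x)) (\<lambda>x. qderiv \<kappa> 2 x (C x))"
    "primitive (\<lambda>x. qderiv \<kappa> 2 x (C x)) (\<lambda>x. qderiv \<kappa> 3 x (C x) + of_real (v1 x) * (qderiv \<kappa> 1 x (C x) - q x))"
    "primitive (\<lambda>x. qderiv \<kappa> 3 x (C x)) (\<lambda>x. \<kappa> ^ 4 * qderiv \<kappa> 0 x (C x) - of_real (v0 x) * (qderiv \<kappa> 0 x (C x) - p x))"
  using qderiv_primitive[OF C, of 0] qderiv_primitive[OF C, of 1] qderiv_primitive[OF C, of 2] qderiv_primitive[OF C, of 3]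
  by (simp_all add: qderiv_ampl_ode[OF \<kappa>, simplified] qderiv_4 numeral_2_eq_2[symmetric] numeral_3_eq_3[symmetric]
      eval_nat_numeral(2)[of num.One, symmetric] Suc_numeral)

lemma qderiv_continuous:
  assumes "global_solution (ampl_ode \<kappa> p q) c C"
  shows "continuous_on UNIV (\<lambda>x. qderiv \<kappa> m x (C x))"
  by (intro continuous_intros global_solutionD(1)[OF assms])

text \<open>On each half line there are two cases. If the limit amplitude vanishes, the amplitude
  decays faster than its exponential can grow; if not, the sign condition makes the exponential
  itself decay and boundedness of the amplitude is enough.\<close>

lemma amplitude_exp_decay:
  assumes \<kappa>: "\<kappa> \<noteq> 0" and pq: "admissible p q" and C: "global_solution (ampl_ode \<kappa> p q) c C"
    and c: "c $ j \<noteq> 0 \<Longrightarrow> 0 < Re (rt \<kappa> j)"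
    and d: "end_value (ampl_ode \<kappa> p q) c C $ j \<noteq> 0 \<Longrightarrow> Re (rt \<kappa> j) < 0"
  shows "\<exists>\<delta> K. 0 < \<delta> \<and> 0 \<le> K \<and> (\<forall>x. norm (exp (rt \<kappa> j * of_real x) * C x $ j) \<le> K * exp (- \<delta> * \<bar>x\<bar>))"
proof -
  let ?d = "end_value (ampl_ode \<kappa> p q) c C"
  let ?\<rho> = "Re (rt \<kappa> j)"
  \<comment> \<open>If both limit amplitudes vanish, the sign of the real part is unknown and
    possibly zero, and the rate 1 comes from the amplitude alone.\<close>
  define \<delta> where "\<delta> = (if c $ j = 0 \<and> ?d $ j = 0 then 1 else min 1 \<bar>?\<rho>\<bar>)"
  have \<delta>: "0 < \<delta>" "\<delta> \<le> 1" using c d by (auto simp: \<delta>_def)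
  \<comment> \<open>One more than the growth rate of the exponential, so that a factor
    \<open>exp (- \<bar>x\<bar>)\<close> is left over.\<close>
  define a where "a = norm \<kappa> + 1"
  have \<rho>: "\<bar>?\<rho>\<bar> \<le> norm \<kappa>" using abs_Re_le_cmod[of "rt \<kappa> j"] by simp
  obtain L where L: "0 \<le> L" "\<And>x. norm (C x) \<le> L" using global_solution_bounded[OF C] by metis
  have "0 \<le> a" by (simp add: a_def)
  from solution_rate[OF \<kappa> pq C this] obtain K where K: "0 \<le> K" "\<And>x. norm (C x - c) \<le> K * exp (a * x)"
    "\<And>x. norm (C x - ?d) \<le> K * exp (- a * x)" by blast
  have comp: "norm (v $ j) \<le> norm v" for v :: "complex^4" by (rule Finite_Cartesian_Product.norm_nth_le)
  have "norm (exp (rt \<kappa> j * of_real x) * C x $ j) \<le> (K + L) * exp (- \<delta> * \<bar>x\<bar>)" for x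
  proof -
    have e: "norm (exp (rt \<kappa> j * of_real x)) = exp (?\<rho> * x)" by (simp add: norm_exp_eq_Re)
    have \<rho>x: "?\<rho> * x \<le> norm \<kappa> * \<bar>x\<bar>"
      using mult_right_mono[OF \<rho>, of "\<bar>x\<bar>"] abs_ge_self[of "?\<rho> * x"] by (simp add: abs_mult)
    have small: "exp (?\<rho> * x) * norm (C x $ j) \<le> K * exp (- \<delta> * \<bar>x\<bar>)" if "norm (C x $ j) \<le> K * exp (- a * \<bar>x\<bar>)"
    proof -
      have "exp (?\<rho> * x) * norm (C x $ j) \<le> exp (norm \<kappa> * \<bar>x\<bar>) * (K * exp (- a * \<bar>x\<bar>))"
        using that \<rho>x by (intro mult_mono) auto
      also have "\<dots> = K * exp (- \<bar>x\<bar>)" by (simp add: a_def algebra_simps flip: exp_add)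
      also have "\<dots> \<le> K * exp (- \<delta> * \<bar>x\<bar>)"
        using \<delta> K(1) by (intro mult_left_mono) (auto simp: mult_left_le_one_le)
      finally show ?thesis .
    qed
    have large: "exp (?\<rho> * x) * norm (C x $ j) \<le> L * exp (- \<delta> * \<bar>x\<bar>)" if "?\<rho> * x \<le> - \<delta> * \<bar>x\<bar>"
      using mult_mono[of "exp (?\<rho> * x)" "exp (- \<delta> * \<bar>x\<bar>)" "norm (C x $ j)" L] that L(2)[of x] comp[of "C x"]
      by (simp add: mult.commute)
    have "exp (?\<rho> * x) * norm (C x $ j) \<le> K * exp (- \<delta> * \<bar>x\<bar>) \<or> exp (?\<rho> * x) * norm (C x $ j) \<le> L * exp (- \<delta> * \<bar>x\<bar>)"
    proof (cases "x \<le> 0")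
      case True
      show ?thesis
      proof (cases "c $ j = 0")
        case c0: True
        have "norm (C x $ j) \<le> K * exp (a * x)" using order_trans[OF comp K(2)[of x]] c0 by simp
        then show ?thesis using True small by simp
      next
        case False
        then have "\<delta> \<le> ?\<rho>" using c by (simp add: \<delta>_def)
        then have "?\<rho> * x \<le> \<delta> * x" using True by (intro mult_right_mono_neg)
        then show ?thesis using True large by simp
      qed
    next
      case x: False
      show ?thesis
      proof (cases "?d $ j = 0")
        case d0: True
        have "norm (C x $ j) \<le> K * exp (- a * x)" using order_trans[OF comp K(3)[of x]] d0 by simp
        then show ?thesis using x small by simp
      next
        case False
        then have "?\<rho> \<le> - \<delta>" using d by (simp add: \<delta>_def)
        then have "?\<rho> * x \<le> - \<delta> * x" using x by (intro mult_right_mono) auto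
        then show ?thesis using x large by simp
      qed
    qed
    then show ?thesis unfolding norm_mult e using K(1) L(1) by (auto simp: distrib_right intro: add_increasing add_increasing2)
  qed
  then show ?thesis using \<delta>(1) K(1) L(1) by (metis add_nonneg_nonneg)
qed

lemma qderiv_exp_decay:
  assumes \<kappa>: "\<kappa> \<noteq> 0" and pq: "admissible p q" and C: "global_solution (ampl_ode \<kappa> p q) c C"
    and c: "\<And>j. c $ j \<noteq> 0 \<Longrightarrow> 0 < Re (rt \<kappa> j)"
    and d: "\<And>j. end_value (ampl_ode \<kappa> p q) c C $ j \<noteq> 0 \<Longrightarrow> Re (rt \<kappa> j) < 0"
  obtains \<delta> K where "0 < \<delta>" "\<And>m x. norm (qderiv \<kappa> m x (C x)) \<le> K * norm \<kappa> ^ m * exp (- \<delta> * \<bar>x\<bar>)"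
proof -
  have "\<exists>\<delta> K. 0 < \<delta> \<and> 0 \<le> K \<and> (\<forall>x. norm (exp (rt \<kappa> j * of_real x) * C x $ j) \<le> K * exp (- \<delta> * \<bar>x\<bar>))" for j
    by (rule amplitude_exp_decay[OF \<kappa> pq C c d])
  then obtain \<delta> K where \<delta>: "\<And>j::4. 0 < \<delta> j" and K: "\<And>j. 0 \<le> K j"
    and le: "\<And>j x. norm (exp (rt \<kappa> j * of_real x) * C x $ j) \<le> K j * exp (- \<delta> j * \<bar>x\<bar>)"
    by metis
  define \<delta>0 where "\<delta>0 = Min (range \<delta>)"
  have \<delta>0: "0 < \<delta>0" "\<And>j. \<delta>0 \<le> \<delta> j" using \<delta> by (auto simp: \<delta>0_def)
  have "norm (qderiv \<kappa> m x (C x)) \<le> (\<Sum>j\<in>UNIV. K j) * norm \<kappa> ^ m * exp (- \<delta>0 * \<bar>x\<bar>)" for m x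
  proof -
    have "norm (qderiv \<kappa> m x (C x)) \<le> (\<Sum>j\<in>UNIV. norm \<kappa> ^ m * (K j * exp (- \<delta>0 * \<bar>x\<bar>)))"
      unfolding qderiv_def
    proof (rule sum_norm_le)
      fix j :: 4
      have "norm (exp (rt \<kappa> j * of_real x) * C x $ j) \<le> K j * exp (- \<delta>0 * \<bar>x\<bar>)"
        using le[of j x] by (rule order_trans) (use K \<delta>0(2)[of j] in \<open>auto intro!: mult_left_mono mult_right_mono\<close>)
      then have "norm \<kappa> ^ m * norm (exp (rt \<kappa> j * of_real x) * C x $ j) \<le> norm \<kappa> ^ m * (K j * exp (- \<delta>0 * \<bar>x\<bar>))"
        by (rule mult_left_mono) simp
      then show "norm (rt \<kappa> j ^ m * exp (rt \<kappa> j * of_real x) * C x $ j) \<le> norm \<kappa> ^ m * (K j * exp (- \<delta>0 * \<bar>x\<bar>))"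
        by (simp add: norm_mult norm_power mult.assoc)
    qed
    then show ?thesis by (simp add: sum_distrib_left sum_distrib_right mult_ac)
  qed
  then show ?thesis using that \<delta>0(1) by blast
qed

text \<open>The solution and its quasi-derivatives decay exponentially while test functions in H2
  are bounded, so two integrations by parts have no boundary terms. The parameter may be real: with
  \<open>p = q = 0\<close> the conclusion is the eigenvalue equation, with a non-real parameter it
  identifies the resolvent.\<close>

theorem decaying_solution_weak:
  assumes \<kappa>: "\<kappa> \<noteq> 0" and pq: "admissible p q" and C: "global_solution (ampl_ode \<kappa> p q) c C"
    and c: "\<And>j. c $ j \<noteq> 0 \<Longrightarrow> 0 < Re (rt \<kappa> j)"
    and d: "\<And>j. end_value (ampl_ode \<kappa> p q) c C $ j \<noteq> 0 \<Longrightarrow> Re (rt \<kappa> j) < 0"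
  shows "resolvent_V_sol v0 v1 (\<kappa> ^ 4) p q (\<lambda>x. qderiv \<kappa> 0 x (C x))"
proof -
  define u where "u m x = qderiv \<kappa> m x (C x)" for m x
  obtain \<delta> K where \<delta>: "0 < \<delta>" and K: "\<And>m x. norm (u m x) \<le> (K * norm \<kappa> ^ m) * exp (- \<delta> * \<bar>x\<bar>)"
    unfolding u_def using qderiv_exp_decay[OF assms] by blast
  have cu: "continuous_on UNIV (u m)" for m using qderiv_continuous[OF C, of m] by (simp add: u_def[abs_def])
  have mu [measurable]: "u m \<in> borel_measurable borel" for m by (rule borel_measurable_continuous_onI[OF cu])
  note prim = qderiv_primitives[OF C \<kappa>, folded u_def]
  note int = exp_decay_integrable[OF \<delta> K cu]
  obtain P where P: "\<And>t. norm (p t) \<le> P" "\<And>t. norm (q t) \<le> P"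
    and pqc: "continuous_on UNIV p" "continuous_on UNIV q" using pq by (auto simp: admissible_def)
  have mpq [measurable]: "p \<in> borel_measurable borel" "q \<in> borel_measurable borel"
    using pqc by (auto intro: borel_measurable_continuous_onI)
  have bu: "norm (u m x) \<le> \<bar>K * norm \<kappa> ^ m\<bar>" for m x
  proof -
    have "(K * norm \<kappa> ^ m) * exp (- \<delta> * \<bar>x\<bar>) \<le> \<bar>K * norm \<kappa> ^ m\<bar> * 1"
      using \<delta> by (intro mult_mono) auto
    then show ?thesis using K[of m x] by simp
  qed
  have H: "H2 (u 0) (u 1) (u 2)"
    unfolding H2_def
  proof (intro conjI allI)
    show "(u 0 has_vector_derivative u 1 x) (at x)" for x
      using primitive_deriv[OF prim(1) cu] by (simp add: u_def[abs_def])
    show "a \<le> b \<longrightarrow> set_integrable lborel {a..b} (u 2) \<and> u 1 b - u 1 a = (LINT t:{a..b}|lborel. u 2 t)" for a b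
      using prim(2) unfolding primitive_def by blast
  qed (use int(2) mu in auto)
  have "hform v0 v1 (u 0) (u 1) (u 2) w w1 w2 - \<kappa> ^ 4 * l2_inner (u 0) w =
           (LINT x|lborel. complex_of_real (v1 x) * q x * cnj (w1 x) + complex_of_real (v0 x) * p x * cnj (w x))"
    if W: "H2 w w1 w2" for w w1 w2
  proof -
    note W' = H2D[OF W]
    obtain L where L: "\<And>x. norm (w x) \<le> L" "\<And>x. norm (w1 x) \<le> L" using H2_bounded[OF W] by blast
    have mw [measurable]: "w \<in> borel_measurable borel" "w1 \<in> borel_measurable borel" by (rule W')+
    have pw: "primitive (\<lambda>x. cnj (w x)) (\<lambda>x. cnj (w1 x))" and pw1: "primitive (\<lambda>x. cnj (w1 x)) (\<lambda>x. cnj (w2 x))"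
      using W'(1,2) by (auto intro: primitive_linear bounded_linear_cnj)
    have decay: "norm (u m x * cnj (g x)) \<le> (K * norm \<kappa> ^ m * L) * exp (- \<delta> * \<bar>x\<bar>)" if "\<And>x. norm (g x) \<le> L" for g m x
    proof -
      have "norm (u m x) * norm (g x) \<le> (K * norm \<kappa> ^ m) * exp (- \<delta> * \<bar>x\<bar>) * L"
        using K[of m x] that[of x] order_trans[OF norm_ge_zero K[of m x]] by (intro mult_mono) auto
      then show ?thesis by (simp add: norm_mult mult_ac)
    qed
    note lim = exp_decay_tendsto[OF \<delta> decay]
    note hi = hform_integrable[OF H W]
    have ui: "integrable lborel (\<lambda>x. u m x * cnj (g x))" if "\<And>x. norm (g x) \<le> L" "g \<in> borel_measurable borel" for g m
      by (rule integrable_mult_bounded[OF int(1)]) (use that in auto)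
    have vu1: "integrable lborel (\<lambda>x. complex_of_real (v1 x) * (u 1 x - q x) * cnj (w1 x))"
    proof (rule v_mult_integrable[OF _ _ _ _ L(2)])
      show "norm (u 1 x - q x) \<le> \<bar>K * norm \<kappa> ^ 1\<bar> + P" for x
        by (rule order_trans[OF norm_triangle_ineq4]) (intro add_mono bu P)
    qed auto
    have vu0: "integrable lborel (\<lambda>x. complex_of_real (v0 x) * (u 0 x - p x) * cnj (w x))"
    proof (rule v_mult_integrable[OF _ _ _ _ L(1)])
      show "norm (u 0 x - p x) \<le> \<bar>K * norm \<kappa> ^ 0\<bar> + P" for x
        by (rule order_trans[OF norm_triangle_ineq4]) (intro add_mono bu P)
    qed auto
    have vq: "integrable lborel (\<lambda>x. complex_of_real (v1 x) * q x * cnj (w1 x))"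
      by (rule v_mult_integrable[OF _ _ _ _ L(2)]) (use P in auto)
    have vp: "integrable lborel (\<lambda>x. complex_of_real (v0 x) * p x * cnj (w x))"
      by (rule v_mult_integrable[OF _ _ _ _ L(1)]) (use P in auto)
    let ?I = "\<lambda>f. LINT x|lborel. f x"
    \<comment> \<open>The equation for level 2 is tested against \<open>w1\<close> and the one for
      level 3 against \<open>w\<close>. The integral of \<open>u 3\<close> times the conjugate of
      \<open>w1\<close> occurs in both and is eliminated at the end.\<close>
    have 1: "?I (\<lambda>x. (u 3 x + complex_of_real (v1 x) * (u 1 x - q x)) * cnj (w1 x)) = - ?I (\<lambda>x. u 2 x * cnj (w2 x))"
      by (rule integration_by_parts_real_line[OF prim(3) pw1])
         (use ui[OF L(2) mw(2), of 3] vu1 hi(1) lim[OF L(2)] in \<open>simp_all add: distrib_right\<close>)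
    have 2: "?I (\<lambda>x. (\<kappa> ^ 4 * u 0 x - complex_of_real (v0 x) * (u 0 x - p x)) * cnj (w x)) = - ?I (\<lambda>x. u 3 x * cnj (w1 x))"
      by (rule integration_by_parts_real_line[OF prim(4) pw])
         (use ui[OF L(1) mw(1), of 0] ui[OF L(2) mw(2), of 3] vu0 lim[OF L(1)] in
           \<open>simp_all add: left_diff_distrib mult.assoc\<close>)
    have 3: "?I (\<lambda>x. (u 3 x + complex_of_real (v1 x) * (u 1 x - q x)) * cnj (w1 x))
        = ?I (\<lambda>x. u 3 x * cnj (w1 x)) + (?I (\<lambda>x. complex_of_real (v1 x) * u 1 x * cnj (w1 x)) - ?I (\<lambda>x. complex_of_real (v1 x) * q x * cnj (w1 x)))"
    proof -
      have "?I (\<lambda>x. u 3 x * cnj (w1 x)) + (?I (\<lambda>x. complex_of_real (v1 x) * u 1 x * cnj (w1 x)) - ?I (\<lambda>x. complex_of_real (v1 x) * q x * cnj (w1 x)))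
        = ?I (\<lambda>x. u 3 x * cnj (w1 x) + (complex_of_real (v1 x) * u 1 x * cnj (w1 x) - complex_of_real (v1 x) * q x * cnj (w1 x)))"
        using ui[OF L(2) mw(2), of 3] hi(2) vq by simp
      also have "\<dots> = ?I (\<lambda>x. (u 3 x + complex_of_real (v1 x) * (u 1 x - q x)) * cnj (w1 x))"
        by (intro Bochner_Integration.integral_cong refl) (simp add: algebra_simps)
      finally show ?thesis ..
    qed
    have 4: "?I (\<lambda>x. (\<kappa> ^ 4 * u 0 x - complex_of_real (v0 x) * (u 0 x - p x)) * cnj (w x))
        = \<kappa> ^ 4 * ?I (\<lambda>x. u 0 x * cnj (w x)) - (?I (\<lambda>x. complex_of_real (v0 x) * u 0 x * cnj (w x)) - ?I (\<lambda>x. complex_of_real (v0 x) * p x * cnj (w x)))"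
    proof -
      have "\<kappa> ^ 4 * ?I (\<lambda>x. u 0 x * cnj (w x)) - (?I (\<lambda>x. complex_of_real (v0 x) * u 0 x * cnj (w x)) - ?I (\<lambda>x. complex_of_real (v0 x) * p x * cnj (w x)))
        = ?I (\<lambda>x. \<kappa> ^ 4 * (u 0 x * cnj (w x)) - (complex_of_real (v0 x) * u 0 x * cnj (w x) - complex_of_real (v0 x) * p x * cnj (w x)))"
        using hi(3,4) vp by simp
      also have "\<dots> = ?I (\<lambda>x. (\<kappa> ^ 4 * u 0 x - complex_of_real (v0 x) * (u 0 x - p x)) * cnj (w x))"
        by (intro Bochner_Integration.integral_cong refl) (simp add: algebra_simps)
      finally show ?thesis ..
    qed
    have 5: "hform v0 v1 (u 0) (u 1) (u 2) w w1 w2 = ?I (\<lambda>x. u 2 x * cnj (w2 x))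
        + ?I (\<lambda>x. complex_of_real (v1 x) * u 1 x * cnj (w1 x)) + ?I (\<lambda>x. complex_of_real (v0 x) * u 0 x * cnj (w x))"
      unfolding hform_def using hi by simp
    have 6: "?I (\<lambda>x. complex_of_real (v1 x) * q x * cnj (w1 x) + complex_of_real (v0 x) * p x * cnj (w x))
        = ?I (\<lambda>x. complex_of_real (v1 x) * q x * cnj (w1 x)) + ?I (\<lambda>x. complex_of_real (v0 x) * p x * cnj (w x))"
      using vp vq by simp
    show ?thesis
      unfolding 5 6 l2_inner_def using 1 2 unfolding 3 4 by algebra
  qed
  then show ?thesis unfolding resolvent_V_sol_def using H by (auto simp: u_def[abs_def])
qed

text \<open>If the function vanishes, so do its quasi-derivatives up to level 3, by uniqueness of
  derivatives of continuous primitives. They determine the four amplitudes, because up to powers of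
  \<open>\<kappa>\<close> the coefficient matrix is the invertible Fourier matrix of order
  four.\<close>

lemma vanishing_solution:
  assumes \<kappa>: "\<kappa> \<noteq> 0" and C: "global_solution (ampl_ode0 \<kappa>) c C" and z: "\<And>x. qderiv \<kappa> 0 x (C x) = 0"
  shows "C = (\<lambda>x. 0)" "c = 0" "end_value (ampl_ode0 \<kappa>) c C = 0"
proof -
  note prim = qderiv_primitives[OF C \<kappa>] and cu = qderiv_continuous[OF C]
  have 1: "qderiv \<kappa> 1 x (C x) = 0" for x
    using primitive_zero_imp[OF _ cu] prim(1) unfolding z by blast
  have 2: "qderiv \<kappa> 2 x (C x) = 0" for x
    using primitive_zero_imp[OF _ cu] prim(2) unfolding 1 by blast
  have "primitive (\<lambda>x. 0) (\<lambda>x. qderiv \<kappa> 3 x (C x))"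
    using prim(3) unfolding 1 2 by simp
  then have 3: "qderiv \<kappa> 3 x (C x) = 0" for x
    by (rule primitive_zero_imp[OF _ cu])
  have "C x $ j = 0" for x j
  proof -
    define e where "e j = exp (rt \<kappa> j * of_real x) * C x $ j" for j
    have "e 1 + e 2 + e 3 + e 4 = 0" using z[of x] by (simp add: qderiv_def e_def sum_4)
    moreover have "\<kappa> * (\<i> * e 1 - \<i> * e 2 + e 3 - e 4) = 0" using 1[of x] by (simp add: qderiv_def e_def sum_4 algebra_simps)
    moreover have "\<kappa>\<^sup>2 * (- e 1 - e 2 + e 3 + e 4) = 0" using 2[of x] by (simp add: qderiv_def e_def sum_4 power_mult_distrib algebra_simps)
    moreover have "\<kappa> ^ 3 * (- \<i> * e 1 + \<i> * e 2 + e 3 - e 4) = 0"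
      using 3[of x] by (simp add: qderiv_def e_def sum_4 power_mult_distrib power3_eq_cube algebra_simps)
    ultimately have E: "e 1 + e 2 + e 3 + e 4 = 0" "\<i> * e 1 - \<i> * e 2 + e 3 - e 4 = 0"
      "- e 1 - e 2 + e 3 + e 4 = 0" "- \<i> * e 1 + \<i> * e 2 + e 3 - e 4 = 0" using \<kappa> by simp_all
    have "e 3 = 0" "e 4 = 0" "e 1 + e 2 = 0" "\<i> * (e 1 - e 2) = 0"
      using E by algebra+
    then have "e 1 = 0" "e 2 = 0" "e 3 = 0" "e 4 = 0" by (auto simp: algebra_simps)
    then have "e j = 0" using exhaust_4[of j] by auto
    then show ?thesis by (simp add: e_def)
  qed
  then show C0: "C = (\<lambda>x. 0)" by (simp add: fun_eq_iff vec_eq_iff)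
  have v0: "ampl_ode0 \<kappa> t 0 = 0" for t by (simp add: ampl_ode_def vec_eq_iff)
  have "(0 :: complex^4) = c + (LINT t:{..0::real}|lborel. ampl_ode0 \<kappa> t 0)"
    using global_solutionD(4)[OF C, of 0] unfolding C0 .
  then show "c = 0" by (simp add: v0 set_lebesgue_integral_def)
  then show "end_value (ampl_ode0 \<kappa>) c C = 0" by (simp add: end_value_def C0 v0)
qed

lemma solution_scale:
  assumes C: "global_solution (ampl_ode0 \<kappa>) c C"
  shows "global_solution (ampl_ode0 \<kappa>) (a *s c) (\<lambda>x. a *s C x)"
    "end_value (ampl_ode0 \<kappa>) (a *s c) (\<lambda>x. a *s C x) = a *s end_value (ampl_ode0 \<kappa>) c C"
proof -
  have "ampl_ode0 \<kappa> t (a *s v) = a *s ampl_ode0 \<kappa> t v" for t v using ampl_ode_scale[of \<kappa> a "\<lambda>_. 0" "\<lambda>_. 0"] by simp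
  then show "global_solution (ampl_ode0 \<kappa>) (a *s c) (\<lambda>x. a *s C x)"
    "end_value (ampl_ode0 \<kappa>) (a *s c) (\<lambda>x. a *s C x) = a *s end_value (ampl_ode0 \<kappa>) c C"
    using global_solution_linear[OF C bounded_linear_scale] end_value_linear[OF C bounded_linear_scale] by auto
qed

lemma solution_add:
  assumes C: "global_solution (ampl_ode0 \<kappa>) c C" and E: "global_solution (ampl_ode \<kappa> p q) e E"
  shows "global_solution (ampl_ode \<kappa> p q) (c + e) (\<lambda>x. C x + E x)"
    "end_value (ampl_ode \<kappa> p q) (c + e) (\<lambda>x. C x + E x) = end_value (ampl_ode0 \<kappa>) c C + end_value (ampl_ode \<kappa> p q) e E"
proof -
  have "ampl_ode \<kappa> p q t (v + w) = ampl_ode0 \<kappa> t v + ampl_ode \<kappa> p q t w" for t v w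
    using ampl_ode_add[of \<kappa> "\<lambda>_. 0" p "\<lambda>_. 0" q] by simp
  then show "global_solution (ampl_ode \<kappa> p q) (c + e) (\<lambda>x. C x + E x)"
    "end_value (ampl_ode \<kappa> p q) (c + e) (\<lambda>x. C x + E x) = end_value (ampl_ode0 \<kappa>) c C + end_value (ampl_ode \<kappa> p q) e E"
    using global_solution_add[OF C E] end_value_add[OF C E] by auto
qed

end

section \<open>Limiting absorption\<close>

text \<open>The systems at finite \<open>n\<close> may be singular. Only the limiting determinant
  matters, since Cramer's rule then expresses the unknowns for all large \<open>n\<close>.\<close>

lemma cramer_limit:
  fixes a b c d r s \<alpha> \<beta> :: "nat \<Rightarrow> complex"
  assumes lim: "a \<longlonglongrightarrow> a'" "b \<longlonglongrightarrow> b'" "c \<longlonglongrightarrow> c'" "d \<longlonglongrightarrow> d'" "r \<longlonglongrightarrow> r'" "s \<longlonglongrightarrow> s'"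
    and det: "a' * d' - b' * c' \<noteq> 0"
    and eq: "\<And>n. \<alpha> n * a n + \<beta> n * b n = r n" "\<And>n. \<alpha> n * c n + \<beta> n * d n = s n"
  shows "convergent \<alpha>" "convergent \<beta>"
proof -
  have D: "(\<lambda>n. a n * d n - b n * c n) \<longlonglongrightarrow> a' * d' - b' * c'" by (intro tendsto_intros lim)
  have ne: "\<forall>\<^sub>F n in sequentially. a n * d n - b n * c n \<noteq> 0" by (rule tendsto_imp_eventually_ne[OF D det])
  have \<alpha>: "\<alpha> n * (a n * d n - b n * c n) = r n * d n - b n * s n"
    and \<beta>: "\<beta> n * (a n * d n - b n * c n) = a n * s n - r n * c n" for n
    unfolding eq[symmetric] by (simp_all add: algebra_simps)
  have "(\<lambda>n. (r n * d n - b n * s n) / (a n * d n - b n * c n)) \<longlonglongrightarrow> (r' * d' - b' * s') / (a' * d' - b' * c')"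
    by (intro tendsto_intros lim det)
  moreover have "\<forall>\<^sub>F n in sequentially. (r n * d n - b n * s n) / (a n * d n - b n * c n) = \<alpha> n"
    using ne by (rule eventually_mono) (simp only: \<alpha>[symmetric], rule nonzero_mult_div_cancel_right)
  ultimately show "convergent \<alpha>" by (intro convergentI) (rule Lim_transform_eventually)
  have "(\<lambda>n. (a n * s n - r n * c n) / (a n * d n - b n * c n)) \<longlonglongrightarrow> (a' * s' - r' * c') / (a' * d' - b' * c')"
    by (intro tendsto_intros lim det)
  moreover have "\<forall>\<^sub>F n in sequentially. (a n * s n - r n * c n) / (a n * d n - b n * c n) = \<beta> n"
    using ne by (rule eventually_mono) (simp only: \<beta>[symmetric], rule nonzero_mult_div_cancel_right)
  ultimately show "convergent \<beta>" by (intro convergentI) (rule Lim_transform_eventually)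
qed

definition vec4 :: "complex \<Rightarrow> complex \<Rightarrow> complex \<Rightarrow> complex \<Rightarrow> complex^4" where
  "vec4 a b c d = (\<chi> j. if j = 1 then a else if j = 2 then b else if j = 3 then c else d)"

lemma vec4_nth [simp]:
  "vec4 a b c d $ 1 = a" "vec4 a b c d $ 2 = b" "vec4 a b c d $ 3 = c" "vec4 a b c d $ 4 = d"
  by (simp_all add: vec4_def)

text \<open>Data at -infinity on the second and third exponentials. For \<open>\<kappa>\<close> in
  the open first quadrant these are the two roots with positive real part, that is, the exponentials
  decaying at -infinity.\<close>

abbreviation incoming :: "complex \<Rightarrow> complex \<Rightarrow> complex^4" where
  "incoming \<alpha> \<beta> \<equiv> vec4 0 \<alpha> \<beta> 0"

lemma vec4_eq_iff: "(v :: complex^4) = w \<longleftrightarrow> v $ 1 = w $ 1 \<and> v $ 2 = w $ 2 \<and> v $ 3 = w $ 3 \<and> v $ 4 = w $ 4"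
  by (simp add: vec_eq_iff forall_4)

context potentials
begin

lemma superposition:
  assumes T2: "global_solution (ampl_ode0 \<kappa>) (incoming 1 0) T2" and T3: "global_solution (ampl_ode0 \<kappa>) (incoming 0 1) T3"
    and P: "global_solution (ampl_ode \<kappa> p q) 0 P"
  shows "global_solution (ampl_ode \<kappa> p q) (incoming \<alpha> \<beta>) (\<lambda>x. \<alpha> *s T2 x + (\<beta> *s T3 x + P x))"
    "end_value (ampl_ode \<kappa> p q) (incoming \<alpha> \<beta>) (\<lambda>x. \<alpha> *s T2 x + (\<beta> *s T3 x + P x))
      = \<alpha> *s end_value (ampl_ode0 \<kappa>) (incoming 1 0) T2 + (\<beta> *s end_value (ampl_ode0 \<kappa>) (incoming 0 1) T3 + end_value (ampl_ode \<kappa> p q) 0 P)"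
proof -
  have e: "\<alpha> *s incoming 1 0 + (\<beta> *s incoming 0 1 + 0) = incoming \<alpha> \<beta>" by (simp add: vec4_eq_iff)
  note s2 = solution_scale[OF T2, of \<alpha>] and s3 = solution_scale[OF T3, of \<beta>]
  note a3 = solution_add[OF s3(1) P]
  note a2 = solution_add[OF s2(1) a3(1)]
  show "global_solution (ampl_ode \<kappa> p q) (incoming \<alpha> \<beta>) (\<lambda>x. \<alpha> *s T2 x + (\<beta> *s T3 x + P x))"
    using a2(1) unfolding e .
  show "end_value (ampl_ode \<kappa> p q) (incoming \<alpha> \<beta>) (\<lambda>x. \<alpha> *s T2 x + (\<beta> *s T3 x + P x))
      = \<alpha> *s end_value (ampl_ode0 \<kappa>) (incoming 1 0) T2 + (\<beta> *s end_value (ampl_ode0 \<kappa>) (incoming 0 1) T3 + end_value (ampl_ode \<kappa> p q) 0 P)"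
    using a2(2) unfolding e a3(2) s2(2) s3(2) .
qed

lemma outgoing_decay_conditions:
  assumes "0 < Re \<kappa>" "0 < Im \<kappa>" and d: "d $ 2 = 0" "d $ 3 = 0"
  shows "incoming \<alpha> \<beta> $ j \<noteq> 0 \<Longrightarrow> 0 < Re (rt \<kappa> j)" "d $ j \<noteq> 0 \<Longrightarrow> Re (rt \<kappa> j) < 0"
  using assms exhaust_4[of j] by auto

lemma zero_solution: "global_solution (ampl_ode0 \<kappa>) 0 (\<lambda>_. 0)"
proof -
  have "ampl_ode0 \<kappa> t 0 = 0" for t by (simp add: ampl_ode_def vec_eq_iff)
  then show ?thesis by (simp add: global_solution_def set_lebesgue_integral_def)
qed

text \<open>Decay at +infinity requires the second and third end amplitudes to vanish: two linear
  equations for the two free data. A kernel vector would give a decaying solution without source,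
  which uniqueness of the resolvent equation excludes.\<close>

lemma resolvent_solution:
  assumes \<kappa>: "0 < Re \<kappa>" "0 < Im \<kappa>" "Im (\<kappa> ^ 4) \<noteq> 0" and pq: "admissible p q"
  shows "\<exists>\<alpha> \<beta> C. global_solution (ampl_ode \<kappa> p q) (incoming \<alpha> \<beta>) C \<and>
     end_value (ampl_ode \<kappa> p q) (incoming \<alpha> \<beta>) C $ 2 = 0 \<and> end_value (ampl_ode \<kappa> p q) (incoming \<alpha> \<beta>) C $ 3 = 0 \<and>
     RV v0 v1 (\<kappa> ^ 4) p q = (\<lambda>x. qderiv \<kappa> 0 x (C x))"
proof -
  have \<kappa>0: "\<kappa> \<noteq> 0" using \<kappa> by auto
  obtain T2 where T2: "global_solution (ampl_ode0 \<kappa>) (incoming 1 0) T2" using solution_exists[OF \<kappa>0 admissible_zero] by blast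
  obtain T3 where T3: "global_solution (ampl_ode0 \<kappa>) (incoming 0 1) T3" using solution_exists[OF \<kappa>0 admissible_zero] by blast
  obtain P where P: "global_solution (ampl_ode \<kappa> p q) 0 P" using solution_exists[OF \<kappa>0 pq] by blast
  define D2 D3 DP where "D2 = end_value (ampl_ode0 \<kappa>) (incoming 1 0) T2" and "D3 = end_value (ampl_ode0 \<kappa>) (incoming 0 1) T3"
    and "DP = end_value (ampl_ode \<kappa> p q) 0 P"
  note sup = superposition[OF T2 T3 P, folded D2_def D3_def DP_def]
  have inj: "\<alpha> = 0 \<and> \<beta> = 0" if "\<alpha> * D2 $ 2 + \<beta> * D3 $ 2 = 0" "\<alpha> * D2 $ 3 + \<beta> * D3 $ 3 = 0" for \<alpha> \<beta>
  proof -
    let ?C = "\<lambda>x. \<alpha> *s T2 x + (\<beta> *s T3 x + 0)"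
    note s = superposition[OF T2 T3 zero_solution, of \<alpha> \<beta>, folded D2_def D3_def]
    have z: "end_value (ampl_ode0 \<kappa>) 0 (\<lambda>_. 0) = 0"
      by (rule vanishing_solution(3)[OF \<kappa>0 zero_solution]) simp
    have d: "end_value (ampl_ode0 \<kappa>) (incoming \<alpha> \<beta>) ?C $ 2 = 0" "end_value (ampl_ode0 \<kappa>) (incoming \<alpha> \<beta>) ?C $ 3 = 0"
      unfolding s(2) z using that by simp_all
    have "resolvent_V_sol v0 v1 (\<kappa> ^ 4) (\<lambda>_. 0) (\<lambda>_. 0) (\<lambda>x. qderiv \<kappa> 0 x (?C x))"
      by (rule decaying_solution_weak[OF \<kappa>0 admissible_zero s(1) outgoing_decay_conditions[OF \<kappa>(1,2) d]])
    moreover have "resolvent_V_sol v0 v1 (\<kappa> ^ 4) (\<lambda>_. 0) (\<lambda>_. 0) (\<lambda>x. qderiv \<kappa> 0 x ((\<lambda>_. 0) x))"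
      by (rule decaying_solution_weak[OF \<kappa>0 admissible_zero zero_solution]) (simp_all add: z)
    ultimately have "(\<lambda>x. qderiv \<kappa> 0 x (?C x)) = (\<lambda>x. qderiv \<kappa> 0 x ((\<lambda>_. 0) x))"
      by (rule resolvent_V_sol_unique[OF \<kappa>(3)])
    then have "qderiv \<kappa> 0 x (?C x) = 0" for x by (simp add: fun_eq_iff)
    then have "incoming \<alpha> \<beta> = 0" by (rule vanishing_solution(2)[OF \<kappa>0 s(1)])
    then show ?thesis by (simp add: vec4_eq_iff)
  qed
  define \<Delta> where "\<Delta> = D2 $ 2 * D3 $ 3 - D3 $ 2 * D2 $ 3"
  have \<Delta>: "\<Delta> \<noteq> 0"
  proof
    assume "\<Delta> = 0"
    \<comment> \<open>Each row of a singular matrix yields the kernel vector orthogonal to it. Both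
      must be zero, so the whole matrix is zero, and then (1, 0) is a forbidden kernel
      vector.\<close>
    then have "D3 $ 2 = 0 \<and> - D2 $ 2 = 0" "D3 $ 3 = 0 \<and> - D2 $ 3 = 0"
      using inj[of "D3 $ 2" "- D2 $ 2"] inj[of "D3 $ 3" "- D2 $ 3"] by (simp_all add: \<Delta>_def algebra_simps)
    then show False using inj[of 1 0] by simp
  qed
  \<comment> \<open>Cramer's rule for the data that cancel the end amplitudes \<open>DP\<close> of
    the particular solution.\<close>
  define \<alpha> \<beta> where "\<alpha> = - (DP $ 2 * D3 $ 3 - D3 $ 2 * DP $ 3) / \<Delta>" and "\<beta> = - (D2 $ 2 * DP $ 3 - DP $ 2 * D2 $ 3) / \<Delta>"
  let ?C = "\<lambda>x. \<alpha> *s T2 x + (\<beta> *s T3 x + P x)"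
  have "\<Delta> * (\<alpha> * D2 $ 2 + (\<beta> * D3 $ 2 + DP $ 2)) = 0" "\<Delta> * (\<alpha> * D2 $ 3 + (\<beta> * D3 $ 3 + DP $ 3)) = 0"
    using \<Delta> by (simp_all add: \<alpha>_def \<beta>_def distrib_left) (simp_all add: \<Delta>_def algebra_simps)
  then have d: "end_value (ampl_ode \<kappa> p q) (incoming \<alpha> \<beta>) ?C $ 2 = 0" "end_value (ampl_ode \<kappa> p q) (incoming \<alpha> \<beta>) ?C $ 3 = 0"
    unfolding sup(2) using \<Delta> by simp_all
  have r: "resolvent_V_sol v0 v1 (\<kappa> ^ 4) p q (\<lambda>x. qderiv \<kappa> 0 x (?C x))"
    by (rule decaying_solution_weak[OF \<kappa>0 pq sup(1) outgoing_decay_conditions[OF \<kappa>(1,2) d]])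
  have "RV v0 v1 (\<kappa> ^ 4) p q = (\<lambda>x. qderiv \<kappa> 0 x (?C x))"
    unfolding RV_def
    by (rule the_equality[where P = "resolvent_V_sol v0 v1 (\<kappa> ^ 4) p q", OF r])
       (rule resolvent_V_sol_unique[OF \<kappa>(3) _ r])
  then show ?thesis using sup(1) d by blast
qed

text \<open>The principal square root maps the upper half plane into the open first quadrant, which
  lies in the upper half plane, so it can be applied twice.\<close>

lemma fourth_root_csqrt:
  fixes z :: complex
  assumes "0 < Im z"
  shows "csqrt (csqrt z) ^ 4 = z" "0 < Re (csqrt (csqrt z))" "0 < Im (csqrt (csqrt z))"
proof -
  have *: "0 < Re (csqrt w) \<and> 0 < Im (csqrt w)" if "0 < Im w" for w
  proof -
    have "\<bar>Re w\<bar>\<^sup>2 < (cmod w)\<^sup>2" using that by (simp add: cmod_power2)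
    then have "\<bar>Re w\<bar> < cmod w" by (rule power2_less_imp_less) simp
    then have "0 < cmod w + Re w" "0 < cmod w - Re w" by linarith+
    then show ?thesis using that by simp
  qed
  show "0 < Re (csqrt (csqrt z))" "0 < Im (csqrt (csqrt z))" using *[of "csqrt z"] *[OF assms] by blast+
  have "csqrt (csqrt z) ^ 4 = ((csqrt (csqrt z))\<^sup>2)\<^sup>2" by (simp only: power_mult[symmetric]) simp
  also have "\<dots> = z" by (simp only: power2_csqrt)
  finally show "csqrt (csqrt z) ^ 4 = z" .
qed

text \<open>The data \<open>\<alpha> n\<close> and \<open>\<beta> n\<close> have no a priori bound.
  They are recovered from the assumed pointwise limit: the limits of the two basis solutions are
  independent functions, so evaluation at two suitable points gives a system for the data that is
  invertible in the limit.\<close>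

theorem limiting_solution:
  assumes k: "0 < k" and pq: "admissible p q"
    and lim: "\<And>x. ((\<lambda>\<epsilon>. RV v0 v1 (complex_of_real (k ^ 4) + \<i> * complex_of_real \<epsilon>) p q x) \<longlongrightarrow> \<theta> x) (at_right 0)"
  obtains C c where "global_solution (ampl_ode (of_real k) p q) c C" "\<And>x. \<theta> x = qderiv (of_real k) 0 x (C x)"
    "c $ 1 = 0" "c $ 4 = 0" "end_value (ampl_ode (of_real k) p q) c C $ 2 = 0" "end_value (ampl_ode (of_real k) p q) c C $ 3 = 0"
proof -
  \<comment> \<open>Any positive null sequence would serve; since the one-sided limit is given, a
    single sequence identifies it.\<close>
  define \<epsilon> where "\<epsilon> n = inverse (real (Suc n))" for n
  define z where "z n = complex_of_real (k ^ 4) + \<i> * complex_of_real (\<epsilon> n)" for n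
  define \<kappa> where "\<kappa> n = csqrt (csqrt (z n))" for n
  let ?k = "complex_of_real k"
  have \<epsilon>: "\<epsilon> \<longlonglongrightarrow> 0" "\<And>n. 0 < \<epsilon> n" unfolding \<epsilon>_def[abs_def] by (rule LIMSEQ_inverse_real_of_nat) simp
  have zn: "0 < Im (z n)" for n using \<epsilon>(2) by (simp add: z_def)
  note \<kappa>n = fourth_root_csqrt[OF zn, folded \<kappa>_def]
  have k0: "?k \<noteq> 0" using k by simp
  have \<kappa>n0: "\<kappa> n \<noteq> 0" for n using \<kappa>n(2)[of n] by auto
  have lim\<kappa>: "\<kappa> \<longlonglongrightarrow> ?k"
  proof -
    have "z \<longlonglongrightarrow> complex_of_real (k ^ 4) + \<i> * complex_of_real 0"
      unfolding z_def[abs_def] by (intro tendsto_intros \<epsilon>)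
    moreover have c: "isCont csqrt (complex_of_real x)" if "0 < x" for x
      using that by (intro continuous_at_csqrt) (auto simp: complex_nonpos_Reals_iff)
    have "csqrt (complex_of_real (k ^ 4)) = complex_of_real (k ^ 2)"
    proof -
      have "sqrt (k ^ 4) = k ^ 2" using power_mult[of k 2 2] by (intro real_sqrt_unique) simp_all
      then show ?thesis using k by (subst of_real_sqrt[symmetric]) auto
    qed
    moreover have "csqrt (complex_of_real (k ^ 2)) = ?k"
      using k by (subst of_real_sqrt[symmetric]) auto
    ultimately show ?thesis unfolding \<kappa>_def[abs_def]
      using isCont_tendsto_compose[OF c[of "k ^ 2"]] isCont_tendsto_compose[OF c[of "k ^ 4"]] k by fastforce
  qed
  define Q where "Q n \<alpha> \<beta> C \<longleftrightarrow> global_solution (ampl_ode (\<kappa> n) p q) (incoming \<alpha> \<beta>) C \<and>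
     end_value (ampl_ode (\<kappa> n) p q) (incoming \<alpha> \<beta>) C $ 2 = 0 \<and> end_value (ampl_ode (\<kappa> n) p q) (incoming \<alpha> \<beta>) C $ 3 = 0 \<and>
     RV v0 v1 (\<kappa> n ^ 4) p q = (\<lambda>x. qderiv (\<kappa> n) 0 x (C x))" for n \<alpha> \<beta> C
  have "\<exists>\<alpha> \<beta> C. Q n \<alpha> \<beta> C" for n
    unfolding Q_def
    by (rule resolvent_solution[OF \<kappa>n(2,3) _ pq]) (use zn[of n] \<kappa>n(1)[of n] in simp)
  then obtain \<alpha> \<beta> C where "\<And>n. Q n (\<alpha> n) (\<beta> n) (C n)" by metis
  then have C: "\<And>n. global_solution (ampl_ode (\<kappa> n) p q) (incoming (\<alpha> n) (\<beta> n)) (C n)"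
    and E: "\<And>n. end_value (ampl_ode (\<kappa> n) p q) (incoming (\<alpha> n) (\<beta> n)) (C n) $ 2 = 0"
      "\<And>n. end_value (ampl_ode (\<kappa> n) p q) (incoming (\<alpha> n) (\<beta> n)) (C n) $ 3 = 0"
    and RV: "\<And>n. RV v0 v1 (\<kappa> n ^ 4) p q = (\<lambda>x. qderiv (\<kappa> n) 0 x (C n x))"
    unfolding Q_def by blast+
  have \<theta>: "(\<lambda>n. qderiv (\<kappa> n) 0 x (C n x)) \<longlonglongrightarrow> \<theta> x" for x
  proof -
    have "filterlim \<epsilon> (at_right 0) sequentially"
      using \<epsilon> by (auto simp: filterlim_at less_imp_neq[symmetric] intro!: always_eventually)
    from filterlim_compose[OF lim this] show ?thesis
      unfolding z_def[symmetric] \<kappa>n(1)[symmetric] RV .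
  qed
  obtain T2 where T2: "\<And>n. global_solution (ampl_ode0 (\<kappa> n)) (incoming 1 0) (T2 n)"
    using choice[of "\<lambda>n. global_solution (ampl_ode0 (\<kappa> n)) (incoming 1 0)"] solution_exists[OF \<kappa>n0 admissible_zero] by blast
  obtain T3 where T3: "\<And>n. global_solution (ampl_ode0 (\<kappa> n)) (incoming 0 1) (T3 n)"
    using choice[of "\<lambda>n. global_solution (ampl_ode0 (\<kappa> n)) (incoming 0 1)"] solution_exists[OF \<kappa>n0 admissible_zero] by blast
  obtain P where P: "\<And>n. global_solution (ampl_ode (\<kappa> n) p q) 0 (P n)"
    using choice[of "\<lambda>n. global_solution (ampl_ode (\<kappa> n) p q) 0"] solution_exists[OF \<kappa>n0 pq] by blast
  obtain T2' where T2': "global_solution (ampl_ode0 ?k) (incoming 1 0) T2'" using solution_exists[OF k0 admissible_zero] by blast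
  obtain T3' where T3': "global_solution (ampl_ode0 ?k) (incoming 0 1) T3'" using solution_exists[OF k0 admissible_zero] by blast
  obtain P' where P': "global_solution (ampl_ode ?k p q) 0 P'" using solution_exists[OF k0 pq] by blast
  have "C n = (\<lambda>x. \<alpha> n *s T2 n x + (\<beta> n *s T3 n x + P n x))" for n
    by (rule solution_unique[OF \<kappa>n0 pq C superposition(1)[OF T2 T3 P]])
  then have Cu: "\<alpha> n * qderiv (\<kappa> n) 0 x (T2 n x) + \<beta> n * qderiv (\<kappa> n) 0 x (T3 n x) = qderiv (\<kappa> n) 0 x (C n x) - qderiv (\<kappa> n) 0 x (P n x)" for n x
    by (simp add: qderiv_add qderiv_scale)
  define f2 f3 where "f2 x = qderiv ?k 0 x (T2' x)" and "f3 x = qderiv ?k 0 x (T3' x)" for x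
  have f2: "(\<lambda>n. qderiv (\<kappa> n) 0 x (T2 n x)) \<longlonglongrightarrow> f2 x" for x
    unfolding f2_def by (intro qderiv_tendsto lim\<kappa> solution_continuous_dependence(1)[OF lim\<kappa> k0 admissible_zero tendsto_const T2 T2'])
  have f3: "(\<lambda>n. qderiv (\<kappa> n) 0 x (T3 n x)) \<longlonglongrightarrow> f3 x" for x
    unfolding f3_def by (intro qderiv_tendsto lim\<kappa> solution_continuous_dependence(1)[OF lim\<kappa> k0 admissible_zero tendsto_const T3 T3'])
  have fP: "(\<lambda>n. qderiv (\<kappa> n) 0 x (P n x)) \<longlonglongrightarrow> qderiv ?k 0 x (P' x)" for x
    by (intro qderiv_tendsto lim\<kappa> solution_continuous_dependence(1)[OF lim\<kappa> k0 pq tendsto_const P P'])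
  have indep: "a = 0 \<and> b = 0" if "\<And>x. a * f2 x + b * f3 x = 0" for a b
  proof -
    have "incoming a b = 0"
      by (rule vanishing_solution(2)[OF k0 superposition(1)[OF T2' T3' zero_solution]])
         (use that in \<open>simp add: qderiv_add qderiv_scale f2_def f3_def\<close>)
    then show ?thesis by (simp add: vec4_eq_iff)
  qed
  \<comment> \<open>If all these 2 by 2 determinants vanished, fixing \<open>y\<close> would give
    linear relations between \<open>f2\<close> and \<open>f3\<close>. Independence makes their
    coefficients zero, and thus both functions.\<close>
  have "\<exists>x y. f2 x * f3 y - f3 x * f2 y \<noteq> 0"
  proof (rule ccontr)
    assume "\<not> ?thesis"
    then have "f3 y * f2 x + (- f2 y) * f3 x = 0" for x y by (simp add: algebra_simps)
    then have "f3 y = 0 \<and> - f2 y = 0" for y using indep[of "f3 y" "- f2 y"] by blast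
    then show False using indep[of 1 0] by simp
  qed
  then obtain x y where xy: "f2 x * f3 y - f3 x * f2 y \<noteq> 0" by blast
  have rhs: "(\<lambda>n. qderiv (\<kappa> n) 0 x (C n x) - qderiv (\<kappa> n) 0 x (P n x)) \<longlonglongrightarrow> \<theta> x - qderiv ?k 0 x (P' x)" for x
    by (intro tendsto_intros \<theta> fP)
  note conv = cramer_limit[OF f2 f3 f2 f3 rhs rhs xy Cu Cu]
  obtain \<alpha>' \<beta>' where \<alpha>: "\<alpha> \<longlonglongrightarrow> \<alpha>'" and \<beta>: "\<beta> \<longlonglongrightarrow> \<beta>'" using conv unfolding convergent_def by blast
  have inc: "(\<lambda>n. incoming (\<alpha> n) (\<beta> n)) \<longlonglongrightarrow> incoming \<alpha>' \<beta>'"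
    unfolding vec4_def by (intro vec_tendstoI) (auto simp: \<alpha> \<beta>)
  obtain C' where C': "global_solution (ampl_ode ?k p q) (incoming \<alpha>' \<beta>') C'" using solution_exists[OF k0 pq] by blast
  note dep = solution_continuous_dependence[OF lim\<kappa> k0 pq inc C C']
  have "\<theta> x = qderiv ?k 0 x (C' x)" for x
    by (rule LIMSEQ_unique[OF \<theta> qderiv_tendsto[OF lim\<kappa> dep(1)]])
  moreover have "end_value (ampl_ode ?k p q) (incoming \<alpha>' \<beta>') C' $ 2 = 0" "end_value (ampl_ode ?k p q) (incoming \<alpha>' \<beta>') C' $ 3 = 0"
    using LIMSEQ_unique[OF tendsto_vec_nth[OF dep(2)], of 2 0] LIMSEQ_unique[OF tendsto_vec_nth[OF dep(2)], of 3 0]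
    by (simp_all add: E)
  ultimately show ?thesis using that[OF C'] by simp
qed

end

section \<open>Asymptotics and conserved bilinear form\<close>

text \<open>On a bounded region \<open>v\<close> may be unbounded and only its integrability helps,
  while the exponential is bounded there. In the tail the decay rate
  \<open>\<bar>a\<bar> + 1\<close> leaves the integrable factor
  \<open>exp (- \<bar>t\<bar>)\<close>.\<close>

lemma integrable_exp_of_superexponential_decay:
  fixes v :: "real \<Rightarrow> real"
  assumes i: "integrable lborel v"
    and O: "\<And>\<kappa>. \<kappa> > 0 \<Longrightarrow> v \<in> O[at_infinity](\<lambda>x. exp (- \<kappa> * \<bar>x\<bar>))"
  shows "integrable lborel (\<lambda>t. v t * exp (a * \<bar>t\<bar>))"
proof -
  define \<kappa> where "\<kappa> = \<bar>a\<bar> + 1"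
  have "0 < \<kappa>" by (simp add: \<kappa>_def)
  from landau_o.bigE[OF O[OF this]] obtain c where
    "\<forall>\<^sub>F x in at_infinity. norm (v x) \<le> c * norm (exp (- \<kappa> * \<bar>x\<bar>))" and c: "0 < c" by blast
  then obtain B where B: "\<And>x. B \<le> \<bar>x\<bar> \<Longrightarrow> \<bar>v x\<bar> \<le> c * exp (- \<kappa> * \<bar>x\<bar>)"
    by (auto simp: eventually_at_infinity)
  have [measurable]: "v \<in> borel_measurable borel" using borel_measurable_integrable[OF i] by simp
  show ?thesis
  proof (rule Bochner_Integration.integrable_bound)
    show "integrable lborel (\<lambda>t. exp (\<bar>a\<bar> * \<bar>B\<bar>) * \<bar>v t\<bar> + c * exp (- 1 * \<bar>t\<bar>))"
      using i integrable_exp_minus_abs[of 1]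
      by (intro Bochner_Integration.integrable_add integrable_mult_right integrable_abs) auto
    show "AE t in lborel. norm (v t * exp (a * \<bar>t\<bar>)) \<le> norm (exp (\<bar>a\<bar> * \<bar>B\<bar>) * \<bar>v t\<bar> + c * exp (- 1 * \<bar>t\<bar>))"
    proof (intro AE_I2)
      fix t
      have "\<bar>v t\<bar> * exp (a * \<bar>t\<bar>) \<le> exp (\<bar>a\<bar> * \<bar>B\<bar>) * \<bar>v t\<bar> + c * exp (- 1 * \<bar>t\<bar>)"
      proof (cases "B \<le> \<bar>t\<bar>")
        case True
        have "\<bar>v t\<bar> * exp (a * \<bar>t\<bar>) \<le> c * exp (- \<kappa> * \<bar>t\<bar>) * exp (\<bar>a\<bar> * \<bar>t\<bar>)"
          using c by (intro mult_mono B True) (auto intro: mult_right_mono)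
        also have "\<dots> = c * exp (- 1 * \<bar>t\<bar>)" by (simp add: \<kappa>_def algebra_simps flip: exp_add)
        finally show ?thesis by (simp add: add_increasing)
      next
        case False
        have "a * \<bar>t\<bar> \<le> \<bar>a\<bar> * \<bar>B\<bar>" by (rule order_trans[OF mult_right_mono[of a "\<bar>a\<bar>"] mult_left_mono]) (use False in auto)
        then have "\<bar>v t\<bar> * exp (a * \<bar>t\<bar>) \<le> \<bar>v t\<bar> * exp (\<bar>a\<bar> * \<bar>B\<bar>)" by (intro mult_left_mono) auto
        then show ?thesis using c by (simp add: add_increasing2 mult.commute)
      qed
      then show "norm (v t * exp (a * \<bar>t\<bar>)) \<le> norm (exp (\<bar>a\<bar> * \<bar>B\<bar>) * \<bar>v t\<bar> + c * exp (- 1 * \<bar>t\<bar>))"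
        using abs_ge_self order_trans by (simp add: abs_mult) blast
    qed
  qed measurable
qed

text \<open>Uniqueness of a two-term expansion. The oscillating term has constant modulus, so its
  coefficient is read off first; division by \<open>e\<close> then isolates \<open>B\<close>,
  because the remainder is of order \<open>e\<close> squared.\<close>

lemma asymptotic_match:
  fixes A B :: complex and w :: "real \<Rightarrow> complex" and e :: "real \<Rightarrow> real"
  assumes F: "F \<noteq> bot" and e0: "(e \<longlongrightarrow> 0) F" and e: "\<And>x. 0 < e x" and w: "\<And>x. norm (w x) = 1"
    and O: "(\<lambda>x. A * w x + B * of_real (e x)) \<in> O[F](\<lambda>x. (of_real (e x))\<^sup>2 :: complex)"
  shows "A = 0" "B = 0"
proof -
  from landau_o.bigE[OF O] obtain c where
    "\<forall>\<^sub>F x in F. norm (A * w x + B * of_real (e x)) \<le> c * norm ((of_real (e x))\<^sup>2 :: complex)" by blast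
  then have c: "\<forall>\<^sub>F x in F. norm (A * w x + B * of_real (e x)) \<le> c * (e x)\<^sup>2"
    by (simp add: norm_power)
  have "\<forall>\<^sub>F x in F. norm A \<le> c * (e x)\<^sup>2 + norm B * e x"
    using c
  proof eventually_elim
    case (elim x)
    have "norm A = norm (A * w x)" using w by (simp add: norm_mult)
    also have "\<dots> \<le> norm (A * w x + B * of_real (e x)) + norm (B * of_real (e x))"
      by (metis add_diff_cancel_right' norm_triangle_ineq4)
    finally show ?case using elim e[of x] by (simp add: norm_mult)
  qed
  moreover have "((\<lambda>x. c * (e x)\<^sup>2 + norm B * e x) \<longlongrightarrow> c * 0\<^sup>2 + norm B * 0) F"
    by (intro tendsto_intros e0)
  ultimately have "norm A \<le> 0" using tendsto_lowerbound[OF _ _ F] by fastforce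
  then show A: "A = 0" by simp
  have "\<forall>\<^sub>F x in F. norm B \<le> c * e x"
    using c
  proof eventually_elim
    case (elim x)
    then have "norm B * e x \<le> (c * e x) * e x"
      using e[of x] by (simp add: A norm_mult power2_eq_square)
    then show ?case using e[of x] by (simp add: mult_le_cancel_right)
  qed
  moreover have "((\<lambda>x. c * e x) \<longlongrightarrow> c * 0) F" by (intro tendsto_intros e0)
  ultimately have "norm B \<le> 0" using tendsto_lowerbound[OF _ _ F] by fastforce
  then show "B = 0" by simp
qed

text \<open>Up to the factor \<open>- 4 \<i> \<kappa>^3\<close> this is the Wronskian \<open>u''' w - u'' w' + u' w'' - u w'''\<close>
  in terms of the amplitudes: the exponentials cancel because only pairs of opposite roots contribute.\<close>
definition wronskian :: "complex^4 \<Rightarrow> complex^4 \<Rightarrow> complex" where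
  "wronskian v w = (v $ 1 * w $ 2 - v $ 2 * w $ 1) + \<i> * (v $ 3 * w $ 4 - v $ 4 * w $ 3)"

text \<open>Conjugation exchanges the roots \<open>\<i> k\<close> and \<open>- \<i> k\<close> and fixes \<open>k\<close> and \<open>- k\<close>.\<close>
definition conj4 :: "complex^4 \<Rightarrow> complex^4" where
  "conj4 v = vec4 (cnj (v $ 2)) (cnj (v $ 1)) (cnj (v $ 3)) (cnj (v $ 4))"

lemma bounded_linear_conj4: "bounded_linear conj4"
  by (rule linear_conv_bounded_linear[THEN iffD1])
     (auto intro!: linearI simp: conj4_def vec4_eq_iff complex_eq_iff)

context potentials
begin

lemma solution_tendsto_at_bot:
  assumes "\<kappa> \<noteq> 0" "admissible p q" "global_solution (ampl_ode \<kappa> p q) c C"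
  shows "(C \<longlongrightarrow> c) at_bot"
proof -
  have "0 \<le> (1 :: real)" by simp
  from solution_rate[OF assms this] obtain K where K: "\<And>x. norm (C x - c) \<le> K * exp (1 * x)" by metis
  have "((\<lambda>x. K * exp x) \<longlongrightarrow> K * 0) at_bot" by (intro tendsto_intros exp_at_bot)
  then show ?thesis
    using Lim_null_comparison[of "\<lambda>x. C x - c" "\<lambda>x. K * exp x" at_bot] K
    by (intro LIM_zero_cancel[of C c]) (simp add: always_eventually)
qed

text \<open>The right-hand side is symmetric in \<open>v\<close> and \<open>w\<close>, which
  expresses that the differential expression is formally symmetric for the bilinear pairing.\<close>

lemma wronskian_ampl_ode0:
  assumes "\<kappa> \<noteq> 0"
  shows "4 * \<kappa> ^ 3 * wronskian (ampl_ode0 \<kappa> t v) w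
    = - \<i> * (of_real (v0 t) * qderiv \<kappa> 0 t v * qderiv \<kappa> 0 t w + of_real (v1 t) * qderiv \<kappa> 1 t v * qderiv \<kappa> 1 t w)"
proof -
  define Z Z' W W' where "Z = exp (\<i> * \<kappa> * of_real t)" and "Z' = exp (- (\<i> * \<kappa> * of_real t))"
    and "W = exp (\<kappa> * of_real t)" and "W' = exp (- (\<kappa> * of_real t))"
  define A B where "A = - of_real (v0 t) * qderiv \<kappa> 0 t v" and "B = of_real (v1 t) * qderiv \<kappa> 1 t v"
  have c: "ampl_ode0 \<kappa> t v $ 1 = \<i> * Z' / (4 * \<kappa> ^ 3) * (A + \<i> * \<kappa> * B)"
    "ampl_ode0 \<kappa> t v $ 2 = - \<i> * Z / (4 * \<kappa> ^ 3) * (A - \<i> * \<kappa> * B)"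
    "ampl_ode0 \<kappa> t v $ 3 = W' / (4 * \<kappa> ^ 3) * (A + \<kappa> * B)"
    "ampl_ode0 \<kappa> t v $ 4 = - W / (4 * \<kappa> ^ 3) * (A - \<kappa> * B)"
    using assms by (simp_all add: ampl_ode_def A_def B_def Z_def Z'_def W_def W'_def power_mult_distrib power3_eq_cube field_simps)
  have u: "qderiv \<kappa> 0 t w = Z * w $ 1 + Z' * w $ 2 + W * w $ 3 + W' * w $ 4"
    "qderiv \<kappa> 1 t w = \<kappa> * (\<i> * Z * w $ 1 - \<i> * Z' * w $ 2 + W * w $ 3 - W' * w $ 4)"
    by (simp_all add: qderiv_def sum_4 Z_def Z'_def W_def W'_def algebra_simps)
  have "4 * \<kappa> ^ 3 * wronskian (ampl_ode0 \<kappa> t v) w = \<i> * (A * qderiv \<kappa> 0 t w - B * qderiv \<kappa> 1 t w)"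
    unfolding wronskian_def c u using assms by (simp add: field_simps)
  then show ?thesis by (simp add: A_def B_def algebra_simps)
qed

text \<open>The derivative of the Wronskian vanishes because the symmetric form of
  \<open>wronskian_ampl_ode0\<close> meets the antisymmetry of \<open>wronskian\<close>. The
  constant value is then computed at both ends.\<close>

lemma wronskian_conserved:
  assumes \<kappa>: "\<kappa> \<noteq> 0" and C: "global_solution (ampl_ode0 \<kappa>) c C" and E: "global_solution (ampl_ode0 \<kappa>) e E"
  shows "wronskian c e = wronskian (end_value (ampl_ode0 \<kappa>) c C) (end_value (ampl_ode0 \<kappa>) e E)"
proof -
  have anti: "wronskian v w = - wronskian w v" for v w by (simp add: wronskian_def algebra_simps)
  have zero: "wronskian (ampl_ode0 \<kappa> t (C t)) (E t) + wronskian (C t) (ampl_ode0 \<kappa> t (E t)) = 0" for t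
  proof -
    have "4 * \<kappa> ^ 3 * wronskian (ampl_ode0 \<kappa> t (C t)) (E t) = 4 * \<kappa> ^ 3 * wronskian (ampl_ode0 \<kappa> t (E t)) (C t)"
      unfolding wronskian_ampl_ode0[OF \<kappa>] by (simp add: mult_ac)
    then have "wronskian (ampl_ode0 \<kappa> t (C t)) (E t) = wronskian (ampl_ode0 \<kappa> t (E t)) (C t)" using \<kappa> by simp
    then show ?thesis using anti[of "C t" "ampl_ode0 \<kappa> t (E t)"] by simp
  qed
  note pC = component_primitive[OF C] and pE = component_primitive[OF E]
  have m: "primitive (\<lambda>x. C x $ i * E x $ j) (\<lambda>x. ampl_ode0 \<kappa> x (C x) $ i * E x $ j + C x $ i * ampl_ode0 \<kappa> x (E x) $ j)" for i j
    by (rule primitive_mult[OF pC pE])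
  have d: "primitive (\<lambda>x. a * (C x $ i * E x $ j - C x $ i' * E x $ j'))
     (\<lambda>x. a * ((ampl_ode0 \<kappa> x (C x) $ i * E x $ j + C x $ i * ampl_ode0 \<kappa> x (E x) $ j) - (ampl_ode0 \<kappa> x (C x) $ i' * E x $ j' + C x $ i' * ampl_ode0 \<kappa> x (E x) $ j')))"
    for a i j i' j'
    by (rule primitive_cong[OF primitive_linear[OF primitive_add[OF m[of i j]
          primitive_linear[OF m[of i' j'] bounded_linear_minus[OF bounded_linear_ident]]] bounded_linear_mult_right[of a]]])
       simp_all
  have "primitive (\<lambda>x. wronskian (C x) (E x)) (\<lambda>x. wronskian (ampl_ode0 \<kappa> x (C x)) (E x) + wronskian (C x) (ampl_ode0 \<kappa> x (E x)))"
    by (rule primitive_cong[OF primitive_add[OF d[of 1 1 2 2 1] d[of \<i> 3 4 4 3]]]) (simp_all add: wronskian_def algebra_simps)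
  then have p: "primitive (\<lambda>x. wronskian (C x) (E x)) (\<lambda>x. 0)" unfolding zero .
  define w0 where "w0 = wronskian (C 0) (E 0)"
  have const: "wronskian (C x) (E x) = w0" for x
    unfolding w0_def using primitive_diff_eq[OF p, of 0 x] primitive_diff_eq[OF p, of x 0]
    by (cases "0 \<le> x") (simp_all add: set_lebesgue_integral_def)
  have lim: "((\<lambda>x. wronskian (C x) (E x)) \<longlongrightarrow> wronskian a b) F" if "(C \<longlongrightarrow> a) F" "(E \<longlongrightarrow> b) F" for a b F
    unfolding wronskian_def by (intro tendsto_intros that)
  have "wronskian c e = w0"
    using tendsto_unique[OF _ lim[OF solution_tendsto_at_bot[OF \<kappa> admissible_zero C] solution_tendsto_at_bot[OF \<kappa> admissible_zero E]], of w0]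
    unfolding const by simp
  moreover have "wronskian (end_value (ampl_ode0 \<kappa>) c C) (end_value (ampl_ode0 \<kappa>) e E) = w0"
    using tendsto_unique[OF _ lim[OF end_value_tendsto[OF C] end_value_tendsto[OF E]], of w0]
    unfolding const by simp
  ultimately show ?thesis by simp
qed

text \<open>Real \<open>k\<close> and real potentials make the conjugate of a solution a
  solution.\<close>

lemma solution_conj4:
  assumes C: "global_solution (ampl_ode0 (of_real k)) c C"
  shows "global_solution (ampl_ode0 (of_real k)) (conj4 c) (\<lambda>x. conj4 (C x))"
    "end_value (ampl_ode0 (of_real k)) (conj4 c) (\<lambda>x. conj4 (C x)) = conj4 (end_value (ampl_ode0 (of_real k)) c C)"
proof -
  have u: "qderiv (of_real k) m t (conj4 v) = cnj (qderiv (of_real k) m t v)" for m t v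
    by (simp add: qderiv_def sum_4 conj4_def exp_cnj)
  have "ampl_ode0 (of_real k) t (conj4 v) = conj4 (ampl_ode0 (of_real k) t v)" for t v
    unfolding vec4_eq_iff by (simp add: ampl_ode_def u) (simp add: conj4_def exp_cnj)
  then show "global_solution (ampl_ode0 (of_real k)) (conj4 c) (\<lambda>x. conj4 (C x))"
    "end_value (ampl_ode0 (of_real k)) (conj4 c) (\<lambda>x. conj4 (C x)) = conj4 (end_value (ampl_ode0 (of_real k)) c C)"
    using global_solution_linear[OF C bounded_linear_conj4] end_value_linear[OF C bounded_linear_conj4] by auto
qed

text \<open>The second and third end amplitudes are already fixed by the radiation condition, so
  only those of \<open>exp (\<i> k x)\<close> and \<open>exp (- k x)\<close> are left to read off. A
  remainder at rate \<open>2 * k\<close> is the square of \<open>exp (- k x)\<close>, as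
  \<open>asymptotic_match\<close> wants.\<close>

lemma match_top:
  assumes k: "0 < k" and C: "global_solution (ampl_ode0 (of_real k)) c C"
    and d: "end_value (ampl_ode0 (of_real k)) c C $ 2 = d $ 2" "end_value (ampl_ode0 (of_real k)) c C $ 3 = d $ 3"
    and O: "(\<lambda>x. qderiv (of_real k) 0 x (C x) - qderiv (of_real k) 0 x d) \<in> O[at_top](\<lambda>x. complex_of_real (exp (- (2 * k) * x)))"
  shows "end_value (ampl_ode0 (of_real k)) c C = d"
proof -
  let ?k = "complex_of_real k"
  have k0: "?k \<noteq> 0" using k by simp
  define D where "D = end_value (ampl_ode0 ?k) c C"
  \<comment> \<open>The amplitude error at rate \<open>3 * k\<close> still has rate
    \<open>2 * k\<close> after multiplication by exponentials growing at rate
    \<open>k\<close>.\<close>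
  have "0 \<le> 3 * k" using k by simp
  from solution_rate[OF k0 admissible_zero C this, folded D_def]
  obtain K where K: "0 \<le> K" "\<And>x. norm (C x - D) \<le> K * exp (- (3 * k) * x)" by metis
  have "(\<lambda>x. qderiv ?k 0 x (C x) - qderiv ?k 0 x D) \<in> O[at_top](\<lambda>x. complex_of_real (exp (- (2 * k) * x)))"
  \<comment> \<open>The added 1 keeps the constant strictly positive when \<open>K\<close> is
    0.\<close>
  proof (rule landau_o.bigI[of "4 * K + 1"])
    show "\<forall>\<^sub>F x in at_top. norm (qderiv ?k 0 x (C x) - qderiv ?k 0 x D) \<le> (4 * K + 1) * norm (complex_of_real (exp (- (2 * k) * x)))"
      using eventually_ge_at_top[of 0]
    proof eventually_elim
      case (elim x)
      have "norm (qderiv ?k 0 x (C x - D)) \<le> 4 * k ^ 0 * exp (k * \<bar>x\<bar>) * norm (C x - D)"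
        by (rule norm_qderiv_le) (use k in simp)
      also have "\<dots> \<le> 4 * k ^ 0 * exp (k * \<bar>x\<bar>) * (K * exp (- (3 * k) * x))" by (intro mult_left_mono K) auto
      also have "\<dots> = 4 * K * exp (- (2 * k) * x)" using elim by (simp add: algebra_simps flip: exp_add)
      also have "\<dots> \<le> (4 * K + 1) * exp (- (2 * k) * x)" by (intro mult_right_mono) auto
      finally show ?case by (simp add: qderiv_diff)
    qed
  qed (use K in simp)
  from sum_in_bigo(2)[OF O this]
  have "(\<lambda>x. qderiv ?k 0 x D - qderiv ?k 0 x d) \<in> O[at_top](\<lambda>x. complex_of_real (exp (- (2 * k) * x)))" by simp
  moreover have "qderiv ?k 0 x D - qderiv ?k 0 x d = (D $ 1 - d $ 1) * exp (\<i> * ?k * of_real x) + (D $ 4 - d $ 4) * of_real (exp (- k * x))" for x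
    using d unfolding D_def[symmetric] by (simp add: qderiv_def sum_4 algebra_simps exp_of_real[symmetric])
  moreover have "complex_of_real (exp (- (2 * k) * x)) = (of_real (exp (- k * x)))\<^sup>2" for x
    by (simp add: power2_eq_square flip: exp_add of_real_mult)
  ultimately have O': "(\<lambda>x. (D $ 1 - d $ 1) * exp (\<i> * ?k * of_real x) + (D $ 4 - d $ 4) * of_real (exp (- k * x)))
     \<in> O[at_top](\<lambda>x. (of_real (exp (- k * x)))\<^sup>2 :: complex)" by simp
  have lim: "((\<lambda>x. exp (- k * x)) \<longlongrightarrow> 0) at_top"
    by (intro filterlim_compose[OF exp_at_bot] filterlim_tendsto_neg_mult_at_bot[where c = "- k"] filterlim_ident tendsto_const) (use k in auto)
  have "D $ 1 - d $ 1 = 0" "D $ 4 - d $ 4 = 0"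
    using asymptotic_match[OF _ lim _ _ O'] by (simp_all add: norm_exp_eq_Re)
  then show ?thesis using d by (simp add: vec4_eq_iff D_def)
qed

text \<open>The mirror image of \<open>match_top\<close>: at -infinity the first and fourth
  amplitudes are known, and those of \<open>exp (- \<i> k x)\<close> and \<open>exp (k x)\<close>
  are read off.\<close>

lemma match_bot:
  assumes k: "0 < k" and C: "global_solution (ampl_ode0 (of_real k)) c C"
    and d: "c $ 1 = d $ 1" "c $ 4 = d $ 4"
    and O: "(\<lambda>x. qderiv (of_real k) 0 x (C x) - qderiv (of_real k) 0 x d) \<in> O[at_bot](\<lambda>x. complex_of_real (exp ((2 * k) * x)))"
  shows "c = d"
proof -
  let ?k = "complex_of_real k"
  have k0: "?k \<noteq> 0" using k by simp
  have "0 \<le> 3 * k" using k by simp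
  from solution_rate[OF k0 admissible_zero C this]
  obtain K where K: "0 \<le> K" "\<And>x. norm (C x - c) \<le> K * exp ((3 * k) * x)" by metis
  have "(\<lambda>x. qderiv ?k 0 x (C x) - qderiv ?k 0 x c) \<in> O[at_bot](\<lambda>x. complex_of_real (exp ((2 * k) * x)))"
  proof (rule landau_o.bigI[of "4 * K + 1"])
    show "\<forall>\<^sub>F x in at_bot. norm (qderiv ?k 0 x (C x) - qderiv ?k 0 x c) \<le> (4 * K + 1) * norm (complex_of_real (exp ((2 * k) * x)))"
      using eventually_le_at_bot[of 0]
    proof eventually_elim
      case (elim x)
      have "norm (qderiv ?k 0 x (C x - c)) \<le> 4 * k ^ 0 * exp (k * \<bar>x\<bar>) * norm (C x - c)"
        by (rule norm_qderiv_le) (use k in simp)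
      also have "\<dots> \<le> 4 * k ^ 0 * exp (k * \<bar>x\<bar>) * (K * exp ((3 * k) * x))" by (intro mult_left_mono K) auto
      also have "\<dots> = 4 * K * exp ((2 * k) * x)" using elim by (simp add: algebra_simps flip: exp_add)
      also have "\<dots> \<le> (4 * K + 1) * exp ((2 * k) * x)" by (intro mult_right_mono) auto
      finally show ?case by (simp add: qderiv_diff)
    qed
  qed (use K in simp)
  from sum_in_bigo(2)[OF O this]
  have "(\<lambda>x. qderiv ?k 0 x c - qderiv ?k 0 x d) \<in> O[at_bot](\<lambda>x. complex_of_real (exp ((2 * k) * x)))" by simp
  moreover have "qderiv ?k 0 x c - qderiv ?k 0 x d = (c $ 2 - d $ 2) * exp (- \<i> * ?k * of_real x) + (c $ 3 - d $ 3) * of_real (exp (k * x))" for x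
    using d by (simp add: qderiv_def sum_4 algebra_simps exp_of_real[symmetric])
  moreover have "complex_of_real (exp ((2 * k) * x)) = (of_real (exp (k * x)))\<^sup>2" for x
    by (simp add: power2_eq_square flip: exp_add of_real_mult)
  ultimately have O': "(\<lambda>x. (c $ 2 - d $ 2) * exp (- \<i> * ?k * of_real x) + (c $ 3 - d $ 3) * of_real (exp (k * x)))
     \<in> O[at_bot](\<lambda>x. (of_real (exp (k * x)))\<^sup>2 :: complex)" by simp
  have lim: "((\<lambda>x. exp (k * x)) \<longlongrightarrow> 0) at_bot"
    by (intro filterlim_compose[OF exp_at_bot] filterlim_tendsto_pos_mult_at_bot[where c = k] filterlim_ident tendsto_const) (use k in auto)
  have "c $ 2 - d $ 2 = 0" "c $ 3 - d $ 3 = 0"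
    using asymptotic_match[OF _ lim _ _ O'] by (simp_all add: norm_exp_eq_Re)
  then show ?thesis using d by (simp add: vec4_eq_iff)
qed

text \<open>The free wave has the constant amplitude vector \<open>e\<close>, and the scattered part
  solves the system with the free wave as source. In the difference the source disappears, while the
  radiation conditions fix four amplitudes to those of \<open>e\<close>.\<close>

lemma wave_function_solution:
  assumes k: "0 < k" and pq: "admissible p q"
    and p: "\<And>x. p x = qderiv (of_real k) 0 x e" and q: "\<And>x. q x = qderiv (of_real k) 1 x e"
    and \<psi>: "is_wave_function v0 v1 (k ^ 4) p q \<psi>"
  obtains C c where "global_solution (ampl_ode0 (of_real k)) c C" "\<And>x. \<psi> x = qderiv (of_real k) 0 x (C x)"
    "c $ 1 = e $ 1" "c $ 4 = e $ 4" "end_value (ampl_ode0 (of_real k)) c C $ 2 = e $ 2" "end_value (ampl_ode0 (of_real k)) c C $ 3 = e $ 3"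
proof -
  let ?k = "complex_of_real k"
  have "((\<lambda>\<epsilon>. RV v0 v1 (complex_of_real (k ^ 4) + \<i> * complex_of_real \<epsilon>) p q x) \<longlongrightarrow> p x - \<psi> x) (at_right 0)" for x
    using \<psi> unfolding is_wave_function_def by blast
  from limiting_solution[OF k pq this]
  obtain C c where C: "global_solution (ampl_ode ?k p q) c C" and \<theta>: "\<And>x. p x - \<psi> x = qderiv ?k 0 x (C x)"
    and c: "c $ 1 = 0" "c $ 4 = 0" "end_value (ampl_ode ?k p q) c C $ 2 = 0" "end_value (ampl_ode ?k p q) c C $ 3 = 0"
    by metis
  \<comment> \<open>\<open>\<Phi>\<close> is arranged so that the constant \<open>e\<close> solves
    it, and \<open>\<Psi>\<close> so that the negated scattered amplitudes do. Their sum is the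
    homogeneous system because \<open>p\<close> and \<open>q\<close> come from
    \<open>e\<close>.\<close>
  define \<Phi> where "\<Phi> t v = ampl_ode0 ?k t (v - e)" for t v
  define \<Psi> where "\<Psi> t v = - ampl_ode ?k p q t (- v)" for t v
  have z: "ampl_ode0 ?k t 0 = 0" for t by (simp add: ampl_ode_def vec_eq_iff)
  have e: "global_solution \<Phi> e (\<lambda>_. e)" by (simp add: global_solution_def \<Phi>_def z set_lebesgue_integral_def)
  have ee: "end_value \<Phi> e (\<lambda>_. e) = e" by (simp add: end_value_def \<Phi>_def z)
  have bl: "bounded_linear (uminus :: complex^4 \<Rightarrow> _)" by (rule bounded_linear_minus[OF bounded_linear_ident])
  have \<Psi>: "\<Psi> t (- v) = - ampl_ode ?k p q t v" for t v by (simp add: \<Psi>_def)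
  note m = global_solution_linear[where \<Psi> = \<Psi>, OF C bl \<Psi>] and me = end_value_linear[where \<Psi> = \<Psi>, OF C bl \<Psi>]
  have eq: "ampl_ode0 ?k t (v + w) = \<Phi> t v + \<Psi> t w" for t v w
  proof -
    have "qderiv ?k j t (- w) = - qderiv ?k j t w" for j using qderiv_scale[of ?k j t "-1" w] by (simp add: vector_smult_lneg)
    then show ?thesis
      unfolding vec_eq_iff by (auto simp: \<Phi>_def \<Psi>_def ampl_ode_def p q qderiv_add qderiv_diff algebra_simps add_divide_distrib diff_divide_distrib)
  qed
  note s = global_solution_add[where \<Theta> = "ampl_ode0 ?k", OF e m eq]
  have es: "end_value (ampl_ode0 ?k) (e + - c) (\<lambda>x. e + - C x) = e + - end_value (ampl_ode ?k p q) c C"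
    using end_value_add[where \<Theta> = "ampl_ode0 ?k", OF e m eq] unfolding me ee .
  show ?thesis
  proof (rule that[OF s])
    show "\<psi> x = qderiv ?k 0 x (e + - C x)" for x using \<theta>[of x] unfolding p by (simp add: qderiv_diff algebra_simps)
  qed (simp_all add: es[simplified] c)
qed

text \<open>What remains is \<open>exp (k x)\<close> at -infinity and \<open>exp (- k x)\<close> at
  +infinity, so the function lies in H2. The weak equation with zero source is then the eigenvalue
  equation, and a nonzero solution would be an eigenfunction.\<close>

lemma decaying_solution_vanishes:
  assumes k: "0 < k" and ne: "\<not> is_eigenvalue_H v0 v1 (k ^ 4)" and C: "global_solution (ampl_ode0 (of_real k)) c C"
    and c: "c $ 1 = 0" "c $ 2 = 0" "c $ 4 = 0"
    and d: "end_value (ampl_ode0 (of_real k)) c C $ 1 = 0" "end_value (ampl_ode0 (of_real k)) c C $ 2 = 0" "end_value (ampl_ode0 (of_real k)) c C $ 3 = 0"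
  shows "c = 0" "end_value (ampl_ode0 (of_real k)) c C = 0"
proof -
  let ?k = "complex_of_real k"
  have k0: "?k \<noteq> 0" using k by simp
  have "resolvent_V_sol v0 v1 (?k ^ 4) (\<lambda>_. 0) (\<lambda>_. 0) (\<lambda>x. qderiv ?k 0 x (C x))"
  proof (rule decaying_solution_weak[OF k0 admissible_zero C])
    show "0 < Re (rt ?k j)" if "c $ j \<noteq> 0" for j using exhaust_4[of j] that c k by auto
    show "Re (rt ?k j) < 0" if "end_value (ampl_ode0 ?k) c C $ j \<noteq> 0" for j using exhaust_4[of j] that d k by auto
  qed
  then have "qderiv ?k 0 x (C x) = 0" for x
    using ne unfolding resolvent_V_sol_def is_eigenvalue_H_def by fastforce
  then show "c = 0" "end_value (ampl_ode0 ?k) c C = 0" by (rule vanishing_solution[OF k0 C])+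
qed

end

section \<open>Unitarity relations and the identities for the evanescent amplitudes\<close>

theorem theorem4p8:
  fixes v0 v1 :: "real \<Rightarrow> real" and k lam :: real
    and psi1 psi2 :: "real \<Rightarrow> complex"
    and b11 b12 b21 b22 :: complex
  defines "phi1 \<equiv> (\<lambda>x. exp (\<i> * complex_of_real (k * x)))"
      and "dphi1 \<equiv> (\<lambda>x. \<i> * complex_of_real k * exp (\<i> * complex_of_real (k * x)))"
      and "phi2 \<equiv> (\<lambda>x. exp (- \<i> * complex_of_real (k * x)))"
      and "dphi2 \<equiv> (\<lambda>x. - \<i> * complex_of_real k * exp (- \<i> * complex_of_real (k * x)))"
  assumes v0_meas: "v0 \<in> borel_measurable lborel" and v1_meas: "v1 \<in> borel_measurable lborel"
      and v0_L1: "integrable lborel v0" and v1_L1: "integrable lborel v1"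
      and v0_decay: "\<And>\<kappa>. \<kappa> > 0 \<Longrightarrow> v0 \<in> O[at_infinity](\<lambda>x. exp (- \<kappa> * \<bar>x\<bar>))"
      and v1_decay: "\<And>\<kappa>. \<kappa> > 0 \<Longrightarrow> v1 \<in> O[at_infinity](\<lambda>x. exp (- \<kappa> * \<bar>x\<bar>))"
      and k_pos: "k > 0" and lam_def: "lam = k ^ 4"
      and not_eig: "\<not> is_eigenvalue_H v0 v1 lam"
      and psi1: "is_wave_function v0 v1 lam phi1 dphi1 psi1"
      and psi2: "is_wave_function v0 v1 lam phi2 dphi2 psi2"
  defines "s11 \<equiv> smat_entry v0 v1 k True phi1 dphi1 psi1"
      and "s12 \<equiv> smat_entry v0 v1 k False phi1 dphi1 psi2"
      and "s21 \<equiv> smat_entry v0 v1 k False phi2 dphi2 psi1"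
      and "s22 \<equiv> smat_entry v0 v1 k True phi2 dphi2 psi2"
  assumes asym11: "\<And>\<kappa>. \<kappa> > 0 \<Longrightarrow>
        (\<lambda>x. psi1 x - (s11 * exp (\<i> * complex_of_real (k * x)) + b11 * complex_of_real (exp (- k * x))))
          \<in> O[at_top](\<lambda>x. complex_of_real (exp (- \<kappa> * x)))"
      and asym21: "\<And>\<kappa>. \<kappa> > 0 \<Longrightarrow>
        (\<lambda>x. psi1 x - (exp (\<i> * complex_of_real (k * x)) + s21 * exp (- \<i> * complex_of_real (k * x))
                        + b21 * complex_of_real (exp (k * x))))
          \<in> O[at_bot](\<lambda>x. complex_of_real (exp (\<kappa> * x)))"
      and asym12: "\<And>\<kappa>. \<kappa> > 0 \<Longrightarrow>
        (\<lambda>x. psi2 x - (exp (- \<i> * complex_of_real (k * x)) + s12 * exp (\<i> * complex_of_real (k * x))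
                        + b12 * complex_of_real (exp (- k * x))))
          \<in> O[at_top](\<lambda>x. complex_of_real (exp (- \<kappa> * x)))"
      and asym22: "\<And>\<kappa>. \<kappa> > 0 \<Longrightarrow>
        (\<lambda>x. psi2 x - (s22 * exp (- \<i> * complex_of_real (k * x)) + b22 * complex_of_real (exp (k * x))))
          \<in> O[at_bot](\<lambda>x. complex_of_real (exp (\<kappa> * x)))"
  shows "s11 * cnj b11 + s12 * cnj b12 = b12 \<and>
         s11 * cnj b21 + s12 * cnj b22 = b22 \<and>
         s21 * cnj b11 + s22 * cnj b12 = b11 \<and>
         s21 * cnj b21 + s22 * cnj b22 = b21"
proof -
  have "integrable lborel (\<lambda>t. v0 t * exp (a * \<bar>t\<bar>))" "integrable lborel (\<lambda>t. v1 t * exp (a * \<bar>t\<bar>))" for a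
    using integrable_exp_of_superexponential_decay[OF v0_L1 v0_decay]
      integrable_exp_of_superexponential_decay[OF v1_L1 v1_decay] by blast+
  then interpret potentials v0 v1 by unfold_locales
  let ?k = "complex_of_real k"
  have k0: "?k \<noteq> 0" and k2: "0 < 2 * k" using k_pos by simp_all
  have um4: "qderiv ?k 0 x (vec4 a b c d) = a * exp (\<i> * complex_of_real (k * x)) + b * exp (- \<i> * complex_of_real (k * x))
      + c * complex_of_real (exp (k * x)) + d * complex_of_real (exp (- k * x))" for x a b c d
    by (simp add: qderiv_def sum_4 exp_of_real[symmetric] mult_ac)
  have ph: "phi1 x = qderiv ?k 0 x (vec4 1 0 0 0)" "dphi1 x = qderiv ?k 1 x (vec4 1 0 0 0)"
    "phi2 x = qderiv ?k 0 x (vec4 0 1 0 0)" "dphi2 x = qderiv ?k 1 x (vec4 0 1 0 0)" for x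
    by (simp_all add: phi1_def phi2_def dphi1_def dphi2_def qderiv_def sum_4 mult.assoc)
  have adm: "admissible phi1 dphi1" "admissible phi2 dphi2"
    unfolding admissible_def phi1_def phi2_def dphi1_def dphi2_def
    by (auto intro!: continuous_intros exI[of _ "max 1 k"] simp: norm_mult norm_exp_eq_Re k_pos less_imp_le)
  from wave_function_solution[OF k_pos adm(1) ph(1,2) psi1[unfolded lam_def], unfolded vec4_nth]
  obtain C1 c1 where C1: "global_solution (ampl_ode0 ?k) c1 C1" and u1: "\<And>x. psi1 x = qderiv ?k 0 x (C1 x)"
    and c1: "c1 $ 1 = 1" "c1 $ 4 = 0" "end_value (ampl_ode0 ?k) c1 C1 $ 2 = 0" "end_value (ampl_ode0 ?k) c1 C1 $ 3 = 0"
    by metis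
  from wave_function_solution[OF k_pos adm(2) ph(3,4) psi2[unfolded lam_def], unfolded vec4_nth]
  obtain C2 c2 where C2: "global_solution (ampl_ode0 ?k) c2 C2" and u2: "\<And>x. psi2 x = qderiv ?k 0 x (C2 x)"
    and c2: "c2 $ 1 = 0" "c2 $ 4 = 0" "end_value (ampl_ode0 ?k) c2 C2 $ 2 = 1" "end_value (ampl_ode0 ?k) c2 C2 $ 3 = 0"
    by metis
  have d1: "end_value (ampl_ode0 ?k) c1 C1 = vec4 s11 0 0 b11"
    by (rule match_top[OF k_pos C1]) (use c1 asym11[OF k2] in \<open>simp_all add: um4 u1\<close>)
  have d2: "end_value (ampl_ode0 ?k) c2 C2 = vec4 s12 1 0 b12"
    by (rule match_top[OF k_pos C2]) (use c2 asym12[OF k2] in \<open>simp_all add: um4 u2 add_ac\<close>)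
  have c1: "c1 = vec4 1 s21 b21 0"
    by (rule match_bot[OF k_pos C1]) (use c1 asym21[OF k2] in \<open>simp_all add: um4 u1\<close>)
  have c2: "c2 = vec4 0 s22 b22 0"
    by (rule match_bot[OF k_pos C2]) (use c2 asym22[OF k2] in \<open>simp_all add: um4 u2\<close>)
  note C1' = solution_conj4[OF C1] and C2' = solution_conj4[OF C2]
  \<comment> \<open>At each end only one of the two real exponentials is present in either solution,
    so their product term in \<open>wronskian\<close> vanishes and no \<open>b\<close> enters. The
    same holds in the three conjugate pairings below, where pairing a solution with its own
    conjugate expresses conservation of flux.\<close>
  have w12: "s11 = s22"
    using wronskian_conserved[OF k0 C1 C2] unfolding d1 d2 unfolding c1 c2 by (simp add: wronskian_def)
  have w11: "s11 * cnj s11 + s21 * cnj s21 = 1"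
    using wronskian_conserved[OF k0 C1 C1'(1)] unfolding C1'(2) d1 unfolding c1 by (simp add: wronskian_def conj4_def algebra_simps)
  have w22: "s12 * cnj s12 + s22 * cnj s22 = 1"
    using wronskian_conserved[OF k0 C2 C2'(1)] unfolding C2'(2) d2 unfolding c2 by (simp add: wronskian_def conj4_def algebra_simps)
  have "- (s21 * cnj s22) = s11 * cnj s12"
    using wronskian_conserved[OF k0 C1 C2'(1)] unfolding C2'(2) d1 d2 unfolding c1 c2 by (simp add: wronskian_def conj4_def)
  then have w21: "s21 * cnj s22 + s11 * cnj s12 = 0" by (metis add.right_inverse)
  then have w21': "cnj s21 * s22 + cnj s11 * s12 = 0"
    by (metis complex_cnj_add complex_cnj_cnj complex_cnj_mult complex_cnj_zero)
  \<comment> \<open>The amplitudes required to be zero are the oscillating and growing ones at each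
    end. The identities sit in the two that are left: the third at -infinity and the fourth at
    +infinity.\<close>
  have vanish: "a *s conj4 c1 + (b *s conj4 c2 + (-1) *s c) = 0 \<and> a *s conj4 (end_value (ampl_ode0 ?k) c1 C1)
      + (b *s conj4 (end_value (ampl_ode0 ?k) c2 C2) + (-1) *s end_value (ampl_ode0 ?k) c C) = 0"
    if C: "global_solution (ampl_ode0 ?k) c C"
      and "(a *s conj4 c1 + (b *s conj4 c2 + (-1) *s c)) $ 1 = 0" "(a *s conj4 c1 + (b *s conj4 c2 + (-1) *s c)) $ 2 = 0"
      "(a *s conj4 c1 + (b *s conj4 c2 + (-1) *s c)) $ 4 = 0"
      "(a *s conj4 (end_value (ampl_ode0 ?k) c1 C1) + (b *s conj4 (end_value (ampl_ode0 ?k) c2 C2) + (-1) *s end_value (ampl_ode0 ?k) c C)) $ 1 = 0"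
      "(a *s conj4 (end_value (ampl_ode0 ?k) c1 C1) + (b *s conj4 (end_value (ampl_ode0 ?k) c2 C2) + (-1) *s end_value (ampl_ode0 ?k) c C)) $ 2 = 0"
      "(a *s conj4 (end_value (ampl_ode0 ?k) c1 C1) + (b *s conj4 (end_value (ampl_ode0 ?k) c2 C2) + (-1) *s end_value (ampl_ode0 ?k) c C)) $ 3 = 0"
    for a b c C
  proof -
    note s1 = solution_scale[OF C1'(1), of a] and s2 = solution_scale[OF C2'(1), of b] and s3 = solution_scale[OF C, of "-1"]
    note a2 = solution_add[OF s2(1) s3(1)]
    note a1 = solution_add[OF s1(1) a2(1)]
    have ev: "end_value (ampl_ode0 ?k) (a *s conj4 c1 + (b *s conj4 c2 + (-1) *s c)) (\<lambda>x. a *s conj4 (C1 x) + (b *s conj4 (C2 x) + (-1) *s C x))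
      = a *s conj4 (end_value (ampl_ode0 ?k) c1 C1) + (b *s conj4 (end_value (ampl_ode0 ?k) c2 C2) + (-1) *s end_value (ampl_ode0 ?k) c C)"
      unfolding a1(2) a2(2) s1(2) s2(2) s3(2) C1'(2) C2'(2) ..
    show ?thesis
      using decaying_solution_vanishes[OF k_pos not_eig[unfolded lam_def] a1(1)] that(2-) unfolding ev by blast
  qed
  \<comment> \<open>With the first row of the scattering matrix as coefficients, \<open>w12\<close>
    and \<open>w21'\<close> cancel the oscillating amplitudes at -infinity and \<open>w22\<close>
    the one of \<open>exp (- \<i> k x)\<close> at +infinity; the other one there cancels
    trivially.\<close>
  have "s11 * cnj b11 + s12 * cnj b12 = b12 \<and> s11 * cnj b21 + s12 * cnj b22 = b22"
    using vanish[OF C2, of s11 s12] w12 w22 w21' unfolding d1 d2 unfolding c1 c2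
    by (simp add: conj4_def vec4_eq_iff mult.commute add.commute add_diff_eq)
  moreover have "s21 * cnj b11 + s22 * cnj b12 = b11 \<and> s21 * cnj b21 + s22 * cnj b22 = b21"
    using vanish[OF C1, of s21 s22] w12 w11 w21 unfolding d1 d2 unfolding c1 c2
    by (simp add: conj4_def vec4_eq_iff mult.commute add.commute add_diff_eq)
  ultimately show ?thesis by blast
qed

end
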